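(* Let $R$ be a non-trivial commutative Noetherian ring with identity, let $\mathfrak{a}$ be an ideal of $R$ and let $M$ be a non-zero finitely generated $R$-module. Then the $R$-module $H^{\operatorname{grade}_{\mathfrak{a}}(M)}_{\mathfrak{a}}(M)$ has finite Goldie dimension.
   Context: $H^i_{\mathfrak{a}}(-)$ denotes the $i$-th local cohomology functor with respect to $\mathfrak{a}$, i.e. the $i$-th right derived functor of the $\mathfrak{a}$-torsion functor $\Gamma_{\mathfrak{a}}(X) = \bigcup_{t\in\mathbb{N}} (0:_X \mathfrak{a}^t)$. $\operatorname{grade}_{\mathfrak{a}}(M)$ denotes the length of a maximal $M$-regular sequence contained in $\mathfrak{a}$. An $R$-module $X$ is said to have finite Goldie dimension if $X$ does not contain an infinite direct sum of non-zero submodules, or equivalently if the injective hull $E_R(X)$ of $X$ decomposes as a finite direct sum of indecomposable (injective) submodules. *)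

theory Defs
  imports "HOL-Algebra.Module" "HOL-Algebra.AbelCoset" "HOL-Algebra.Ideal_Product"
    "HOL-Algebra.Ring_Divisibility"
begin

section \<open>Modules\<close>

definition module_hom ::
  "('a, 'r) ring_scheme \<Rightarrow> ('a, 'm, 'x) module_scheme \<Rightarrow> ('a, 'n, 'y) module_scheme \<Rightarrow> ('m \<Rightarrow> 'n) set"
  where "module_hom R M N =
    {f \<in> carrier M \<rightarrow> carrier N.
       (\<forall>x\<in>carrier M. \<forall>y\<in>carrier M. f (x \<oplus>\<^bsub>M\<^esub> y) = f x \<oplus>\<^bsub>N\<^esub> f y) \<and>
       (\<forall>r\<in>carrier R. \<forall>x\<in>carrier M. f (r \<odot>\<^bsub>M\<^esub> x) = r \<odot>\<^bsub>N\<^esub> f x)}"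

definition module_span ::
  "('a, 'r) ring_scheme \<Rightarrow> ('a, 'm, 'x) module_scheme \<Rightarrow> 'm set \<Rightarrow> 'm set"
  where "module_span R M S = \<Inter> {N. submodule N R M \<and> S \<subseteq> N}"

definition finitely_generated_module ::
  "('a, 'r) ring_scheme \<Rightarrow> ('a, 'm, 'x) module_scheme \<Rightarrow> bool"
  where "finitely_generated_module R M \<longleftrightarrow>
    (\<exists>S. finite S \<and> S \<subseteq> carrier M \<and> module_span R M S = carrier M)"

text \<open>
  The quotient of \<open>M\<close> by a submodule \<open>N\<close>, on the additive cosets of \<open>N\<close>. The record type
  \<open>module\<close> extends \<open>ring\<close>, but its fields \<open>mult\<close> and \<open>one\<close> play no role for modules.
\<close>

definition quotient_module ::
  "('a, 'm, 'x) module_scheme \<Rightarrow> 'm set \<Rightarrow> ('a, 'm set) module"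
  where "quotient_module M N =
    \<lparr>carrier = a_rcosets\<^bsub>M\<^esub> N, monoid.mult = undefined, one = undefined,
     zero = N, add = set_add M,
     smult = (\<lambda>r C. \<Union>x\<in>C. N +>\<^bsub>M\<^esub> (r \<odot>\<^bsub>M\<^esub> x))\<rparr>"

text \<open>
  HOL cannot quantify over the carrier types of the test modules \<open>A\<close> and \<open>B\<close>, so they range
  over all modules whose carrier lies in the element type of \<open>R\<close>. These include \<open>R\<close> and all of
  its ideals; hence, by Baer's criterion, this is injectivity with respect to all modules.
\<close>

definition injective_module ::
  "('a, 'r) ring_scheme \<Rightarrow> ('a, 'e, 'x) module_scheme \<Rightarrow> bool"
  where "injective_module R E \<longleftrightarrow> module R E \<and>
    (\<forall>(A :: ('a, 'a) module) (B :: ('a, 'a) module) i f.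
       module R A \<and> module R B \<and>
       i \<in> module_hom R A B \<and> inj_on i (carrier A) \<and> f \<in> module_hom R A E \<longrightarrow>
       (\<exists>g \<in> module_hom R B E. \<forall>x\<in>carrier A. g (i x) = f x))"


section \<open>Local cohomology\<close>

text \<open>
  Exactness of \<open>0 \<rightarrow> M \<rightarrow> I 0 \<rightarrow> I 1 \<rightarrow> \<dots>\<close>, with augmentation \<open>e\<close> and differentials \<open>d\<close>,
  and injectivity of all the \<open>I n\<close>.
\<close>

definition injective_resolution ::
  "('a, 'r) ring_scheme \<Rightarrow> ('a, 'm, 'x) module_scheme \<Rightarrow>
   (nat \<Rightarrow> ('a, 'e, 'y) module_scheme) \<Rightarrow> (nat \<Rightarrow> 'e \<Rightarrow> 'e) \<Rightarrow> ('m \<Rightarrow> 'e) \<Rightarrow> bool"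
  where "injective_resolution R M I d e \<longleftrightarrow>
    (\<forall>n. injective_module R (I n)) \<and>
    e \<in> module_hom R M (I 0) \<and>
    (\<forall>n. d n \<in> module_hom R (I n) (I (Suc n))) \<and>
    inj_on e (carrier M) \<and>
    e ` carrier M = a_kernel (I 0) (I 1) (d 0) \<and>
    (\<forall>n. d n ` carrier (I n) = a_kernel (I (Suc n)) (I (Suc (Suc n))) (d (Suc n)))"

definition coboundaries ::
  "(nat \<Rightarrow> ('a, 'e, 'y) module_scheme) \<Rightarrow> (nat \<Rightarrow> 'e \<Rightarrow> 'e) \<Rightarrow> nat \<Rightarrow> 'e set"
  where "coboundaries C d i =
    (case i of 0 \<Rightarrow> {\<zero>\<^bsub>C 0\<^esub>} | Suc j \<Rightarrow> d j ` carrier (C j))"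

definition cohomology_module ::
  "(nat \<Rightarrow> ('a, 'e, 'y) module_scheme) \<Rightarrow> (nat \<Rightarrow> 'e \<Rightarrow> 'e) \<Rightarrow> nat \<Rightarrow> ('a, 'e set) module"
  where "cohomology_module C d i =
    quotient_module ((C i)\<lparr>carrier := a_kernel (C i) (C (Suc i)) (d i)\<rparr>) (coboundaries C d i)"

text \<open>
  The \<open>\<aa>\<close>-torsion submodule, the union over \<open>t\<close> of the annihilators in \<open>X\<close> of the ideal
  powers \<open>\<aa>\<^sup>t\<close>. The latter are powers in the multiplicative monoid \<open>ideals_set R\<close> of ideals.
\<close>

definition torsion_module ::
  "('a, 'r) ring_scheme \<Rightarrow> 'a set \<Rightarrow> ('a, 'e, 'y) module_scheme \<Rightarrow> ('a, 'e, 'y) module_scheme"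
  where "torsion_module R \<aa> X =
    X\<lparr>carrier := (\<Union>t::nat. {x \<in> carrier X. \<forall>r \<in> \<aa> [^]\<^bsub>ideals_set R\<^esub> t. r \<odot>\<^bsub>X\<^esub> x = \<zero>\<^bsub>X\<^esub>})\<rparr>"

text \<open>
  The \<open>i\<close>-th right derived functor of the \<open>\<aa>\<close>-torsion functor, computed from an injective
  resolution \<open>I\<close> with differentials \<open>d\<close>. On morphisms the torsion functor is restriction, so the
  functions \<open>d\<close> are unchanged.
\<close>

definition local_cohomology ::
  "('a, 'r) ring_scheme \<Rightarrow> 'a set \<Rightarrow> (nat \<Rightarrow> ('a, 'e, 'y) module_scheme) \<Rightarrow> (nat \<Rightarrow> 'e \<Rightarrow> 'e) \<Rightarrow>
   nat \<Rightarrow> ('a, 'e set) module"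
  where "local_cohomology R \<aa> I d i = cohomology_module (\<lambda>n. torsion_module R \<aa> (I n)) d i"


section \<open>Grade\<close>

definition nonzerodivisor_on :: "('a, 'm, 'x) module_scheme \<Rightarrow> 'a \<Rightarrow> bool"
  where "nonzerodivisor_on M r \<longleftrightarrow> (\<forall>x\<in>carrier M. r \<odot>\<^bsub>M\<^esub> x = \<zero>\<^bsub>M\<^esub> \<longrightarrow> x = \<zero>\<^bsub>M\<^esub>)"

definition quotient_by_sequence ::
  "('a, 'r) ring_scheme \<Rightarrow> ('a, 'm, 'x) module_scheme \<Rightarrow> 'a list \<Rightarrow> ('a, 'm set) module"
  where "quotient_by_sequence R M xs =
    quotient_module M (module_span R M {r \<odot>\<^bsub>M\<^esub> x |r x. r \<in> set xs \<and> x \<in> carrier M})"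

definition regular_sequence ::
  "('a, 'r) ring_scheme \<Rightarrow> ('a, 'm, 'x) module_scheme \<Rightarrow> 'a list \<Rightarrow> bool"
  where "regular_sequence R M xs \<longleftrightarrow>
    set xs \<subseteq> carrier R \<and>
    (\<forall>i<length xs. nonzerodivisor_on (quotient_by_sequence R M (take i xs)) (xs ! i)) \<and>
    carrier (quotient_by_sequence R M xs) \<noteq> {\<zero>\<^bsub>quotient_by_sequence R M xs\<^esub>}"

definition maximal_regular_sequence ::
  "('a, 'r) ring_scheme \<Rightarrow> 'a set \<Rightarrow> ('a, 'm, 'x) module_scheme \<Rightarrow> 'a list \<Rightarrow> bool"
  where "maximal_regular_sequence R \<aa> M xs \<longleftrightarrow>
    regular_sequence R M xs \<and> set xs \<subseteq> \<aa> \<and> (\<forall>y\<in>\<aa>. \<not> regular_sequence R M (xs @ [y]))"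

text \<open>
  For \<open>M\<close> finitely generated over a Noetherian ring with \<open>\<aa>M \<noteq> M\<close>, all maximal \<open>M\<close>-regular
  sequences in \<open>\<aa>\<close> have the same length. If \<open>\<aa>M = M \<noteq> 0\<close>, such sequences still exist, but
  their length need not be unique and the value is the length of some such sequence.
\<close>

definition module_grade ::
  "('a, 'r) ring_scheme \<Rightarrow> 'a set \<Rightarrow> ('a, 'm, 'x) module_scheme \<Rightarrow> nat"
  where "module_grade R \<aa> M = (SOME n. \<exists>xs. maximal_regular_sequence R \<aa> M xs \<and> length xs = n)"


section \<open>Goldie dimension\<close>

text \<open>The sum of the submodules in \<open>\<N>\<close> is direct.\<close>

definition direct_family :: "('a, 'm, 'x) module_scheme \<Rightarrow> 'm set set \<Rightarrow> bool"
  where "direct_family X \<N> \<longleftrightarrow>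
    (\<forall>F x. F \<subseteq> \<N> \<and> finite F \<and> (\<forall>N\<in>F. x N \<in> N) \<and> (\<Oplus>\<^bsub>X\<^esub>N\<in>F. x N) = \<zero>\<^bsub>X\<^esub>
       \<longrightarrow> (\<forall>N\<in>F. x N = \<zero>\<^bsub>X\<^esub>))"

text \<open>
  Non-zero submodules whose sum is direct are pairwise distinct, so nothing is lost by considering
  sets instead of indexed families of submodules.
\<close>

definition finite_Goldie_dimension ::
  "('a, 'r) ring_scheme \<Rightarrow> ('a, 'm, 'x) module_scheme \<Rightarrow> bool"
  where "finite_Goldie_dimension R X \<longleftrightarrow>
    \<not> (\<exists>\<N>. infinite \<N> \<and> (\<forall>N\<in>\<N>. submodule N R X \<and> N \<noteq> {\<zero>\<^bsub>X\<^esub>}) \<and> direct_family X \<N>)"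

end

theory Submission
  imports Defs
begin

text \<open>
  Let \<open>x\<^sub>1, \<dots>, x\<^sub>h\<close> be an \<open>M\<close>-regular sequence in \<open>\<aa>\<close>. Start from an injective resolution, whose only
  cohomology is \<open>M\<close> in degree \<open>0\<close>, and pass to the subcomplex of torsion elements for
  \<open>x\<^sub>1, \<dots>, x\<^sub>h\<close>, one \<open>x\<^sub>i\<close> at a time. If \<open>x\<close> is regular on the only cohomology module \<open>H\<close> of a
  complex, the \<open>x\<close>-torsion subcomplex has only cohomology \<open>H\<^sub>x / H\<close>, one degree higher. In that module
  every non-zero element has a non-zero multiple in the copy \<open>x\<^sup>-\<^sup>1H / H\<close> of \<open>H / xH\<close>, and the rest of
  the sequence stays regular. Hence after \<open>h\<close> steps the cohomology in degree \<open>h\<close> has finite Goldie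
  dimension because the Noetherian module \<open>M / (x\<^sub>1, \<dots>, x\<^sub>h)M\<close> does. As the cohomology vanishes in
  degrees below \<open>h\<close>, passing further to the torsion elements for the generators of \<open>\<aa>\<close> replaces the
  cohomology in degree \<open>h\<close> by a submodule. Over a Noetherian ring torsion submodules inherit Baer's
  extension property, which is the only form of injectivity that is needed.
\<close>

section \<open>Noetherian rings and Baer's criterion\<close>

text \<open>The construction stays inside the modules \<open>I n\<close>: a cohomology module is a
  pair of submodules \<open>U\<close>, \<open>N\<close> standing for N/U, a subcomplex is a family
  of subsets \<open>J n\<close>, and the identification of H_x/H with the next cohomology is a
  relation between representatives. That relation is the connecting map of 0 -> Gamma_x(J) -> J ->
  J_x -> 0, so J -> J_x has to be onto. Since x may be a zero divisor, Baer's property does not make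
  multiplication by x onto on J; it gives divisibility only up to x-torsion, which is exactly
  surjectivity onto J_x. Two facts on a regular sequence a, b on H carry regularity through a step:
  a is regular on H/bH, and b is regular on every H/a^j H. Goldie dimension is carried through by
  one transfer principle: finiteness passes to submodules and to essential extensions. Independent
  sequences replace infinite direct sums, so that only multiples of elements and spans of
  predecessors have to be followed.\<close>

lemma (in noetherian_ring) ideal_chain_stabilizes:
  assumes "\<And>n. ideal (A n) R" and "\<And>n::nat. A n \<subseteq> A (Suc n)"
  obtains N where "\<And>n. N \<le> n \<Longrightarrow> A n = A N"
proof -
  have mono: "A m \<subseteq> A n" if "m \<le> n" for m n
    using lift_Suc_mono_le[of A, OF assms(2) that] .
  have "subset.chain {I. ideal I R} (range A)"
    unfolding pred_on.chain_def using assms(1) mono nat_le_linear by blast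
  then have "\<Union>(range A) \<in> range A"
    by (intro ideal_chain_is_trivial) auto
  then obtain N where "\<Union>(range A) = A N" by auto
  then show ?thesis using mono that[of N] by blast
qed

lemma (in noetherian_ring) ideal_set_has_maximal:
  assumes "S \<noteq> {}" and "\<And>I. I \<in> S \<Longrightarrow> ideal I R"
  obtains I where "I \<in> S" "\<And>K. K \<in> S \<Longrightarrow> I \<subseteq> K \<Longrightarrow> K = I"
proof -
  have "\<exists>U\<in>S. \<forall>X\<in>C. X \<subseteq> U" if C: "subset.chain S C" for C
  proof (cases "C = {}")
    case True
    then show ?thesis using assms(1) by auto
  next
    case False
    have "subset.chain {I. ideal I R} C"
      using C assms(2) unfolding pred_on.chain_def by blast
    then have "\<Union>C \<in> C" using ideal_chain_is_trivial False by blast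
    moreover have "C \<subseteq> S" using C by (simp add: pred_on.chain_def)
    ultimately show ?thesis by blast
  qed
  then have "\<exists>I\<in>S. \<forall>X\<in>S. I \<subseteq> X \<longrightarrow> X = I" by (rule subset_Zorn)
  then show ?thesis using that by blast
qed

lemma (in cring) ideal_colon:
  assumes "ideal I R" "a \<in> carrier R"
  shows "ideal {r \<in> carrier R. a \<otimes> r \<in> I} R"
proof (rule idealI)
  interpret I: ideal I R by fact
  show "ring R" by (rule ring_axioms)
  show "subgroup {r \<in> carrier R. a \<otimes> r \<in> I} (add_monoid R)"
  proof (rule add.subgroupI)
    have "\<zero> \<in> {r \<in> carrier R. a \<otimes> r \<in> I}" using assms(2) by simp
    then show "{r \<in> carrier R. a \<otimes> r \<in> I} \<noteq> {}" by blast
  qed (use assms(2) in \<open>auto simp: r_minus r_distr\<close>)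
  show "y \<otimes> r \<in> {r \<in> carrier R. a \<otimes> r \<in> I}"
    if "r \<in> {r \<in> carrier R. a \<otimes> r \<in> I}" "y \<in> carrier R" for r y
    using that assms(2) I.I_l_closed[of "a \<otimes> r" y] m_lcomm[of y a r] by auto
  then show "r \<otimes> y \<in> {r \<in> carrier R. a \<otimes> r \<in> I}"
    if "r \<in> {r \<in> carrier R. a \<otimes> r \<in> I}" "y \<in> carrier R" for r y
    using that m_comm[of r y] by auto
qed

text \<open>Gamma_x(J), kept as a subset of the ambient module so that torsion can be taken
  repeatedly without a change of type.\<close>

definition power_torsion :: "('a, 'r) ring_scheme \<Rightarrow> ('a, 'm, 'x) module_scheme \<Rightarrow> 'a \<Rightarrow> 'm set \<Rightarrow> 'm set"
  where "power_torsion R M x J = {z \<in> J. \<exists>k::nat. (x [^]\<^bsub>R\<^esub> k) \<odot>\<^bsub>M\<^esub> z = \<zero>\<^bsub>M\<^esub>}"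

text \<open>
  A partial homomorphism from an ideal of \<open>R\<close> to \<open>J\<close> is represented by its graph.
\<close>

definition linear_relation :: "('a, 'r) ring_scheme \<Rightarrow> ('a, 'm, 'x) module_scheme \<Rightarrow> ('a \<times> 'm) set \<Rightarrow> bool"
  where "linear_relation R M G \<longleftrightarrow> (\<zero>\<^bsub>R\<^esub>, \<zero>\<^bsub>M\<^esub>) \<in> G \<and>
    (\<forall>r v s w. (r, v) \<in> G \<and> (s, w) \<in> G \<longrightarrow> (r \<oplus>\<^bsub>R\<^esub> s, v \<oplus>\<^bsub>M\<^esub> w) \<in> G) \<and>
    (\<forall>s\<in>carrier R. \<forall>r v. (r, v) \<in> G \<longrightarrow> (s \<otimes>\<^bsub>R\<^esub> r, s \<odot>\<^bsub>M\<^esub> v) \<in> G)"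

text \<open>Baer's criterion in terms of graphs: a homomorphism from an ideal to \<open>J\<close> is
  multiplication by an element of \<open>J\<close>. A linear graph is single-valued once its fibre
  over zero is trivial.\<close>

definition baer :: "('a, 'r) ring_scheme \<Rightarrow> ('a, 'm, 'x) module_scheme \<Rightarrow> 'm set \<Rightarrow> bool"
  where "baer R M J \<longleftrightarrow> submodule J R M \<and>
    (\<forall>G. G \<subseteq> carrier R \<times> J \<and> linear_relation R M G \<and> (\<forall>v. (\<zero>\<^bsub>R\<^esub>, v) \<in> G \<longrightarrow> v = \<zero>\<^bsub>M\<^esub>) \<longrightarrow>
      (\<exists>u\<in>J. \<forall>r v. (r, v) \<in> G \<longrightarrow> v = r \<odot>\<^bsub>M\<^esub> u))"

section \<open>Baer's extension property: torsion submodules and divisibility\<close>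

context module
begin

lemma minus_zero_eq: "\<ominus>\<^bsub>M\<^esub> \<zero>\<^bsub>M\<^esub> = \<zero>\<^bsub>M\<^esub>"
  using M.minus_equality[of "\<zero>\<^bsub>M\<^esub>" "\<zero>\<^bsub>M\<^esub>"] by simp

lemma minus_eq_zero_imp_eq:
  assumes "z \<in> carrier M" "w \<in> carrier M" "z \<ominus>\<^bsub>M\<^esub> w = \<zero>\<^bsub>M\<^esub>"
  shows "z = w"
  using M.minus_equality[of z "\<ominus>\<^bsub>M\<^esub> w"] assms by (simp add: a_minus_def M.minus_minus)

lemma smult_left_commute:
  "a \<in> carrier R \<Longrightarrow> b \<in> carrier R \<Longrightarrow> z \<in> carrier M \<Longrightarrow>
    a \<odot>\<^bsub>M\<^esub> (b \<odot>\<^bsub>M\<^esub> z) = b \<odot>\<^bsub>M\<^esub> (a \<odot>\<^bsub>M\<^esub> z)"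
  by (metis R.m_comm smult_assoc1)

lemma smult_pow_add:
  "a \<in> carrier R \<Longrightarrow> z \<in> carrier M \<Longrightarrow>
    (a [^] (k + l::nat)) \<odot>\<^bsub>M\<^esub> z = (a [^] k) \<odot>\<^bsub>M\<^esub> ((a [^] l) \<odot>\<^bsub>M\<^esub> z)"
  by (simp add: R.nat_pow_mult[symmetric] smult_assoc1)

lemma smult_minus_distr:
  "a \<in> carrier R \<Longrightarrow> z \<in> carrier M \<Longrightarrow> w \<in> carrier M \<Longrightarrow>
    a \<odot>\<^bsub>M\<^esub> (z \<ominus>\<^bsub>M\<^esub> w) = a \<odot>\<^bsub>M\<^esub> z \<ominus>\<^bsub>M\<^esub> a \<odot>\<^bsub>M\<^esub> w"
  by (simp add: a_minus_def smult_r_distr smult_r_minus)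

lemma submodule_carrier: "submodule N R M \<Longrightarrow> z \<in> N \<Longrightarrow> z \<in> carrier M"
  using submoduleE(1) by blast

lemma submodule_zero: "submodule N R M \<Longrightarrow> \<zero>\<^bsub>M\<^esub> \<in> N"
  using submoduleE(2,4) submodule_carrier
  by (metis M.r_neg all_not_in_conv submoduleE(3,5))

lemma submodule_minus: "submodule N R M \<Longrightarrow> z \<in> N \<Longrightarrow> w \<in> N \<Longrightarrow> z \<ominus>\<^bsub>M\<^esub> w \<in> N"
  by (simp add: a_minus_def submoduleE(3,5))

lemma smult_pow_zero_mono:
  "a \<in> carrier R \<Longrightarrow> z \<in> carrier M \<Longrightarrow> (a [^] (k::nat)) \<odot>\<^bsub>M\<^esub> z = \<zero>\<^bsub>M\<^esub> \<Longrightarrow> k \<le> l \<Longrightarrow>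
    (a [^] l) \<odot>\<^bsub>M\<^esub> z = \<zero>\<^bsub>M\<^esub>"
  by (metis le_add_diff_inverse2 R.nat_pow_closed smult_pow_add smult_r_null)

lemma submodule_zero_submodule: "submodule {\<zero>\<^bsub>M\<^esub>} R M"
  by (rule submoduleI) (auto simp: minus_zero_eq)

lemma submodule_power_torsion:
  assumes "x \<in> carrier R" "submodule J R M"
  shows "submodule (power_torsion R M x J) R M"
proof (rule submoduleI)
  have C: "z \<in> carrier M" if "z \<in> J" for z using assms(2) submodule_carrier that by blast
  show "power_torsion R M x J \<subseteq> carrier M" using C by (auto simp: power_torsion_def)
  show "\<zero>\<^bsub>M\<^esub> \<in> power_torsion R M x J"
    using assms by (auto simp: power_torsion_def submodule_zero)
  show "\<ominus>\<^bsub>M\<^esub> a \<in> power_torsion R M x J" if "a \<in> power_torsion R M x J" for a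
    using that assms by (auto simp: power_torsion_def submoduleE(3) C smult_r_minus minus_zero_eq)
  show "a \<oplus>\<^bsub>M\<^esub> b \<in> power_torsion R M x J"
    if "a \<in> power_torsion R M x J" "b \<in> power_torsion R M x J" for a b
  proof -
    from that obtain k l :: nat where "(x [^] k) \<odot>\<^bsub>M\<^esub> a = \<zero>\<^bsub>M\<^esub>" "(x [^] l) \<odot>\<^bsub>M\<^esub> b = \<zero>\<^bsub>M\<^esub>" "a \<in> J" "b \<in> J"
      by (auto simp: power_torsion_def)
    then have "(x [^] (max k l)) \<odot>\<^bsub>M\<^esub> (a \<oplus>\<^bsub>M\<^esub> b) = \<zero>\<^bsub>M\<^esub>"
      using smult_pow_zero_mono[OF assms(1), of a k "max k l"] smult_pow_zero_mono[OF assms(1), of b l "max k l"] C assms(1)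
      by (simp add: smult_r_distr)
    then show ?thesis using \<open>a \<in> J\<close> \<open>b \<in> J\<close> assms(2) by (auto simp: power_torsion_def submoduleE(5))
  qed
  show "a \<odot>\<^bsub>M\<^esub> b \<in> power_torsion R M x J" if "a \<in> carrier R" "b \<in> power_torsion R M x J" for a b
    using that assms unfolding power_torsion_def
    by (smt (verit) C mem_Collect_eq R.nat_pow_closed smult_left_commute smult_r_null submoduleE(4))
qed

lemma linear_relation_minus:
  assumes "linear_relation R M G" "G \<subseteq> carrier R \<times> carrier M" "(r, v) \<in> G" "(s, w) \<in> G"
  shows "(r \<ominus> s, v \<ominus>\<^bsub>M\<^esub> w) \<in> G"
proof -
  have C: "r \<in> carrier R" "s \<in> carrier R" "v \<in> carrier M" "w \<in> carrier M" using assms by auto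
  have "((\<ominus> \<one>) \<otimes> s, (\<ominus> \<one>) \<odot>\<^bsub>M\<^esub> w) \<in> G"
    using assms unfolding linear_relation_def by (meson R.add.inv_closed R.one_closed)
  then have "(\<ominus> s, \<ominus>\<^bsub>M\<^esub> w) \<in> G" using C by (simp add: R.l_minus smult_l_minus)
  then show ?thesis
    using assms(1,3) unfolding linear_relation_def by (simp add: a_minus_def R.minus_eq)
qed

lemma linear_relation_functional:
  assumes "linear_relation R M G" "G \<subseteq> carrier R \<times> carrier M"
    and "\<forall>v. (\<zero>, v) \<in> G \<longrightarrow> v = \<zero>\<^bsub>M\<^esub>" "(r, v) \<in> G" "(r, w) \<in> G"
  shows "v = w"
proof -
  have "(r \<ominus> r, v \<ominus>\<^bsub>M\<^esub> w) \<in> G" using linear_relation_minus assms by blast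
  moreover have "r \<in> carrier R" "v \<in> carrier M" "w \<in> carrier M" using assms by auto
  ultimately show ?thesis using assms(3) by (metis minus_eq_zero_imp_eq R.r_right_minus_eq)
qed

lemma ideal_linear_relation_domain:
  assumes "linear_relation R M G" "G \<subseteq> carrier R \<times> carrier M"
  shows "ideal (Domain G) R"
proof (rule idealI)
  show "ring R" by (rule R.ring_axioms)
  show "subgroup (Domain G) (add_monoid R)"
  proof (rule R.add.subgroupI)
    show "Domain G \<noteq> {}" using assms(1) by (auto simp: linear_relation_def)
    show "\<ominus> a \<in> Domain G" if "a \<in> Domain G" for a
    proof -
      from that obtain v where v: "(a, v) \<in> G" by blast
      have "(\<zero> \<ominus> a, \<zero>\<^bsub>M\<^esub> \<ominus>\<^bsub>M\<^esub> v) \<in> G"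
        using linear_relation_minus[OF assms _ v] assms(1) by (auto simp: linear_relation_def)
      moreover have "\<zero> \<ominus> a = \<ominus> a" using v assms by (auto simp: R.minus_eq)
      ultimately show ?thesis by auto
    qed
    show "a \<oplus> b \<in> Domain G" if "a \<in> Domain G" "b \<in> Domain G" for a b
      using that assms(1) unfolding linear_relation_def by blast
  qed (use assms in auto)
  show "x \<otimes> a \<in> Domain G" if "a \<in> Domain G" "x \<in> carrier R" for a x
    using that assms(1) unfolding linear_relation_def by blast
  then show "a \<otimes> x \<in> Domain G" if "a \<in> Domain G" "x \<in> carrier R" for a x
    using that assms(2) by (metis Domain.cases R.m_comm SigmaD1 subsetD)
qed

text \<open>Let phi map an ideal b to Gamma_x(J). Baer's property of \<open>J\<close> alone gives an
  element u of \<open>J\<close> that need not be x-torsion. The ring being Noetherian, phi vanishes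
  on the part of b inside x^e R for some e, so it extends by zero to b + x^e R; the u belonging to
  this extension is killed by x^e.\<close>

lemma baer_power_torsion:
  assumes "noetherian_ring R" "baer R M J" "x \<in> carrier R"
  shows "baer R M (power_torsion R M x J)"
  unfolding baer_def
proof (intro conjI allI impI)
  have sub: "submodule J R M" using assms by (simp add: baer_def)
  have C: "z \<in> carrier M" if "z \<in> J" for z using sub submodule_carrier that by blast
  show "submodule (power_torsion R M x J) R M"
    using submodule_power_torsion assms by (simp add: baer_def)
  fix G
  assume "G \<subseteq> carrier R \<times> power_torsion R M x J \<and> linear_relation R M G \<and> (\<forall>v. (\<zero>, v) \<in> G \<longrightarrow> v = \<zero>\<^bsub>M\<^esub>)"
  then have G: "G \<subseteq> carrier R \<times> power_torsion R M x J" and lin: "linear_relation R M G"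
    and sv: "\<forall>v. (\<zero>, v) \<in> G \<longrightarrow> v = \<zero>\<^bsub>M\<^esub>" by auto
  have GM: "G \<subseteq> carrier R \<times> carrier M" using G C by (auto simp: power_torsion_def)
  have GD: "r \<in> carrier R" "v \<in> carrier M" "v \<in> J" if "(r, v) \<in> G" for r v
    using G that C by (auto simp: power_torsion_def)
  have add: "(r \<oplus> s, v \<oplus>\<^bsub>M\<^esub> w) \<in> G" if "(r, v) \<in> G" "(s, w) \<in> G" for r v s w
    using lin that by (auto simp: linear_relation_def)
  have smul: "(s \<otimes> r, s \<odot>\<^bsub>M\<^esub> v) \<in> G" if "(r, v) \<in> G" "s \<in> carrier R" for r v s
    using lin that by (auto simp: linear_relation_def)
  have zero: "(\<zero>, \<zero>\<^bsub>M\<^esub>) \<in> G" using lin by (auto simp: linear_relation_def)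
  interpret noetherian_ring R by fact
  have idb: "ideal (Domain G) R" using ideal_linear_relation_domain lin GM by blast
  have [simp]: "x [^] k \<in> carrier R" for k :: nat using assms(3) by simp
  \<comment> \<open>The ring elements whose value is killed by x^j form an ascending chain of
    ideals. Where the chain stops, j is one exponent that kills all values of
    \<open>G\<close>.\<close>
  define T where "T j = {(r, v) \<in> G. (x [^] j) \<odot>\<^bsub>M\<^esub> v = \<zero>\<^bsub>M\<^esub>}" for j :: nat
  have linT: "linear_relation R M (T j)" for j
    unfolding linear_relation_def
  proof (intro conjI allI ballI impI)
    show "(\<zero>, \<zero>\<^bsub>M\<^esub>) \<in> T j" using zero by (simp add: T_def)
    show "(r \<oplus> s, v \<oplus>\<^bsub>M\<^esub> w) \<in> T j" if "(r, v) \<in> T j \<and> (s, w) \<in> T j" for r v s w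
      using that add GD(2) by (auto simp: T_def smult_r_distr)
    show "(s \<otimes> r, s \<odot>\<^bsub>M\<^esub> v) \<in> T j" if "s \<in> carrier R" "(r, v) \<in> T j" for s r v
      using that smul GD(2) smult_left_commute[of "x [^] j" s v] by (auto simp: T_def)
  qed
  have "ideal (Domain (T j)) R" for j
  proof (rule ideal_linear_relation_domain[OF linT])
    show "T j \<subseteq> carrier R \<times> carrier M" using GM unfolding T_def by blast
  qed
  moreover have "Domain (T j) \<subseteq> Domain (T (Suc j))" for j
  proof -
    have "(r, v) \<in> T (Suc j)" if "(r, v) \<in> T j" for r v
      using that GD(2)[of r v] smult_pow_zero_mono[OF assms(3), of v j "Suc j"] by (simp add: T_def)
    then show ?thesis by blast
  qed
  ultimately obtain j where j: "\<And>n. j \<le> n \<Longrightarrow> Domain (T n) = Domain (T j)"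
    using ideal_chain_stabilizes[of "\<lambda>j. Domain (T j)"] by blast
  have killed: "(x [^] j) \<odot>\<^bsub>M\<^esub> v = \<zero>\<^bsub>M\<^esub>" if rv: "(r, v) \<in> G" for r v
  proof -
    obtain k :: nat where "(x [^] k) \<odot>\<^bsub>M\<^esub> v = \<zero>\<^bsub>M\<^esub>" using rv G by (auto simp: power_torsion_def)
    then have "(r, v) \<in> T (j + k)"
      using rv smult_pow_zero_mono[OF assms(3) GD(2)[OF rv], of k "j + k"] by (auto simp: T_def)
    then obtain w where "(r, w) \<in> T j" using j[of "j + k"] by auto
    moreover have "w = v"
      using linear_relation_functional[OF lin GM sv] rv calculation by (auto simp: T_def)
    ultimately show ?thesis by (auto simp: T_def)
  qed
  \<comment> \<open>The colon ideals of the domain of \<open>G\<close> by x^m. Once they stop at m,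
    an x^(m+j) r in the domain already has x^m r in the domain: an elementary case of
    Artin-Rees.\<close>
  define B where "B m = {r \<in> carrier R. x [^] m \<otimes> r \<in> Domain G}" for m :: nat
  have "ideal (B m) R" for m
    unfolding B_def by (rule R.ideal_colon[OF idb]) simp
  moreover have "B m \<subseteq> B (Suc m)" for m
  proof
    fix r assume "r \<in> B m"
    then have r: "r \<in> carrier R" "x [^] m \<otimes> r \<in> Domain G" by (auto simp only: B_def)
    moreover have "x [^] Suc m \<otimes> r = x \<otimes> (x [^] m \<otimes> r)"
      using r(1) assms(3) by (simp add: R.m_assoc R.m_lcomm[of "x [^] m" x])
    ultimately show "r \<in> B (Suc m)"
      unfolding B_def using ideal.I_l_closed[OF idb r(2) assms(3)] by simp
  qed
  ultimately obtain m where m: "\<And>n. m \<le> n \<Longrightarrow> B n = B m"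
    using ideal_chain_stabilizes[of B] by blast
  \<comment> \<open>Sending \<open>x [^] (m + j)\<close> to zero makes the representing element torsion; the choice of \<open>j\<close> and \<open>m\<close>
    makes the extended graph single-valued.\<close>
  define G' where "G' = {(r \<otimes> (x [^] (m + j)) \<oplus> b, v) | r b v. r \<in> carrier R \<and> (b, v) \<in> G}"
  have G'I: "(r \<otimes> (x [^] (m + j)) \<oplus> b, v) \<in> G'" if "r \<in> carrier R" "(b, v) \<in> G" for r b v
    unfolding G'_def using that by blast
  have "G' \<subseteq> carrier R \<times> J" using GD by (auto simp: G'_def)
  moreover have "linear_relation R M G'"
    unfolding linear_relation_def
  proof (intro conjI allI ballI impI)
    show "(\<zero>, \<zero>\<^bsub>M\<^esub>) \<in> G'" using G'I[OF R.zero_closed zero] by simp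
  next
    fix r v s w assume "(r, v) \<in> G' \<and> (s, w) \<in> G'"
    then obtain r1 b1 r2 b2 where "r = r1 \<otimes> (x [^] (m + j)) \<oplus> b1" "s = r2 \<otimes> (x [^] (m + j)) \<oplus> b2"
      "r1 \<in> carrier R" "r2 \<in> carrier R" "(b1, v) \<in> G" "(b2, w) \<in> G" by (auto simp: G'_def)
    moreover from this have "r \<oplus> s = (r1 \<oplus> r2) \<otimes> (x [^] (m + j)) \<oplus> (b1 \<oplus> b2)"
      using GD(1) by (simp add: R.l_distr R.a_ac)
    ultimately show "(r \<oplus> s, v \<oplus>\<^bsub>M\<^esub> w) \<in> G'" unfolding G'_def using add by blast
  next
    fix s r v assume s: "s \<in> carrier R" "(r, v) \<in> G'"
    then obtain r1 b1 where "r = r1 \<otimes> (x [^] (m + j)) \<oplus> b1" "r1 \<in> carrier R" "(b1, v) \<in> G"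
      by (auto simp: G'_def)
    moreover from this have "s \<otimes> r = (s \<otimes> r1) \<otimes> (x [^] (m + j)) \<oplus> (s \<otimes> b1)"
      using GD(1) s by (simp add: R.r_distr R.m_assoc)
    ultimately show "(s \<otimes> r, s \<odot>\<^bsub>M\<^esub> v) \<in> G'" unfolding G'_def using smul s by blast
  qed
  moreover have "\<forall>v. (\<zero>, v) \<in> G' \<longrightarrow> v = \<zero>\<^bsub>M\<^esub>"
  proof (intro allI impI)
    fix v assume "(\<zero>, v) \<in> G'"
    then obtain r b where r: "\<zero> = r \<otimes> (x [^] (m + j)) \<oplus> b" "r \<in> carrier R" and b: "(b, v) \<in> G"
      by (auto simp: G'_def)
    have mb: "(\<ominus> b, \<ominus>\<^bsub>M\<^esub> v) \<in> G"
      using linear_relation_minus[OF lin GM zero b] GD[OF b] by (simp add: R.minus_eq M.minus_eq)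
    \<comment> \<open>Here -b is x^j times the element x^m r of the domain, so its value is x^j
      times a value of \<open>G\<close>, which is zero by the choice of j.\<close>
    have eq: "\<ominus> b = x [^] (m + j) \<otimes> r"
      using r GD(1)[OF b] R.minus_equality[of "r \<otimes> (x [^] (m + j))" b] by (simp add: R.m_comm)
    then have "r \<in> B (m + j)" using r(2) mb by (auto simp: B_def)
    then have "r \<in> B m" using m[of "m + j"] by simp
    then obtain w where w: "(x [^] m \<otimes> r, w) \<in> G" by (auto simp: B_def)
    then have "(x [^] j \<otimes> (x [^] m \<otimes> r), x [^] j \<odot>\<^bsub>M\<^esub> w) \<in> G" using smul by simp
    then have "(\<ominus> b, \<zero>\<^bsub>M\<^esub>) \<in> G"
      using eq killed[OF w] r(2) assms(3)
      by (simp add: R.m_assoc[symmetric] R.nat_pow_mult add.commute)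
    then have "\<ominus>\<^bsub>M\<^esub> v = \<zero>\<^bsub>M\<^esub>" using linear_relation_functional[OF lin GM sv mb] by blast
    then show "v = \<zero>\<^bsub>M\<^esub>" using GD(2)[OF b] M.minus_minus minus_zero_eq by metis
  qed
  ultimately obtain u where u: "u \<in> J" "\<And>r v. (r, v) \<in> G' \<Longrightarrow> v = r \<odot>\<^bsub>M\<^esub> u"
    using assms(2) unfolding baer_def by blast
  have "(x [^] (m + j), \<zero>\<^bsub>M\<^esub>) \<in> G'"
    using G'I[OF R.one_closed zero] by simp
  then have "u \<in> power_torsion R M x J" using u unfolding power_torsion_def by force
  moreover have "(r, v) \<in> G'" if "(r, v) \<in> G" for r v
    using G'I[OF R.zero_closed that] GD(1)[OF that] by simp
  ultimately show "\<exists>u\<in>power_torsion R M x J. \<forall>r v. (r, v) \<in> G \<longrightarrow> v = r \<odot>\<^bsub>M\<^esub> u"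
    using u(2) by blast
qed

text \<open>The element \<open>v\<close> represents u/x^k in J_x. The annihilators of the powers of
  x stop growing at some m, which makes the map r x^(m+k) -> r x^m u on an ideal well defined;
  Baer's property then turns it into multiplication by \<open>v\<close>.\<close>

lemma baer_divisible:
  assumes "noetherian_ring R" "baer R M J" "x \<in> carrier R" "u \<in> J"
  obtains v and m :: nat where "v \<in> J" "(x [^] (m + k)) \<odot>\<^bsub>M\<^esub> v = (x [^] m) \<odot>\<^bsub>M\<^esub> u"
proof -
  have sub: "submodule J R M" using assms by (simp add: baer_def)
  have C: "z \<in> carrier M" if "z \<in> J" for z using sub submodule_carrier that by blast
  have [simp]: "x [^] n \<in> carrier R" for n :: nat using assms(3) by simp
  interpret noetherian_ring R by fact
  define A where "A m = {r \<in> carrier R. x [^] m \<otimes> r = \<zero>}" for m :: nat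
  have "ideal (A m) R" for m
    using R.ideal_colon[OF R.zeroideal, of "x [^] m"] by (simp add: A_def)
  moreover have "A m \<subseteq> A (Suc m)" for m
    unfolding A_def using assms(3) by (auto simp: R.m_assoc R.m_lcomm[of "x [^] m" x])
  ultimately obtain m where m: "\<And>n. m \<le> n \<Longrightarrow> A n = A m"
    using ideal_chain_stabilizes[of A] by blast
  define G where "G = {(r \<otimes> x [^] (m + k), r \<odot>\<^bsub>M\<^esub> (x [^] m \<odot>\<^bsub>M\<^esub> u)) | r. r \<in> carrier R}"
  have "G \<subseteq> carrier R \<times> J" using assms(4) sub by (auto simp: G_def submoduleE(4))
  moreover have "linear_relation R M G"
    unfolding linear_relation_def
  proof (intro conjI allI ballI impI)
    show "(\<zero>, \<zero>\<^bsub>M\<^esub>) \<in> G" unfolding G_def using C assms(4) by (auto intro!: exI[of _ \<zero>])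
  next
    fix r v s w assume "(r, v) \<in> G \<and> (s, w) \<in> G"
    then obtain a b where "r = a \<otimes> x [^] (m + k)" "v = a \<odot>\<^bsub>M\<^esub> (x [^] m \<odot>\<^bsub>M\<^esub> u)" "a \<in> carrier R"
      "s = b \<otimes> x [^] (m + k)" "w = b \<odot>\<^bsub>M\<^esub> (x [^] m \<odot>\<^bsub>M\<^esub> u)" "b \<in> carrier R" by (auto simp: G_def)
    then show "(r \<oplus> s, v \<oplus>\<^bsub>M\<^esub> w) \<in> G" unfolding G_def using C assms(4)
      by (auto intro!: exI[of _ "a \<oplus> b"] simp: R.l_distr smult_l_distr)
  next
    fix s r v assume s: "s \<in> carrier R" "(r, v) \<in> G"
    then obtain a where "r = a \<otimes> x [^] (m + k)" "v = a \<odot>\<^bsub>M\<^esub> (x [^] m \<odot>\<^bsub>M\<^esub> u)" "a \<in> carrier R"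
      by (auto simp: G_def)
    then show "(s \<otimes> r, s \<odot>\<^bsub>M\<^esub> v) \<in> G" unfolding G_def using C assms(4) s(1)
      by (auto intro!: exI[of _ "s \<otimes> a"] simp: R.m_assoc smult_assoc1)
  qed
  moreover have "\<forall>v. (\<zero>, v) \<in> G \<longrightarrow> v = \<zero>\<^bsub>M\<^esub>"
  proof (intro allI impI)
    fix v assume "(\<zero>, v) \<in> G"
    then obtain r where r: "\<zero> = r \<otimes> x [^] (m + k)" "v = r \<odot>\<^bsub>M\<^esub> (x [^] m \<odot>\<^bsub>M\<^esub> u)" "r \<in> carrier R"
      by (auto simp: G_def)
    then have "r \<in> A (m + k)" by (auto simp: A_def R.m_comm)
    then have "x [^] m \<otimes> r = \<zero>" using m[of "m + k"] by (auto simp: A_def)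
    then show "v = \<zero>\<^bsub>M\<^esub>" using r C assms(4) by (metis \<open>\<And>n. x [^] n \<in> carrier R\<close> R.m_comm smult_assoc1 smult_l_null)
  qed
  ultimately obtain v where v: "v \<in> J" "\<And>r w. (r, w) \<in> G \<Longrightarrow> w = r \<odot>\<^bsub>M\<^esub> v"
    using assms(2) unfolding baer_def by blast
  have "(x [^] (m + k), x [^] m \<odot>\<^bsub>M\<^esub> u) \<in> G"
    unfolding G_def using C assms(4) by (auto intro!: exI[of _ \<one>])
  then show ?thesis using v that by metis
qed

end

lemma injective_module_imp_baer:
  assumes "injective_module R E"
  shows "baer R E (carrier E)"
  unfolding baer_def
proof (intro conjI allI impI)
  interpret module R E using assms by (simp add: injective_module_def)
  show "submodule (carrier E) R E" by (rule carrier_is_submodule)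
  fix G
  assume "G \<subseteq> carrier R \<times> carrier E \<and> linear_relation R E G \<and> (\<forall>v. (\<zero>\<^bsub>R\<^esub>, v) \<in> G \<longrightarrow> v = \<zero>\<^bsub>E\<^esub>)"
  then have G: "G \<subseteq> carrier R \<times> carrier E" and lin: "linear_relation R E G"
    and sv: "\<forall>v. (\<zero>\<^bsub>R\<^esub>, v) \<in> G \<longrightarrow> v = \<zero>\<^bsub>E\<^esub>" by auto
  \<comment> \<open>The ring as a module over itself, in the record type over which the test modules
    of \<open>injective_module\<close> range; \<open>A\<close> will be the domain of
    \<open>G\<close> inside it.\<close>
  define B :: "('a, 'a) module" where
    "B = \<lparr>carrier = carrier R, monoid.mult = monoid.mult R, one = \<one>\<^bsub>R\<^esub>, zero = \<zero>\<^bsub>R\<^esub>, add = add R, smult = monoid.mult R\<rparr>"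
  have modB: "module R B"
  proof (rule moduleI)
    show "cring R" by (rule R.cring_axioms)
    show "abelian_group B"
      by (rule abelian_groupI) (auto simp: B_def R.a_ac intro: R.l_neg exI[of _ "\<ominus>\<^bsub>R\<^esub> _"])
  qed (auto simp: B_def R.l_distr R.r_distr R.m_assoc)
  interpret b: ideal "Domain G" R using ideal_linear_relation_domain lin G by blast
  define A where "A = B\<lparr>carrier := Domain G\<rparr>"
  have "submodule (Domain G) R B"
  proof (rule module.submoduleI[OF modB])
    have inv: "\<ominus>\<^bsub>B\<^esub> a = \<ominus>\<^bsub>R\<^esub> a" for a by (simp add: a_inv_def m_inv_def B_def)
    show "\<ominus>\<^bsub>B\<^esub> a \<in> Domain G" if "a \<in> Domain G" for a
      unfolding inv using that by (rule b.a_inv_closed)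
    show "a \<oplus>\<^bsub>B\<^esub> c \<in> Domain G" if "a \<in> Domain G" "c \<in> Domain G" for a c
      using b.a_closed[OF that] by (simp add: B_def)
    show "\<zero>\<^bsub>B\<^esub> \<in> Domain G" using b.zero_closed by (simp add: B_def)
    show "a \<odot>\<^bsub>B\<^esub> c \<in> Domain G" if "a \<in> carrier R" "c \<in> Domain G" for a c
      using b.I_l_closed[OF that(2,1)] by (simp add: B_def)
  qed (use G in \<open>auto simp: B_def\<close>)
  then have modA: "module R A" unfolding A_def using submodule.submodule_is_module modB by blast
  define f where "f r = (THE v. (r, v) \<in> G)" for r
  have f: "f r = v" if "(r, v) \<in> G" for r v
    unfolding f_def using that linear_relation_functional[OF lin G sv] by blast
  have "f \<in> module_hom R A E"
    using G lin f unfolding module_hom_def linear_relation_def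
    by (auto simp: A_def B_def)
  moreover have "(\<lambda>r. r) \<in> module_hom R A B"
    using G by (auto simp: module_hom_def A_def B_def)
  moreover have "inj_on (\<lambda>r. r) (carrier A)" by simp
  ultimately obtain g where g: "g \<in> module_hom R B E" "\<forall>r\<in>carrier A. g r = f r"
    using assms modA modB unfolding injective_module_def by blast
  have "v = r \<odot>\<^bsub>E\<^esub> g \<one>\<^bsub>R\<^esub>" if rv: "(r, v) \<in> G" for r v
  proof -
    have r: "r \<in> carrier R" using rv G by auto
    have "r \<in> carrier A" using rv by (auto simp: A_def)
    then have "v = g r" using g(2) f[OF rv] by simp
    also have "\<dots> = g (r \<otimes>\<^bsub>R\<^esub> \<one>\<^bsub>R\<^esub>)" using r by simp
    also have "\<dots> = r \<odot>\<^bsub>E\<^esub> g \<one>\<^bsub>R\<^esub>" using g(1) r by (simp add: module_hom_def B_def del: R.r_one)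
    finally show ?thesis .
  qed
  moreover have "g \<one>\<^bsub>R\<^esub> \<in> carrier E" using g(1) by (auto simp: module_hom_def B_def)
  ultimately show "\<exists>u\<in>carrier E. \<forall>r v. (r, v) \<in> G \<longrightarrow> v = r \<odot>\<^bsub>E\<^esub> u" by blast
qed

section \<open>Finite Goldie dimension of subquotients\<close>

text \<open>The n-th term is U + R z_0 + ... + R z_(n-1), so \<open>z n\<close> enters only at
  \<open>Suc n\<close>.\<close>

primrec span_chain ::
  "('a, 'r) ring_scheme \<Rightarrow> ('a, 'm, 'x) module_scheme \<Rightarrow> 'm set \<Rightarrow> (nat \<Rightarrow> 'm) \<Rightarrow> nat \<Rightarrow> 'm set"
  where
    "span_chain R M U z 0 = U"
  | "span_chain R M U z (Suc n) = {s \<oplus>\<^bsub>M\<^esub> r \<odot>\<^bsub>M\<^esub> z n | s r. s \<in> span_chain R M U z n \<and> r \<in> carrier R}"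

text \<open>
  For submodules \<open>U \<subseteq> N\<close> of \<open>M\<close> this says that \<open>N / U\<close> has finite Goldie dimension: the classes of
  a sequence as below would generate an infinite direct sum of non-zero cyclic submodules.
\<close>

definition finite_Goldie_pair ::
  "('a, 'r) ring_scheme \<Rightarrow> ('a, 'm, 'x) module_scheme \<Rightarrow> 'm set \<Rightarrow> 'm set \<Rightarrow> bool"
  where "finite_Goldie_pair R M N U \<longleftrightarrow>
    \<not> (\<exists>z. (\<forall>n. z n \<in> N - U) \<and>
        (\<forall>n. \<forall>r\<in>carrier R. r \<odot>\<^bsub>M\<^esub> z n \<in> span_chain R M U z n \<longrightarrow> r \<odot>\<^bsub>M\<^esub> z n \<in> U))"

text \<open>A relation and not a homomorphism, because a class such as z/x^k determines neither a
  unique numerator nor a unique representing cycle.\<close>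

definition linear_between ::
  "('a, 'r) ring_scheme \<Rightarrow> ('a, 'm, 'x) module_scheme \<Rightarrow> ('a, 'n, 'y) module_scheme \<Rightarrow>
    ('m \<Rightarrow> 'n \<Rightarrow> bool) \<Rightarrow> bool"
  where "linear_between R A B D \<longleftrightarrow> D \<zero>\<^bsub>A\<^esub> \<zero>\<^bsub>B\<^esub> \<and>
    (\<forall>z z' w w'. D z z' \<longrightarrow> D w w' \<longrightarrow> D (z \<oplus>\<^bsub>A\<^esub> w) (z' \<oplus>\<^bsub>B\<^esub> w')) \<and>
    (\<forall>r\<in>carrier R. \<forall>z z'. D z z' \<longrightarrow> D (r \<odot>\<^bsub>A\<^esub> z) (r \<odot>\<^bsub>B\<^esub> z'))"

lemma linear_between_minus:
  assumes "module R A" "module R B" "linear_between R A B D" "D z z'" "D w w'"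
    and "w \<in> carrier A" "w' \<in> carrier B"
  shows "D (z \<ominus>\<^bsub>A\<^esub> w) (z' \<ominus>\<^bsub>B\<^esub> w')"
proof -
  interpret A: module R A by fact
  interpret B: module R B by fact
  have "D ((\<ominus>\<^bsub>R\<^esub> \<one>\<^bsub>R\<^esub>) \<odot>\<^bsub>A\<^esub> w) ((\<ominus>\<^bsub>R\<^esub> \<one>\<^bsub>R\<^esub>) \<odot>\<^bsub>B\<^esub> w')"
    using assms(3,5) unfolding linear_between_def by simp
  then have "D (\<ominus>\<^bsub>A\<^esub> w) (\<ominus>\<^bsub>B\<^esub> w')"
    using assms(6,7) by (simp add: A.smult_l_minus B.smult_l_minus)
  then show ?thesis
    using assms(3,4) unfolding linear_between_def a_minus_def by blast
qed

context module
begin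

lemma submodule_minus_cancel:
  assumes "submodule U R M" "z \<in> carrier M" "w \<in> U" "z \<ominus>\<^bsub>M\<^esub> w \<in> U"
  shows "z \<in> U"
proof -
  have "w \<in> carrier M" using assms submodule_carrier by blast
  then have "z = (z \<ominus>\<^bsub>M\<^esub> w) \<oplus>\<^bsub>M\<^esub> w" using assms(2) by (simp add: a_minus_def M.a_assoc M.l_neg)
  then show ?thesis using submoduleE(5)[OF assms(1,4,3)] by simp
qed

lemma submodule_minus_commute:
  assumes "submodule U R M" "z \<in> carrier M" "w \<in> carrier M" "z \<ominus>\<^bsub>M\<^esub> w \<in> U"
  shows "w \<ominus>\<^bsub>M\<^esub> z \<in> U"
proof -
  have "w \<ominus>\<^bsub>M\<^esub> z = \<ominus>\<^bsub>M\<^esub> (z \<ominus>\<^bsub>M\<^esub> w)"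
    using assms(2,3) by (simp add: a_minus_def M.minus_add M.minus_minus M.a_comm)
  then show ?thesis using submoduleE(3)[OF assms(1,4)] by simp
qed

lemma submodule_add_cyclic:
  assumes "submodule U R M" "w \<in> carrier M"
  shows "submodule {s \<oplus>\<^bsub>M\<^esub> r \<odot>\<^bsub>M\<^esub> w | s r. s \<in> U \<and> r \<in> carrier R} R M"
    (is "submodule ?S R M")
proof (rule submoduleI)
  have C: "s \<in> carrier M" if "s \<in> U" for s using that assms(1) submodule_carrier by blast
  have I: "s \<oplus>\<^bsub>M\<^esub> r \<odot>\<^bsub>M\<^esub> w \<in> ?S" if "s \<in> U" "r \<in> carrier R" for s r using that by blast
  show "?S \<subseteq> carrier M" using C assms(2) by auto
  show "\<zero>\<^bsub>M\<^esub> \<in> ?S" using I[OF submodule_zero[OF assms(1)] R.zero_closed] assms(2) by simp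
  fix a assume "a \<in> ?S"
  then obtain s r where a: "a = s \<oplus>\<^bsub>M\<^esub> r \<odot>\<^bsub>M\<^esub> w" "s \<in> U" "r \<in> carrier R" by blast
  have "\<ominus>\<^bsub>M\<^esub> a = \<ominus>\<^bsub>M\<^esub> s \<oplus>\<^bsub>M\<^esub> (\<ominus> r) \<odot>\<^bsub>M\<^esub> w"
    using a C assms(2) by (simp add: M.minus_add smult_l_minus)
  then show "\<ominus>\<^bsub>M\<^esub> a \<in> ?S" using I[OF submoduleE(3)[OF assms(1) a(2)], of "\<ominus> r"] a(3) by simp
  {
    fix b assume "b \<in> ?S"
    then obtain s' r' where b: "b = s' \<oplus>\<^bsub>M\<^esub> r' \<odot>\<^bsub>M\<^esub> w" "s' \<in> U" "r' \<in> carrier R" by blast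
    have "a \<oplus>\<^bsub>M\<^esub> b = (s \<oplus>\<^bsub>M\<^esub> s') \<oplus>\<^bsub>M\<^esub> (r \<oplus> r') \<odot>\<^bsub>M\<^esub> w"
      using a b C assms(2) by (simp add: smult_l_distr M.a_ac)
    then show "a \<oplus>\<^bsub>M\<^esub> b \<in> ?S"
      using I[OF submoduleE(5)[OF assms(1) a(2) b(2)], of "r \<oplus> r'"] a(3) b(3) by simp
  }
  fix c assume c: "c \<in> carrier R"
  have "c \<odot>\<^bsub>M\<^esub> a = c \<odot>\<^bsub>M\<^esub> s \<oplus>\<^bsub>M\<^esub> (c \<otimes> r) \<odot>\<^bsub>M\<^esub> w"
    using a c C assms(2) by (simp add: smult_r_distr smult_assoc1)
  then show "c \<odot>\<^bsub>M\<^esub> a \<in> ?S" using I[OF submoduleE(4)[OF assms(1) c a(2)], of "c \<otimes> r"] a(3) c by simp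
qed

lemma submodule_span_chain:
  assumes "submodule U R M" "range z \<subseteq> carrier M"
  shows "submodule (span_chain R M U z n) R M"
  using assms by (induct n) (auto intro!: submodule_add_cyclic)

lemma span_chain_Suc_superset:
  assumes "submodule U R M" "range z \<subseteq> carrier M"
  shows "span_chain R M U z n \<subseteq> span_chain R M U z (Suc n)"
proof
  fix s assume s: "s \<in> span_chain R M U z n"
  have "s = s \<oplus>\<^bsub>M\<^esub> \<zero> \<odot>\<^bsub>M\<^esub> z n"
    using assms(2) submodule_carrier[OF submodule_span_chain[OF assms] s] by (simp add: range_subsetD)
  then show "s \<in> span_chain R M U z (Suc n)" using s R.zero_closed by auto
qed

lemma span_chain_superset:
  assumes "submodule U R M" "range z \<subseteq> carrier M"
  shows "U \<subseteq> span_chain R M U z n"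
  using lift_Suc_mono_le[of "span_chain R M U z" 0 n, OF span_chain_Suc_superset[OF assms]] by simp

lemma span_chain_mem:
  assumes "submodule U R M" "range z \<subseteq> carrier M"
  shows "z n \<in> span_chain R M U z (Suc n)"
proof -
  have "z n = \<zero>\<^bsub>M\<^esub> \<oplus>\<^bsub>M\<^esub> \<one> \<odot>\<^bsub>M\<^esub> z n" using assms(2) by (simp add: range_subsetD)
  then show ?thesis using submodule_zero[OF submodule_span_chain[OF assms, of n]] R.one_closed by auto
qed

end

text \<open>By \<open>iff\<close> the relation is an isomorphism from a part of N/U onto a part of
  N'/U', and by \<open>ess\<close> the latter part is essential. An independent sequence in N'/U' is
  moved into the essential part by suitable multiples, and the partners of these multiples are
  independent in N/U.\<close>

lemma finite_Goldie_pair_transfer: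
  assumes "module R A" "module R B"
    and N: "submodule N R A" and U: "submodule U R A"
    and N': "submodule N' R B" and U': "submodule U' R B"
    and D: "linear_between R A B D"
    and dom: "\<And>z z'. D z z' \<Longrightarrow> z \<in> N \<and> z' \<in> N'"
    and iff: "\<And>z z'. D z z' \<Longrightarrow> z \<in> U \<longleftrightarrow> z' \<in> U'"
    and ess: "\<And>z'. z' \<in> N' \<Longrightarrow> z' \<notin> U' \<Longrightarrow>
      \<exists>r\<in>carrier R. \<exists>z y. D z y \<and> y \<notin> U' \<and> r \<odot>\<^bsub>B\<^esub> z' \<ominus>\<^bsub>B\<^esub> y \<in> U'"
    and fin: "finite_Goldie_pair R A N U"
  shows "finite_Goldie_pair R B N' U'"
  unfolding finite_Goldie_pair_def
proof
  interpret A: module R A by fact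
  interpret B: module R B by fact
  assume "\<exists>z. (\<forall>n. z n \<in> N' - U') \<and>
    (\<forall>n. \<forall>r\<in>carrier R. r \<odot>\<^bsub>B\<^esub> z n \<in> span_chain R B U' z n \<longrightarrow> r \<odot>\<^bsub>B\<^esub> z n \<in> U')"
  then obtain z' where z': "\<And>n. z' n \<in> N'" "\<And>n. z' n \<notin> U'"
    and indep: "\<And>n r. r \<in> carrier R \<Longrightarrow> r \<odot>\<^bsub>B\<^esub> z' n \<in> span_chain R B U' z' n \<Longrightarrow> r \<odot>\<^bsub>B\<^esub> z' n \<in> U'"
    by blast
  have CA: "z \<in> carrier A" if "D z y" for z y using dom that N A.submodule_carrier by blast
  have CB: "y \<in> carrier B" if "D z y" for z y using dom that N' B.submodule_carrier by blast
  have z'C: "z' n \<in> carrier B" for n using z'(1) N' B.submodule_carrier by blast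
  then have z'R: "range z' \<subseteq> carrier B" by blast
  have add: "D (z \<oplus>\<^bsub>A\<^esub> w) (z' \<oplus>\<^bsub>B\<^esub> w')" if "D z z'" "D w w'" for z z' w w'
    using D that unfolding linear_between_def by blast
  have smul: "D (r \<odot>\<^bsub>A\<^esub> z) (r \<odot>\<^bsub>B\<^esub> z')" if "r \<in> carrier R" "D z z'" for r z z'
    using D that unfolding linear_between_def by blast
  have minus: "D (z \<ominus>\<^bsub>A\<^esub> w) (z' \<ominus>\<^bsub>B\<^esub> w')" if "D z z'" "D w w'" for z z' w w'
    using linear_between_minus[OF assms(1,2) D that CA[OF that(2)] CB[OF that(2)]] .
  have "\<forall>n. \<exists>r z y. r \<in> carrier R \<and> D z y \<and> y \<notin> U' \<and> r \<odot>\<^bsub>B\<^esub> z' n \<ominus>\<^bsub>B\<^esub> y \<in> U'"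
    using ess[OF z'] by blast
  then obtain \<rho> w y where \<rho>: "\<And>n. \<rho> n \<in> carrier R" and w: "\<And>n. D (w n) (y n)"
    and y: "\<And>n. y n \<notin> U'" and u: "\<And>n. \<rho> n \<odot>\<^bsub>B\<^esub> z' n \<ominus>\<^bsub>B\<^esub> y n \<in> U'"
    by metis
  have wC [simp]: "w n \<in> carrier A" and yC [simp]: "y n \<in> carrier B" for n
    using CA CB w by blast+
  have wR: "range w \<subseteq> carrier A" by auto
  note S' = B.submodule_span_chain[OF U' z'R]
  \<comment> \<open>As \<open>y n\<close> and the multiple of \<open>z' n\<close> by
    \<open>\<rho> n\<close> differ by an element of \<open>U'\<close>, their multiples lie in the
    same submodules above \<open>U'\<close>.\<close>
  have shift: "r \<odot>\<^bsub>B\<^esub> y n \<in> V \<longleftrightarrow> (r \<otimes>\<^bsub>R\<^esub> \<rho> n) \<odot>\<^bsub>B\<^esub> z' n \<in> V"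
    if V: "submodule V R B" "U' \<subseteq> V" and r: "r \<in> carrier R" for V r n
  proof -
    have "r \<odot>\<^bsub>B\<^esub> (\<rho> n \<odot>\<^bsub>B\<^esub> z' n \<ominus>\<^bsub>B\<^esub> y n) \<in> V" using V u r B.submoduleE(4) by blast
    then have d: "(r \<otimes>\<^bsub>R\<^esub> \<rho> n) \<odot>\<^bsub>B\<^esub> z' n \<ominus>\<^bsub>B\<^esub> r \<odot>\<^bsub>B\<^esub> y n \<in> V"
      using r \<rho> z'C by (simp add: B.smult_minus_distr B.smult_assoc1)
    have C: "(r \<otimes>\<^bsub>R\<^esub> \<rho> n) \<odot>\<^bsub>B\<^esub> z' n \<in> carrier B" "r \<odot>\<^bsub>B\<^esub> y n \<in> carrier B"
      using r \<rho> z'C by simp_all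
    show ?thesis
      using B.submodule_minus_cancel[OF V(1)] d B.submodule_minus_commute[OF V(1) C d] C by blast
  qed
  \<comment> \<open>An element of the span may have no partner itself, since \<open>U\<close> need
    not lie in the domain of \<open>D\<close>. A partner is therefore found for some t congruent to
    s modulo \<open>U\<close>.\<close>
  have lift: "\<exists>t t'. D t t' \<and> s \<ominus>\<^bsub>A\<^esub> t \<in> U \<and> t' \<in> span_chain R B U' z' n"
    if "s \<in> span_chain R A U w n" for s n
    using that
  proof (induct n arbitrary: s)
    case 0
    have "D \<zero>\<^bsub>A\<^esub> \<zero>\<^bsub>B\<^esub>" using D by (simp add: linear_between_def)
    moreover have "s \<ominus>\<^bsub>A\<^esub> \<zero>\<^bsub>A\<^esub> \<in> U" using 0 A.submodule_minus[OF U _ A.submodule_zero[OF U]] by simp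
    ultimately show ?case using B.submodule_zero[OF U'] by (metis span_chain.simps(1))
  next
    case (Suc n)
    then obtain s0 r where s: "s = s0 \<oplus>\<^bsub>A\<^esub> r \<odot>\<^bsub>A\<^esub> w n" "s0 \<in> span_chain R A U w n" "r \<in> carrier R"
      by auto
    obtain t t' where t: "D t t'" "s0 \<ominus>\<^bsub>A\<^esub> t \<in> U" "t' \<in> span_chain R B U' z' n"
      using Suc.hyps[OF s(2)] by blast
    have C: "s0 \<in> carrier A" "t \<in> carrier A"
      using A.submodule_carrier[OF A.submodule_span_chain[OF U wR] s(2)] CA[OF t(1)] by auto
    have "s \<ominus>\<^bsub>A\<^esub> (t \<oplus>\<^bsub>A\<^esub> r \<odot>\<^bsub>A\<^esub> w n) = s0 \<ominus>\<^bsub>A\<^esub> t"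
      using C s(1,3) by (simp add: a_minus_def A.M.minus_add A.M.a_ac A.M.r_neg A.M.r_neg2)
    moreover have "r \<odot>\<^bsub>B\<^esub> y n \<in> span_chain R B U' z' (Suc n)"
    proof -
      have "z' n \<in> span_chain R B U' z' (Suc n)" by (rule B.span_chain_mem[OF U' z'R])
      then have "(r \<otimes>\<^bsub>R\<^esub> \<rho> n) \<odot>\<^bsub>B\<^esub> z' n \<in> span_chain R B U' z' (Suc n)"
        using B.submoduleE(4)[OF S'] s(3) \<rho> by blast
      then show ?thesis using shift[OF S' B.span_chain_superset[OF U' z'R] s(3)] by blast
    qed
    moreover have "t' \<in> span_chain R B U' z' (Suc n)"
      using t(3) B.span_chain_Suc_superset[OF U' z'R] by blast
    ultimately have "s \<ominus>\<^bsub>A\<^esub> (t \<oplus>\<^bsub>A\<^esub> r \<odot>\<^bsub>A\<^esub> w n) \<in> U"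
      "t' \<oplus>\<^bsub>B\<^esub> r \<odot>\<^bsub>B\<^esub> y n \<in> span_chain R B U' z' (Suc n)"
      using t(2) B.submoduleE(5)[OF S'] by presburger+
    then show ?case using add[OF t(1) smul[OF s(3) w]] by blast
  qed
  have "w n \<in> N - U" for n using dom[OF w] iff[OF w] y by blast
  moreover have "r \<odot>\<^bsub>A\<^esub> w n \<in> U" if r: "r \<in> carrier R" "r \<odot>\<^bsub>A\<^esub> w n \<in> span_chain R A U w n" for n r
  proof -
    obtain t t' where t: "D t t'" "r \<odot>\<^bsub>A\<^esub> w n \<ominus>\<^bsub>A\<^esub> t \<in> U" "t' \<in> span_chain R B U' z' n"
      using lift[OF r(2)] by blast
    have "r \<odot>\<^bsub>B\<^esub> y n \<ominus>\<^bsub>B\<^esub> t' \<in> U'" using iff[OF minus[OF smul[OF r(1) w] t(1)]] t(2) by blast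
    then have "r \<odot>\<^bsub>B\<^esub> y n \<ominus>\<^bsub>B\<^esub> t' \<in> span_chain R B U' z' n"
      using B.span_chain_superset[OF U' z'R] by blast
    then have "r \<odot>\<^bsub>B\<^esub> y n \<in> span_chain R B U' z' n"
      using B.submodule_minus_cancel[OF S' _ t(3)] r(1) by simp
    then have "(r \<otimes>\<^bsub>R\<^esub> \<rho> n) \<odot>\<^bsub>B\<^esub> z' n \<in> U'"
      using shift[OF S' B.span_chain_superset[OF U' z'R] r(1)] indep r(1) \<rho> by simp
    then have "r \<odot>\<^bsub>B\<^esub> y n \<in> U'" using shift[OF U' _ r(1)] by blast
    then show ?thesis using iff[OF smul[OF r(1) w]] by blast
  qed
  ultimately show False using fin unfolding finite_Goldie_pair_def by blast
qed

text \<open>The ascending chain condition for finitely generated modules, by induction on the number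
  k of generators. The terms \<open>S n\<close> may reach outside the span, hence the
  intersection.\<close>

lemma (in module) submodule_chain_stabilizes_on_span:
  assumes "noetherian_ring R" and zR: "range z \<subseteq> carrier M"
    and S: "\<And>n. submodule (S n) R M" and mono: "\<And>n::nat. S n \<subseteq> S (Suc n)"
  shows "\<exists>N. \<forall>n\<ge>N. S n \<inter> span_chain R M {\<zero>\<^bsub>M\<^esub>} z k \<subseteq> S N"
proof (induct k)
  case 0
  show ?case using submodule_zero[OF S] by auto
next
  case (Suc k)
  interpret noetherian_ring R by fact
  define T where "T = span_chain R M {\<zero>\<^bsub>M\<^esub>} z k"
  have T: "submodule T R M" unfolding T_def by (rule submodule_span_chain[OF submodule_zero_submodule zR])
  have z: "z i \<in> carrier M" for i using zR by blast
  have le: "S m \<subseteq> S n" if "m \<le> n" for m n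
    using lift_Suc_mono_le[of S, OF mono that] .
  obtain N1 where N1: "\<And>n. n \<ge> N1 \<Longrightarrow> S n \<inter> T \<subseteq> S N1" using Suc T_def by blast
  have TC: "t \<in> carrier M" if "t \<in> T" for t using T that submodule_carrier by blast
  \<comment> \<open>The coefficients of \<open>z k\<close> in those elements of \<open>S n\<close>
    that lie in T + R z_k. These ideals increase and stop at some N2, while N1 serves for the part
    of \<open>S n\<close> inside \<open>T\<close>.\<close>
  define A where "A n = {r \<in> carrier R. \<exists>t\<in>T. t \<oplus>\<^bsub>M\<^esub> r \<odot>\<^bsub>M\<^esub> z k \<in> S n}" for n
  have AI: "r \<in> A n" if "r \<in> carrier R" "t \<in> T" "t \<oplus>\<^bsub>M\<^esub> r \<odot>\<^bsub>M\<^esub> z k \<in> S n" for r t n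
    using that by (auto simp: A_def)
  have smulA: "x \<otimes> a \<in> A n" if a: "a \<in> A n" and x: "x \<in> carrier R" for a x n
  proof -
    obtain t where t: "t \<in> T" "t \<oplus>\<^bsub>M\<^esub> a \<odot>\<^bsub>M\<^esub> z k \<in> S n" "a \<in> carrier R" using a by (auto simp: A_def)
    have "x \<odot>\<^bsub>M\<^esub> (t \<oplus>\<^bsub>M\<^esub> a \<odot>\<^bsub>M\<^esub> z k) = x \<odot>\<^bsub>M\<^esub> t \<oplus>\<^bsub>M\<^esub> (x \<otimes> a) \<odot>\<^bsub>M\<^esub> z k"
      using t x TC z by (simp add: smult_r_distr smult_assoc1)
    then show ?thesis
      using AI[of "x \<otimes> a" "x \<odot>\<^bsub>M\<^esub> t" n] submoduleE(4)[OF S x t(2)] submoduleE(4)[OF T x t(1)] x t(3)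
      by simp
  qed
  have "ideal (A n) R" for n
  proof (rule idealI)
    show "ring R" by (rule R.ring_axioms)
    show "subgroup (A n) (add_monoid R)"
    proof (rule R.add.subgroupI)
      show "A n \<subseteq> carrier R" by (auto simp: A_def)
      have "\<zero> \<in> A n" using AI[OF R.zero_closed submodule_zero[OF T]] z submodule_zero[OF S] by simp
      then show "A n \<noteq> {}" by blast
      show "\<ominus> a \<in> A n" if "a \<in> A n" for a
        using smulA[OF that, of "\<ominus> \<one>"] that by (simp add: A_def R.l_minus)
      show "a \<oplus> b \<in> A n" if "a \<in> A n" "b \<in> A n" for a b
      proof -
        from that obtain s t where st: "s \<in> T" "s \<oplus>\<^bsub>M\<^esub> a \<odot>\<^bsub>M\<^esub> z k \<in> S n" "a \<in> carrier R"
          "t \<in> T" "t \<oplus>\<^bsub>M\<^esub> b \<odot>\<^bsub>M\<^esub> z k \<in> S n" "b \<in> carrier R" by (auto simp: A_def)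
        then have "(s \<oplus>\<^bsub>M\<^esub> a \<odot>\<^bsub>M\<^esub> z k) \<oplus>\<^bsub>M\<^esub> (t \<oplus>\<^bsub>M\<^esub> b \<odot>\<^bsub>M\<^esub> z k) =
          (s \<oplus>\<^bsub>M\<^esub> t) \<oplus>\<^bsub>M\<^esub> (a \<oplus> b) \<odot>\<^bsub>M\<^esub> z k"
          using TC z by (simp add: smult_l_distr M.a_ac)
        then show ?thesis
          using AI[of "a \<oplus> b" "s \<oplus>\<^bsub>M\<^esub> t" n] submoduleE(5)[OF S st(2,5)] submoduleE(5)[OF T st(1,4)] st
          by simp
      qed
    qed
    show "x \<otimes> a \<in> A n" if "a \<in> A n" "x \<in> carrier R" for a x using smulA that .
    then show "a \<otimes> x \<in> A n" if "a \<in> A n" "x \<in> carrier R" for a x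
      using that R.m_comm[of a x] by (simp add: A_def)
  qed
  moreover have "A n \<subseteq> A (Suc n)" for n using mono by (auto simp: A_def)
  ultimately obtain N2 where N2: "\<And>n. N2 \<le> n \<Longrightarrow> A n = A N2"
    using ideal_chain_stabilizes[of A] by blast
  define N where "N = max N1 N2"
  have "s \<in> S N" if n: "n \<ge> N" and s: "s \<in> S n" "s \<in> span_chain R M {\<zero>\<^bsub>M\<^esub>} z (Suc k)" for n s
  proof -
    obtain t r where t: "s = t \<oplus>\<^bsub>M\<^esub> r \<odot>\<^bsub>M\<^esub> z k" "t \<in> T" "r \<in> carrier R" using s(2) T_def by auto
    then have "r \<in> A n" using AI s(1) by blast
    then have "r \<in> A N" using N2[of n] N2[of N] n by (simp add: N_def)
    then obtain t' where t': "t' \<in> T" "t' \<oplus>\<^bsub>M\<^esub> r \<odot>\<^bsub>M\<^esub> z k \<in> S N" by (auto simp: A_def)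
    \<comment> \<open>The subtracted element comes from \<open>S N\<close> and has the same
      coefficient at \<open>z k\<close>, so the difference falls into \<open>T\<close>, where the
      induction hypothesis applies.\<close>
    have "s \<ominus>\<^bsub>M\<^esub> (t' \<oplus>\<^bsub>M\<^esub> r \<odot>\<^bsub>M\<^esub> z k) = t \<ominus>\<^bsub>M\<^esub> t'"
      using t t' TC z by (simp add: a_minus_def M.minus_add M.a_ac M.r_neg M.r_neg2)
    moreover have "s \<ominus>\<^bsub>M\<^esub> (t' \<oplus>\<^bsub>M\<^esub> r \<odot>\<^bsub>M\<^esub> z k) \<in> S n"
      using submodule_minus[OF S s(1)] t'(2) le[OF n] by blast
    moreover have "t \<ominus>\<^bsub>M\<^esub> t' \<in> T" using submodule_minus[OF T t(2) t'(1)] .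
    ultimately have "s \<ominus>\<^bsub>M\<^esub> (t' \<oplus>\<^bsub>M\<^esub> r \<odot>\<^bsub>M\<^esub> z k) \<in> S N"
      using N1[of n] n le[of N1 N] by (auto simp: N_def)
    then show ?thesis
      using submodule_minus_cancel[OF S submodule_carrier[OF S s(1)] t'(2)] by blast
  qed
  then show ?case by blast
qed

lemma (in module) finitely_generated_span_chain:
  assumes "finitely_generated_module R M"
  obtains z k where "range z \<subseteq> carrier M" "carrier M \<subseteq> span_chain R M {\<zero>\<^bsub>M\<^esub>} z k"
proof -
  obtain S where S: "finite S" "S \<subseteq> carrier M" "module_span R M S = carrier M"
    using assms by (auto simp: finitely_generated_module_def)
  obtain k :: nat and f where f: "S = f ` {i. i < k}"
    using finite_imp_nat_seg_image_inj_on[OF S(1)] by blast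
  define z where "z i = (if i < k then f i else \<zero>\<^bsub>M\<^esub>)" for i
  have z: "range z \<subseteq> carrier M" using f S(2) by (auto simp: z_def)
  have "S \<subseteq> span_chain R M {\<zero>\<^bsub>M\<^esub>} z k"
  proof
    fix s assume "s \<in> S"
    then obtain i where i: "i < k" "s = z i" using f by (auto simp: z_def)
    have "span_chain R M {\<zero>\<^bsub>M\<^esub>} z (Suc i) \<subseteq> span_chain R M {\<zero>\<^bsub>M\<^esub>} z k"
      using lift_Suc_mono_le[of "span_chain R M {\<zero>\<^bsub>M\<^esub>} z", OF span_chain_Suc_superset[OF submodule_zero_submodule z]] i(1)
      by (metis Suc_leI)
    then show "s \<in> span_chain R M {\<zero>\<^bsub>M\<^esub>} z k" using span_chain_mem[OF submodule_zero_submodule z, of i] i(2) by blast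
  qed
  then have "module_span R M S \<subseteq> span_chain R M {\<zero>\<^bsub>M\<^esub>} z k"
    unfolding module_span_def using submodule_span_chain[OF submodule_zero_submodule z, of k] by blast
  then show thesis using that[of z k] z S(3) by blast
qed

text \<open>The chain U + R z_0 + ... + R z_(n-1) cannot grow for ever, so some z_N lies in the span
  of its predecessors; independence with multiplier 1 then puts z_N in \<open>U\<close>.\<close>

lemma (in module) finitely_generated_imp_finite_Goldie_pair:
  assumes "noetherian_ring R" "finitely_generated_module R M" "submodule U R M"
  shows "finite_Goldie_pair R M (carrier M) U"
  unfolding finite_Goldie_pair_def
proof
  assume "\<exists>z. (\<forall>n. z n \<in> carrier M - U) \<and>
    (\<forall>n. \<forall>r\<in>carrier R. r \<odot>\<^bsub>M\<^esub> z n \<in> span_chain R M U z n \<longrightarrow> r \<odot>\<^bsub>M\<^esub> z n \<in> U)"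
  then obtain z where z: "\<And>n. z n \<in> carrier M" "\<And>n. z n \<notin> U"
    and indep: "\<And>n r. r \<in> carrier R \<Longrightarrow> r \<odot>\<^bsub>M\<^esub> z n \<in> span_chain R M U z n \<Longrightarrow> r \<odot>\<^bsub>M\<^esub> z n \<in> U"
    by blast
  then have zR: "range z \<subseteq> carrier M" by blast
  obtain g k where g: "range g \<subseteq> carrier M" "carrier M \<subseteq> span_chain R M {\<zero>\<^bsub>M\<^esub>} g k"
    using finitely_generated_span_chain[OF assms(2)] by blast
  obtain N where "\<forall>n\<ge>N. span_chain R M U z n \<inter> span_chain R M {\<zero>\<^bsub>M\<^esub>} g k \<subseteq> span_chain R M U z N"
    using submodule_chain_stabilizes_on_span[OF assms(1) g(1), where S = "span_chain R M U z"]
      submodule_span_chain[OF assms(3) zR] span_chain_Suc_superset[OF assms(3) zR] by blast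
  then have "span_chain R M U z (Suc N) \<inter> span_chain R M {\<zero>\<^bsub>M\<^esub>} g k \<subseteq> span_chain R M U z N"
    by (metis le_Suc_eq order_refl)
  then have "z N \<in> span_chain R M U z N"
    using span_chain_mem[OF assms(3) zR, of N] g(2) z(1)[of N] by blast
  then show False using indep[of \<one> N] z by simp
qed

section \<open>Quotient modules: cosets, zero divisors and direct families of submodules\<close>

context module
begin

lemma abelian_subgroup_submodule: "submodule U R M \<Longrightarrow> abelian_subgroup U M"
  by (rule abelian_subgroupI3)
     (auto simp: submodule_def intro: additive_subgroupI M.abelian_group_axioms)

lemma coset_eq_submodule_iff:
  assumes "submodule U R M" "z \<in> carrier M"
  shows "U +>\<^bsub>M\<^esub> z = U \<longleftrightarrow> z \<in> U"
proof -
  interpret U: abelian_subgroup U M using abelian_subgroup_submodule[OF assms(1)] .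
  show ?thesis using U.a_rcos_self[OF assms(2)] U.a_rcos_const[of z] by auto
qed

lemma carrier_quotient_module: "carrier (quotient_module M U) = (\<lambda>z. U +>\<^bsub>M\<^esub> z) ` carrier M"
  unfolding quotient_module_def A_RCOSETS_def' by (simp add: UNION_singleton_eq_range)

lemma zero_quotient_module: "\<zero>\<^bsub>quotient_module M U\<^esub> = U"
  by (simp add: quotient_module_def)

text \<open>The union over representatives in \<open>quotient_module\<close> has only one member:
  for y and z in one coset, r y - r z lies in \<open>U\<close>.\<close>

lemma smult_quotient_module:
  assumes U: "submodule U R M" and r: "r \<in> carrier R" and z: "z \<in> carrier M"
  shows "r \<odot>\<^bsub>quotient_module M U\<^esub> (U +>\<^bsub>M\<^esub> z) = U +>\<^bsub>M\<^esub> (r \<odot>\<^bsub>M\<^esub> z)"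
proof -
  interpret U: abelian_subgroup U M using abelian_subgroup_submodule[OF U] .
  have "U +>\<^bsub>M\<^esub> (r \<odot>\<^bsub>M\<^esub> y) = U +>\<^bsub>M\<^esub> (r \<odot>\<^bsub>M\<^esub> z)" if y: "y \<in> U +>\<^bsub>M\<^esub> z" for y
  proof -
    have yC: "y \<in> carrier M" using y z U.a_elemrcos_carrier by blast
    have "y \<ominus>\<^bsub>M\<^esub> z \<in> U" using U.a_rcos_module_imp[OF z] y by (simp add: a_minus_def)
    then have "r \<odot>\<^bsub>M\<^esub> y \<ominus>\<^bsub>M\<^esub> r \<odot>\<^bsub>M\<^esub> z \<in> U"
      using submoduleE(4)[OF U r, of "y \<ominus>\<^bsub>M\<^esub> z"] smult_minus_distr[OF r yC z] by simp
    then have "r \<odot>\<^bsub>M\<^esub> y \<in> U +>\<^bsub>M\<^esub> (r \<odot>\<^bsub>M\<^esub> z)"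
      using U.a_rcos_module[of "r \<odot>\<^bsub>M\<^esub> z" "r \<odot>\<^bsub>M\<^esub> y"] r z yC by (simp add: a_minus_def)
    then show ?thesis using U.a_repr_independence' r z by blast
  qed
  then have "(\<Union>y\<in>U +>\<^bsub>M\<^esub> z. U +>\<^bsub>M\<^esub> (r \<odot>\<^bsub>M\<^esub> y)) = U +>\<^bsub>M\<^esub> (r \<odot>\<^bsub>M\<^esub> z)"
    using U.a_rcos_self[OF z] by blast
  then show ?thesis by (simp add: quotient_module_def)
qed

lemma carrier_quotient_module_trivial_iff:
  assumes "submodule U R M"
  shows "carrier (quotient_module M U) = {\<zero>\<^bsub>quotient_module M U\<^esub>} \<longleftrightarrow> carrier M \<subseteq> U"
proof -
  have im: "f ` A = {u} \<longleftrightarrow> (\<forall>z\<in>A. f z = u)" if "A \<noteq> {}" for f :: "'c \<Rightarrow> 'c set" and A u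
    using that by auto
  have "carrier M \<noteq> {}" using M.zero_closed by blast
  then show ?thesis
    unfolding carrier_quotient_module zero_quotient_module
    by (simp add: im coset_eq_submodule_iff[OF assms] subset_eq)
qed

lemma nonzerodivisor_on_quotient_module:
  assumes "submodule U R M" "r \<in> carrier R"
  shows "nonzerodivisor_on (quotient_module M U) r \<longleftrightarrow> (\<forall>z\<in>carrier M. r \<odot>\<^bsub>M\<^esub> z \<in> U \<longrightarrow> z \<in> U)"
  unfolding nonzerodivisor_on_def carrier_quotient_module zero_quotient_module
  using coset_eq_submodule_iff[OF assms(1)] smult_quotient_module[OF assms] assms(2) by simp

end

text \<open>Choose a sequence of distinct members of an infinite direct family and a representative
  z_n of a non-zero element of each. A multiple of z_n in the span of its predecessors would relate
  different summands, so it is zero modulo \<open>U\<close>, against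
  \<open>finite_Goldie_pair\<close>.\<close>

lemma (in module) finite_Goldie_dimension_quotient_module:
  assumes U: "submodule U R M" and fin: "finite_Goldie_pair R M (carrier M) U"
  shows "finite_Goldie_dimension R (quotient_module M U)"
  unfolding finite_Goldie_dimension_def
proof
  define Q where "Q = quotient_module M U"
  interpret U: abelian_subgroup U M using abelian_subgroup_submodule[OF U] .
  define c where "c z = U +>\<^bsub>M\<^esub> z" for z
  have c_zero: "c z = U \<longleftrightarrow> z \<in> U" if "z \<in> carrier M" for z
    unfolding c_def using coset_eq_submodule_iff[OF U that] .
  have Q_carrier: "carrier Q = c ` carrier M"
    unfolding Q_def c_def by (rule carrier_quotient_module)
  have Q_zero: "\<zero>\<^bsub>Q\<^esub> = U" unfolding Q_def by (rule zero_quotient_module)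
  have Q_add: "c z \<oplus>\<^bsub>Q\<^esub> c w = c (z \<oplus>\<^bsub>M\<^esub> w)" if "z \<in> carrier M" "w \<in> carrier M" for z w
    using U.a_rcos_sum[OF that] by (simp add: Q_def quotient_module_def c_def)
  have Q_smult: "r \<odot>\<^bsub>Q\<^esub> c z = c (r \<odot>\<^bsub>M\<^esub> z)" if "r \<in> carrier R" "z \<in> carrier M" for r z
    unfolding Q_def c_def using smult_quotient_module[OF U that] .
  have zero_c: "\<zero>\<^bsub>Q\<^esub> = c \<zero>\<^bsub>M\<^esub>" using c_zero[OF M.zero_closed] submodule_zero[OF U] Q_zero by simp
  interpret Q: abelian_monoid Q
    by (rule abelian_monoidI) (auto simp: Q_carrier zero_c Q_add M.a_ac)
  assume "\<exists>\<N>. infinite \<N> \<and> (\<forall>N\<in>\<N>. submodule N R (quotient_module M U) \<and> N \<noteq> {\<zero>\<^bsub>quotient_module M U\<^esub>})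
    \<and> direct_family (quotient_module M U) \<N>"
  then obtain \<N> where inf: "infinite \<N>" and sub: "\<And>N. N \<in> \<N> \<Longrightarrow> submodule N R Q"
    and nz: "\<And>N. N \<in> \<N> \<Longrightarrow> N \<noteq> {\<zero>\<^bsub>Q\<^esub>}" and dir: "direct_family Q \<N>" unfolding Q_def by blast
  obtain f :: "nat \<Rightarrow> _" where f: "inj f" "range f \<subseteq> \<N>" using infinite_countable_subset[OF inf] by blast
  then have subf: "submodule (f n) R Q" for n using sub by blast
  have fC: "f n \<subseteq> carrier Q" and f0: "\<zero>\<^bsub>Q\<^esub> \<in> f n" for n
    using subgroup.subset[OF submodule.axioms(1)[OF subf]]
      subgroup.one_closed[OF submodule.axioms(1)[OF subf]] by auto
  have fs: "r \<odot>\<^bsub>Q\<^esub> q \<in> f n" if "r \<in> carrier R" "q \<in> f n" for r q n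
    using submodule.smult_closed[OF subf that] .
  have "\<exists>z. z \<in> carrier M \<and> z \<notin> U \<and> c z \<in> f n" for n
  proof -
    obtain q where "q \<in> f n" "q \<noteq> \<zero>\<^bsub>Q\<^esub>" using nz[of "f n"] f(2) f0[of n] by blast
    moreover from this obtain w where "w \<in> carrier M" "q = c w" using fC[of n] Q_carrier by blast
    ultimately show ?thesis using c_zero[of w] Q_zero by auto
  qed
  then obtain z where z: "\<And>n. z n \<in> carrier M" "\<And>n. z n \<notin> U" "\<And>n. c (z n) \<in> f n" by metis
  then have zR: "range z \<subseteq> carrier M" by blast
  have cf: "c (r \<odot>\<^bsub>M\<^esub> z n) \<in> f n" if "r \<in> carrier R" for r n
    using fs[OF that z(3)[of n]] Q_smult[OF that z(1)] by simp
  have notin: "f n \<notin> f ` {..<n}" for n using f(1) by (auto dest: injD)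
  \<comment> \<open>\<open>direct_family\<close> indexes a sum by the submodules themselves, so a
    new entry at \<open>f n\<close> leaves the earlier ones unchanged because \<open>f\<close> is
    injective.\<close>
  have insert_sum: "(\<Oplus>\<^bsub>Q\<^esub>N\<in>insert (f n) (f ` {..<n}). (x(f n := q)) N) = q \<oplus>\<^bsub>Q\<^esub> (\<Oplus>\<^bsub>Q\<^esub>N\<in>f ` {..<n}. x N)"
    if q: "q \<in> f n" and x: "\<And>i. i < n \<Longrightarrow> x (f i) \<in> f i" for x q n
  proof -
    have xC: "x (f i) \<in> carrier Q" if "i < n" for i using x[OF that] fC by blast
    have qC: "q \<in> carrier Q" using q fC by blast
    have eq: "(x(f n := q)) N = x N" if "N \<in> f ` {..<n}" for N using that notin[of n] by auto
    have "(\<Oplus>\<^bsub>Q\<^esub>N\<in>insert (f n) (f ` {..<n}). (x(f n := q)) N) =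
      (x(f n := q)) (f n) \<oplus>\<^bsub>Q\<^esub> (\<Oplus>\<^bsub>Q\<^esub>N\<in>f ` {..<n}. (x(f n := q)) N)"
      using notin[of n] xC qC by (intro Q.finsum_insert) auto
    also have "(\<Oplus>\<^bsub>Q\<^esub>N\<in>f ` {..<n}. (x(f n := q)) N) = (\<Oplus>\<^bsub>Q\<^esub>N\<in>f ` {..<n}. x N)"
      using xC eq by (intro Q.finsum_cong') auto
    finally show ?thesis by simp
  qed
  have sum: "\<exists>x. (\<forall>i<n. x (f i) \<in> f i) \<and> c s = (\<Oplus>\<^bsub>Q\<^esub>N\<in>f ` {..<n}. x N)"
    if "s \<in> span_chain R M U z n" for s n
    using that
  proof (induct n arbitrary: s)
    case 0
    then show ?case using c_zero[of s] submodule_carrier[OF U] Q_zero by simp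
  next
    case (Suc n)
    then obtain s0 r where s: "s = s0 \<oplus>\<^bsub>M\<^esub> r \<odot>\<^bsub>M\<^esub> z n" "s0 \<in> span_chain R M U z n" "r \<in> carrier R"
      by auto
    obtain x where x: "\<And>i. i < n \<Longrightarrow> x (f i) \<in> f i" "c s0 = (\<Oplus>\<^bsub>Q\<^esub>N\<in>f ` {..<n}. x N)"
      using Suc.hyps[OF s(2)] by blast
    have s0: "s0 \<in> carrier M" using submodule_carrier[OF submodule_span_chain[OF U zR] s(2)] .
    define x' where "x' = x(f n := c (r \<odot>\<^bsub>M\<^esub> z n))"
    have x'f: "x' (f i) \<in> f i" if "i < Suc n" for i
      using that x(1) cf[OF s(3)] f(1) by (auto simp: x'_def less_Suc_eq dest: injD)
    have "(\<Oplus>\<^bsub>Q\<^esub>N\<in>f ` {..<Suc n}. x' N) = (\<Oplus>\<^bsub>Q\<^esub>N\<in>insert (f n) (f ` {..<n}). x' N)"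
      by (simp add: lessThan_Suc)
    also have "\<dots> = c (r \<odot>\<^bsub>M\<^esub> z n) \<oplus>\<^bsub>Q\<^esub> c s0"
      unfolding x'_def x(2) by (rule insert_sum[OF cf[OF s(3)] x(1)])
    also have "\<dots> = c s" using s s0 z(1) Q_add by (simp add: M.a_comm)
    finally show ?case using x'f by (intro exI[of _ x']) simp
  qed
  have "r \<odot>\<^bsub>M\<^esub> z n \<in> U" if r: "r \<in> carrier R" "r \<odot>\<^bsub>M\<^esub> z n \<in> span_chain R M U z n" for r n
  proof -
    obtain x where x: "\<And>i. i < n \<Longrightarrow> x (f i) \<in> f i" "c (r \<odot>\<^bsub>M\<^esub> z n) = (\<Oplus>\<^bsub>Q\<^esub>N\<in>f ` {..<n}. x N)"
      using sum[OF r(2)] by blast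
    \<comment> \<open>Entering -r z_n at \<open>f n\<close> next to the expansion of r z_n over the
      earlier members makes the sum vanish, and directness kills the new entry.\<close>
    define x' where "x' = x(f n := c ((\<ominus> r) \<odot>\<^bsub>M\<^esub> z n))"
    have x'f: "x' (f i) \<in> f i" if "i < Suc n" for i
      using that x(1) cf[of "\<ominus> r"] r(1) f(1) by (auto simp: x'_def less_Suc_eq dest: injD)
    have "(\<Oplus>\<^bsub>Q\<^esub>N\<in>insert (f n) (f ` {..<n}). x' N) = c ((\<ominus> r) \<odot>\<^bsub>M\<^esub> z n) \<oplus>\<^bsub>Q\<^esub> c (r \<odot>\<^bsub>M\<^esub> z n)"
      unfolding x'_def x(2) using r(1) by (intro insert_sum[OF cf x(1)]) auto
    also have "\<dots> = \<zero>\<^bsub>Q\<^esub>"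
      using r(1) z(1)[of n] Q_add by (simp add: smult_l_minus M.l_neg zero_c)
    finally have zero: "(\<Oplus>\<^bsub>Q\<^esub>N\<in>insert (f n) (f ` {..<n}). x' N) = \<zero>\<^bsub>Q\<^esub>" .
    have "\<forall>N\<in>insert (f n) (f ` {..<n}). x' N \<in> N" using x'f by auto
    moreover have "insert (f n) (f ` {..<n}) \<subseteq> \<N>" using f(2) by auto
    moreover have "finite (insert (f n) (f ` {..<n}))" by simp
    ultimately have "\<forall>N\<in>insert (f n) (f ` {..<n}). x' N = \<zero>\<^bsub>Q\<^esub>"
      using dir zero unfolding direct_family_def by metis
    then have "x' (f n) = \<zero>\<^bsub>Q\<^esub>" by simp
    then have "\<ominus>\<^bsub>M\<^esub> (r \<odot>\<^bsub>M\<^esub> z n) \<in> U"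
      using c_zero[of "(\<ominus> r) \<odot>\<^bsub>M\<^esub> z n"] r(1) z(1)[of n] Q_zero by (simp add: x'_def smult_l_minus)
    then show ?thesis using submoduleE(3)[OF U] r(1) z(1)[of n] M.minus_minus[of "r \<odot>\<^bsub>M\<^esub> z n"] by fastforce
  qed
  then have "\<exists>z. (\<forall>n. z n \<in> carrier M - U) \<and>
    (\<forall>n. \<forall>r\<in>carrier R. r \<odot>\<^bsub>M\<^esub> z n \<in> span_chain R M U z n \<longrightarrow> r \<odot>\<^bsub>M\<^esub> z n \<in> U)"
    using z(1,2) by (intro exI[of _ z]) blast
  then show False using fin unfolding finite_Goldie_pair_def by blast
qed

section \<open>Localization quotients\<close>

text \<open>For \<open>U\<close> inside \<open>N\<close> and H = N/U, dividing \<open>N\<close> by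
  this submodule gives H/aH.\<close>

definition plus_mult ::
  "('a, 'r) ring_scheme \<Rightarrow> ('a, 'm, 'x) module_scheme \<Rightarrow> 'm set \<Rightarrow> 'a \<Rightarrow> 'm set \<Rightarrow> 'm set"
  where "plus_mult R M U a N = {u \<oplus>\<^bsub>M\<^esub> a \<odot>\<^bsub>M\<^esub> n | u n. u \<in> U \<and> n \<in> N}"

text \<open>With H = N/U: each element of the list is a non-zero-divisor on H modulo the earlier
  ones, and the last quotient has finite Goldie dimension. Quotients are formed by enlarging
  \<open>U\<close> while \<open>N\<close> stays fixed, so the type of the elements does not
  change.\<close>

primrec regular_Goldie ::
  "('a, 'r) ring_scheme \<Rightarrow> ('a, 'm, 'x) module_scheme \<Rightarrow> 'm set \<Rightarrow> 'a list \<Rightarrow> 'm set \<Rightarrow> bool"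
  where
    "regular_Goldie R M N [] U = finite_Goldie_pair R M N U"
  | "regular_Goldie R M N (a # as) U \<longleftrightarrow>
      (\<forall>n\<in>N. a \<odot>\<^bsub>M\<^esub> n \<in> U \<longrightarrow> n \<in> U) \<and> regular_Goldie R M N as (plus_mult R M U a N)"

lemma (in module) plus_multI:
  assumes "submodule U R M" "n \<in> N" "N \<subseteq> carrier M" "a \<in> carrier R" "z \<in> carrier M"
    and "z \<ominus>\<^bsub>M\<^esub> a \<odot>\<^bsub>M\<^esub> n \<in> U"
  shows "z \<in> plus_mult R M U a N"
proof -
  have "n \<in> carrier M" using assms by blast
  then have "z = (z \<ominus>\<^bsub>M\<^esub> a \<odot>\<^bsub>M\<^esub> n) \<oplus>\<^bsub>M\<^esub> a \<odot>\<^bsub>M\<^esub> n"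
    using assms(4,5) by (simp add: a_minus_def M.a_assoc M.l_neg)
  then show ?thesis using assms(2,6) unfolding plus_mult_def by blast
qed

lemma (in module) plus_multE:
  assumes "submodule U R M" "N \<subseteq> carrier M" "a \<in> carrier R" "z \<in> plus_mult R M U a N"
  obtains n where "n \<in> N" "z \<ominus>\<^bsub>M\<^esub> a \<odot>\<^bsub>M\<^esub> n \<in> U" "z \<in> carrier M"
proof -
  obtain u n where un: "z = u \<oplus>\<^bsub>M\<^esub> a \<odot>\<^bsub>M\<^esub> n" "u \<in> U" "n \<in> N" using assms(4) by (auto simp: plus_mult_def)
  moreover have "u \<in> carrier M" "n \<in> carrier M" using un assms submodule_carrier by auto
  ultimately show thesis
    using that[of n] assms(3) by (simp add: a_minus_def M.a_assoc M.r_neg)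
qed

lemma (in module) submodule_plus_mult:
  assumes U: "submodule U R M" and N: "submodule N R M" and a: "a \<in> carrier R"
  shows "submodule (plus_mult R M U a N) R M"
proof (rule submoduleI)
  have UC: "s \<in> carrier M" if "s \<in> U" for s using that U submodule_carrier by blast
  have NC: "s \<in> carrier M" if "s \<in> N" for s using that N submodule_carrier by blast
  have I: "u \<oplus>\<^bsub>M\<^esub> a \<odot>\<^bsub>M\<^esub> n \<in> plus_mult R M U a N" if "u \<in> U" "n \<in> N" for u n
    using that by (auto simp: plus_mult_def)
  show "plus_mult R M U a N \<subseteq> carrier M" using UC NC a by (auto simp: plus_mult_def)
  show "\<zero>\<^bsub>M\<^esub> \<in> plus_mult R M U a N" using I[OF submodule_zero[OF U] submodule_zero[OF N]] a by simp
  fix z assume "z \<in> plus_mult R M U a N"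
  then obtain u n where z: "z = u \<oplus>\<^bsub>M\<^esub> a \<odot>\<^bsub>M\<^esub> n" "u \<in> U" "n \<in> N" by (auto simp: plus_mult_def)
  have "\<ominus>\<^bsub>M\<^esub> z = \<ominus>\<^bsub>M\<^esub> u \<oplus>\<^bsub>M\<^esub> a \<odot>\<^bsub>M\<^esub> (\<ominus>\<^bsub>M\<^esub> n)"
    using z UC NC a by (simp add: M.minus_add smult_r_minus)
  then show "\<ominus>\<^bsub>M\<^esub> z \<in> plus_mult R M U a N"
    using I[OF submoduleE(3)[OF U z(2)] submoduleE(3)[OF N z(3)]] by simp
  {
    fix w assume "w \<in> plus_mult R M U a N"
    then obtain v m where w: "w = v \<oplus>\<^bsub>M\<^esub> a \<odot>\<^bsub>M\<^esub> m" "v \<in> U" "m \<in> N" by (auto simp: plus_mult_def)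
    have "z \<oplus>\<^bsub>M\<^esub> w = (u \<oplus>\<^bsub>M\<^esub> v) \<oplus>\<^bsub>M\<^esub> a \<odot>\<^bsub>M\<^esub> (n \<oplus>\<^bsub>M\<^esub> m)"
      using z w UC NC a by (simp add: smult_r_distr M.a_ac)
    then show "z \<oplus>\<^bsub>M\<^esub> w \<in> plus_mult R M U a N"
      using I[OF submoduleE(5)[OF U z(2) w(2)] submoduleE(5)[OF N z(3) w(3)]] by simp
  }
  fix r assume r: "r \<in> carrier R"
  have "r \<odot>\<^bsub>M\<^esub> z = r \<odot>\<^bsub>M\<^esub> u \<oplus>\<^bsub>M\<^esub> a \<odot>\<^bsub>M\<^esub> (r \<odot>\<^bsub>M\<^esub> n)"
    using z UC NC a r by (simp add: smult_r_distr smult_left_commute)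
  then show "r \<odot>\<^bsub>M\<^esub> z \<in> plus_mult R M U a N"
    using I[OF submoduleE(4)[OF U r z(2)] submoduleE(4)[OF N r z(3)]] by simp
qed

lemma (in module) plus_mult_superset:
  assumes "submodule U R M" "submodule N R M" "a \<in> carrier R"
  shows "U \<subseteq> plus_mult R M U a N"
proof
  fix u assume "u \<in> U"
  then show "u \<in> plus_mult R M U a N"
    using plus_multI[OF assms(1) submodule_zero[OF assms(2)] _ assms(3), of u] submoduleE(1)[OF assms(2)]
      submodule_carrier[OF assms(1)] assms(3) submodule_minus[OF assms(1) _ submodule_zero[OF assms(1)]]
    by simp
qed

lemma (in module) plus_mult_mult_mem:
  assumes "submodule U R M" "n \<in> N" "N \<subseteq> carrier M" "a \<in> carrier R"
  shows "a \<odot>\<^bsub>M\<^esub> n \<in> plus_mult R M U a N"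
proof -
  have "n \<in> carrier M" using assms by blast
  then show ?thesis
    using plus_multI[OF assms, of "a \<odot>\<^bsub>M\<^esub> n"] assms(4) submodule_zero[OF assms(1)] by (simp add: a_minus_def M.r_neg)
qed

lemma (in module) plus_mult_commute:
  assumes "submodule U R M" "submodule N R M" "a \<in> carrier R" "b \<in> carrier R"
  shows "plus_mult R M (plus_mult R M U a N) b N = plus_mult R M (plus_mult R M U b N) a N"
proof -
  have UC: "s \<in> carrier M" if "s \<in> U" for s using that assms submodule_carrier by blast
  have NC: "s \<in> carrier M" if "s \<in> N" for s using that assms submodule_carrier by blast
  have "plus_mult R M (plus_mult R M U a N) b N \<subseteq> plus_mult R M (plus_mult R M U b N) a N"
    if ab: "a \<in> carrier R" "b \<in> carrier R" for a b
  proof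
    fix z assume "z \<in> plus_mult R M (plus_mult R M U a N) b N"
    then obtain u n m where "z = u \<oplus>\<^bsub>M\<^esub> a \<odot>\<^bsub>M\<^esub> n \<oplus>\<^bsub>M\<^esub> b \<odot>\<^bsub>M\<^esub> m" and uN: "u \<in> U" "n \<in> N" "m \<in> N"
      by (auto simp: plus_mult_def)
    then have "z = u \<oplus>\<^bsub>M\<^esub> b \<odot>\<^bsub>M\<^esub> m \<oplus>\<^bsub>M\<^esub> a \<odot>\<^bsub>M\<^esub> n" using UC NC ab by (simp add: M.a_ac)
    then show "z \<in> plus_mult R M (plus_mult R M U b N) a N" using uN unfolding plus_mult_def by blast
  qed
  then show ?thesis using assms by blast
qed

section \<open>Regular sequences: exchanging two elements and taking powers\<close>

context module
begin

lemma smult_pow_Suc: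
  "a \<in> carrier R \<Longrightarrow> z \<in> carrier M \<Longrightarrow> (a [^] Suc k) \<odot>\<^bsub>M\<^esub> z = a \<odot>\<^bsub>M\<^esub> ((a [^] k) \<odot>\<^bsub>M\<^esub> z)"
  using smult_pow_add[of a z 1 k] by simp

lemma submodule_minus_trans:
  assumes "submodule U R M" "a \<in> carrier M" "b \<in> carrier M" "c \<in> carrier M"
    and "a \<ominus>\<^bsub>M\<^esub> b \<in> U" "b \<ominus>\<^bsub>M\<^esub> c \<in> U"
  shows "a \<ominus>\<^bsub>M\<^esub> c \<in> U"
proof -
  have "a \<ominus>\<^bsub>M\<^esub> c = (a \<ominus>\<^bsub>M\<^esub> b) \<oplus>\<^bsub>M\<^esub> (b \<ominus>\<^bsub>M\<^esub> c)"
    using assms(2-4) by (simp add: a_minus_def M.a_ac M.r_neg1 M.r_neg2 M.r_neg)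
  then show ?thesis using submoduleE(5)[OF assms(1,5,6)] by simp
qed

lemma submodule_smult_minus:
  assumes "submodule U R M" "r \<in> carrier R" "a \<in> carrier M" "b \<in> carrier M" "a \<ominus>\<^bsub>M\<^esub> b \<in> U"
  shows "r \<odot>\<^bsub>M\<^esub> a \<ominus>\<^bsub>M\<^esub> r \<odot>\<^bsub>M\<^esub> b \<in> U"
  using submoduleE(4)[OF assms(1,2,5)] smult_minus_distr[OF assms(2-4)] by simp

text \<open>In H = N/U: if a n = b m, then b m vanishes in H/aH, so m = a p, and cancelling a in a n
  = a b p leaves n = b p. This allows the quotient by b to be taken before localizing at a.\<close>

lemma regular_on_quotient_commute:
  assumes U: "submodule U R M" and N: "submodule N R M" and a: "a \<in> carrier R" and b: "b \<in> carrier R"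
    and reg_a: "\<And>n. n \<in> N \<Longrightarrow> a \<odot>\<^bsub>M\<^esub> n \<in> U \<Longrightarrow> n \<in> U"
    and reg_b: "\<And>n. n \<in> N \<Longrightarrow> b \<odot>\<^bsub>M\<^esub> n \<in> plus_mult R M U a N \<Longrightarrow> n \<in> plus_mult R M U a N"
    and n: "n \<in> N" "a \<odot>\<^bsub>M\<^esub> n \<in> plus_mult R M U b N"
  shows "n \<in> plus_mult R M U b N"
proof -
  have NC: "s \<in> carrier M" if "s \<in> N" for s using that N submodule_carrier by blast
  note NM = submoduleE(1)[OF N]
  obtain m where m: "m \<in> N" "a \<odot>\<^bsub>M\<^esub> n \<ominus>\<^bsub>M\<^esub> b \<odot>\<^bsub>M\<^esub> m \<in> U"
    using plus_multE[OF U NM b n(2)] by blast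
  have "b \<odot>\<^bsub>M\<^esub> m \<ominus>\<^bsub>M\<^esub> a \<odot>\<^bsub>M\<^esub> n \<in> U"
    using submodule_minus_commute[OF U _ _ m(2)] a b n(1) m(1) NC by simp
  then have "b \<odot>\<^bsub>M\<^esub> m \<in> plus_mult R M U a N"
    using plus_multI[OF U n(1) NM a] b m(1) NC by simp
  then obtain p where p: "p \<in> N" "m \<ominus>\<^bsub>M\<^esub> a \<odot>\<^bsub>M\<^esub> p \<in> U"
    using plus_multE[OF U NM a reg_b[OF m(1)]] by blast
  have "b \<odot>\<^bsub>M\<^esub> m \<ominus>\<^bsub>M\<^esub> b \<odot>\<^bsub>M\<^esub> (a \<odot>\<^bsub>M\<^esub> p) \<in> U"
    using submodule_smult_minus[OF U b _ _ p(2)] m(1) p(1) NC a by simp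
  then have "a \<odot>\<^bsub>M\<^esub> n \<ominus>\<^bsub>M\<^esub> b \<odot>\<^bsub>M\<^esub> (a \<odot>\<^bsub>M\<^esub> p) \<in> U"
    using submodule_minus_trans[OF U _ _ _ m(2)] n(1) m(1) p(1) NC a b by simp
  then have "a \<odot>\<^bsub>M\<^esub> (n \<ominus>\<^bsub>M\<^esub> b \<odot>\<^bsub>M\<^esub> p) \<in> U"
    using n(1) p(1) NC a b by (simp add: smult_minus_distr smult_left_commute[of a b])
  moreover have "n \<ominus>\<^bsub>M\<^esub> b \<odot>\<^bsub>M\<^esub> p \<in> N" using submodule_minus[OF N n(1) submoduleE(4)[OF N b p(1)]] .
  ultimately show ?thesis using reg_a plus_multI[OF U p(1) NM b] NC n(1) by blast
qed

text \<open>A fraction z/a^j lies in H = N/U exactly when z is in a^j H, so regularity of b on H_a/H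
  amounts to regularity on all H/a^j H. Inductively, b n = a^(j+1) m gives n = a p; cancelling a
  gives b p = a^j m, and the case j puts p in a^j H.\<close>

lemma regular_on_power_quotient:
  assumes U: "submodule U R M" and N: "submodule N R M" and a: "a \<in> carrier R" and b: "b \<in> carrier R"
    and reg_a: "\<And>n. n \<in> N \<Longrightarrow> a \<odot>\<^bsub>M\<^esub> n \<in> U \<Longrightarrow> n \<in> U"
    and reg_b: "\<And>n. n \<in> N \<Longrightarrow> b \<odot>\<^bsub>M\<^esub> n \<in> plus_mult R M U a N \<Longrightarrow> n \<in> plus_mult R M U a N"
    and n: "n \<in> N" "b \<odot>\<^bsub>M\<^esub> n \<in> plus_mult R M U (a [^] (j::nat)) N"
  shows "n \<in> plus_mult R M U (a [^] j) N"
  using n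
proof (induct j arbitrary: n)
  case 0
  have "n \<in> carrier M" using 0 N submodule_carrier by blast
  then show ?case
    using plus_multI[OF U 0(1) submoduleE(1)[OF N] R.one_closed] submodule_zero[OF U]
    by (simp add: a_minus_def M.r_neg)
next
  case (Suc j)
  have NC: "s \<in> carrier M" if "s \<in> N" for s using that N submodule_carrier by blast
  note NM = submoduleE(1)[OF N]
  have aj: "a [^] j \<in> carrier R" "a [^] Suc j \<in> carrier R" using a by simp_all
  obtain m where m: "m \<in> N" "b \<odot>\<^bsub>M\<^esub> n \<ominus>\<^bsub>M\<^esub> (a [^] Suc j) \<odot>\<^bsub>M\<^esub> m \<in> U"
    using plus_multE[OF U NM aj(2) Suc.prems(2)] by blast
  then have "b \<odot>\<^bsub>M\<^esub> n \<ominus>\<^bsub>M\<^esub> a \<odot>\<^bsub>M\<^esub> ((a [^] j) \<odot>\<^bsub>M\<^esub> m) \<in> U" using smult_pow_Suc[OF a NC] by simp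
  note m2 = this
  then have "b \<odot>\<^bsub>M\<^esub> n \<in> plus_mult R M U a N"
    using plus_multI[OF U submoduleE(4)[OF N aj(1) m(1)] NM a] b Suc.prems(1) NC by simp
  then obtain p where p: "p \<in> N" "n \<ominus>\<^bsub>M\<^esub> a \<odot>\<^bsub>M\<^esub> p \<in> U"
    using plus_multE[OF U NM a reg_b[OF Suc.prems(1)]] by blast
  have C: "n \<in> carrier M" "m \<in> carrier M" "p \<in> carrier M" using Suc.prems(1) m(1) p(1) NC by auto
  have "b \<odot>\<^bsub>M\<^esub> (a \<odot>\<^bsub>M\<^esub> p) \<ominus>\<^bsub>M\<^esub> b \<odot>\<^bsub>M\<^esub> n \<in> U"
    using submodule_smult_minus[OF U b _ _ submodule_minus_commute[OF U _ _ p(2)]] C a by simp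
  then have "b \<odot>\<^bsub>M\<^esub> (a \<odot>\<^bsub>M\<^esub> p) \<ominus>\<^bsub>M\<^esub> a \<odot>\<^bsub>M\<^esub> ((a [^] j) \<odot>\<^bsub>M\<^esub> m) \<in> U"
    using submodule_minus_trans[OF U _ _ _ _ m2] C a b aj by simp
  then have "a \<odot>\<^bsub>M\<^esub> (b \<odot>\<^bsub>M\<^esub> p \<ominus>\<^bsub>M\<^esub> (a [^] j) \<odot>\<^bsub>M\<^esub> m) \<in> U"
    using C a b aj by (simp add: smult_minus_distr smult_left_commute[of a b])
  then have "b \<odot>\<^bsub>M\<^esub> p \<ominus>\<^bsub>M\<^esub> (a [^] j) \<odot>\<^bsub>M\<^esub> m \<in> U"
    using reg_a submodule_minus[OF N submoduleE(4)[OF N b p(1)] submoduleE(4)[OF N aj(1) m(1)]] by blast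
  then have "b \<odot>\<^bsub>M\<^esub> p \<in> plus_mult R M U (a [^] j) N"
    using plus_multI[OF U m(1) NM aj(1)] C b by simp
  then obtain q where q: "q \<in> N" "p \<ominus>\<^bsub>M\<^esub> (a [^] j) \<odot>\<^bsub>M\<^esub> q \<in> U"
    using plus_multE[OF U NM aj(1) Suc.hyps[OF p(1)]] by blast
  have "a \<odot>\<^bsub>M\<^esub> p \<ominus>\<^bsub>M\<^esub> a \<odot>\<^bsub>M\<^esub> ((a [^] j) \<odot>\<^bsub>M\<^esub> q) \<in> U"
    using submodule_smult_minus[OF U a _ _ q(2)] C aj q(1) NC by simp
  then have "n \<ominus>\<^bsub>M\<^esub> a \<odot>\<^bsub>M\<^esub> ((a [^] j) \<odot>\<^bsub>M\<^esub> q) \<in> U"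
    using submodule_minus_trans[OF U _ _ _ p(2)] C a aj q(1) NC by simp
  then show ?case
    using plus_multI[OF U q(1) NM aj(2) C(1)] smult_pow_Suc[OF a NC[OF q(1)]] by simp
qed

end

text \<open>
  \<open>N' / U'\<close> is the quotient \<open>H\<^sub>x / H\<close> of the localization of \<open>H = N / U\<close> at the powers of \<open>x\<close>, and
  \<open>D k z z'\<close> means that \<open>z'\<close> represents the class of \<open>z / x\<^sup>k\<close>.
\<close>

locale localization_quotient = A: module R A + B: module R B
  for R :: "('a, 'r) ring_scheme" and A :: "('a, 'm, 'x) module_scheme" and B :: "('a, 'n, 'y) module_scheme" +
  fixes x :: 'a and N U :: "'m set" and N' U' :: "'n set" and D :: "nat \<Rightarrow> 'm \<Rightarrow> 'n \<Rightarrow> bool"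
  assumes x: "x \<in> carrier R"
    and N: "submodule N R A" and U: "submodule U R A"
    and N': "submodule N' R B" and U': "submodule U' R B"
    and linear: "linear_between R A B (D k)"
    and domain: "D k z z' \<Longrightarrow> z \<in> N \<and> z' \<in> N'"
    and total: "z \<in> N \<Longrightarrow> \<exists>z'. D k z z'"
    and covering: "z' \<in> N' \<Longrightarrow> \<exists>k z. D k z z'"
    and mem_iff: "D k z z' \<Longrightarrow> z' \<in> U' \<longleftrightarrow> z \<in> plus_mult R A U (x [^]\<^bsub>R\<^esub> k) N"
    and shift: "D k z z' \<Longrightarrow> D (Suc k) (x \<odot>\<^bsub>A\<^esub> z) z'"
begin

lemma NC: "z \<in> N \<Longrightarrow> z \<in> carrier A" using N A.submodule_carrier by blast
lemma N'C: "z \<in> N' \<Longrightarrow> z \<in> carrier B" using N' B.submodule_carrier by blast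

lemma x_pow: "x [^]\<^bsub>R\<^esub> (k::nat) \<in> carrier R" using x by simp

lemma D_minus: "D k z z' \<Longrightarrow> D k w w' \<Longrightarrow> D k (z \<ominus>\<^bsub>A\<^esub> w) (z' \<ominus>\<^bsub>B\<^esub> w')"
  using linear_between_minus[OF A.module_axioms B.module_axioms linear] domain NC N'C by blast

lemma D_smult: "r \<in> carrier R \<Longrightarrow> D k z z' \<Longrightarrow> D k (r \<odot>\<^bsub>A\<^esub> z) (r \<odot>\<^bsub>B\<^esub> z')"
  using linear unfolding linear_between_def by blast

lemma D_shift: "D k z z' \<Longrightarrow> D (j + k) ((x [^]\<^bsub>R\<^esub> j) \<odot>\<^bsub>A\<^esub> z) z'"
proof (induct j)
  case 0
  then show ?case using domain NC by simp
next
  case (Suc j)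
  then show ?case using shift[of "j + k"] domain NC A.smult_pow_Suc[OF x] by fastforce
qed

lemma mem_of_U: "D k z z' \<Longrightarrow> z \<in> U \<Longrightarrow> z' \<in> U'"
  using mem_iff A.plus_mult_superset[OF U N x_pow] by blast

text \<open>Induction on the exponent of the denominator in z/x^(k+1). If z is outside xH, the
  multiple by x^k is z/x, which is non-zero modulo H; if z = x n in H, the fraction equals n/x^k.
  With exponent zero the class is zero, against the assumption.\<close>

lemma essential:
  assumes "D k z z'" "z' \<notin> U'"
  shows "\<exists>r\<in>carrier R. \<exists>w y. D 1 w y \<and> y \<notin> U' \<and> r \<odot>\<^bsub>B\<^esub> z' \<ominus>\<^bsub>B\<^esub> y \<in> U'"
  using assms
proof (induct k arbitrary: z z')
  case 0
  then have z: "z \<in> N" "z \<in> carrier A" using domain NC by blast+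
  then have "z \<in> plus_mult R A U \<one>\<^bsub>R\<^esub> N"
    using A.plus_mult_mult_mem[OF U z(1) A.submoduleE(1)[OF N] A.R.one_closed] by simp
  then show ?case using 0 mem_iff by simp
next
  case (Suc k)
  then have z: "z \<in> N" "z \<in> carrier A" "z' \<in> N'" "z' \<in> carrier B" using domain NC N'C by blast+
  obtain y where y: "D 1 z y" using total[OF z(1)] by blast
  then have yC: "y \<in> carrier B" using domain N'C by blast
  show ?case
  proof (cases "y \<in> U'")
    case False
    have "D (Suc k) ((x [^]\<^bsub>R\<^esub> k) \<odot>\<^bsub>A\<^esub> z \<ominus>\<^bsub>A\<^esub> (x [^]\<^bsub>R\<^esub> k) \<odot>\<^bsub>A\<^esub> z) ((x [^]\<^bsub>R\<^esub> k) \<odot>\<^bsub>B\<^esub> z' \<ominus>\<^bsub>B\<^esub> y)"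
      using D_minus[OF D_smult[OF x_pow Suc.prems(1)], where w' = y] D_shift[OF y, of k] by simp
    moreover have "(x [^]\<^bsub>R\<^esub> k) \<odot>\<^bsub>A\<^esub> z \<ominus>\<^bsub>A\<^esub> (x [^]\<^bsub>R\<^esub> k) \<odot>\<^bsub>A\<^esub> z \<in> U"
      using z(2) x_pow A.submodule_zero[OF U] by (simp add: a_minus_def A.M.r_neg)
    ultimately have "(x [^]\<^bsub>R\<^esub> k) \<odot>\<^bsub>B\<^esub> z' \<ominus>\<^bsub>B\<^esub> y \<in> U'" using mem_of_U by blast
    then show ?thesis using y False x_pow by blast
  next
    case True
    then have "z \<in> plus_mult R A U x N" using mem_iff[OF y] x by simp
    then obtain n where n: "n \<in> N" "z \<ominus>\<^bsub>A\<^esub> x \<odot>\<^bsub>A\<^esub> n \<in> U"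
      using A.plus_multE[OF U A.submoduleE(1)[OF N] x] by blast
    obtain n' where n': "D k n n'" using total[OF n(1)] by blast
    have n'C: "n' \<in> carrier B" using domain[OF n'] N'C by blast
    have d: "z' \<ominus>\<^bsub>B\<^esub> n' \<in> U'" using mem_of_U[OF D_minus[OF Suc.prems(1) shift[OF n']] n(2)] .
    then have "n' \<notin> U'" using B.submodule_minus_cancel[OF U' z(4)] Suc.prems(2) by blast
    then obtain r w v where r: "r \<in> carrier R" "D 1 w v" "v \<notin> U'" "r \<odot>\<^bsub>B\<^esub> n' \<ominus>\<^bsub>B\<^esub> v \<in> U'"
      using Suc.hyps[OF n'] by blast
    have "r \<odot>\<^bsub>B\<^esub> z' \<ominus>\<^bsub>B\<^esub> v \<in> U'"
      using B.submodule_minus_trans[OF U' _ _ _ B.submodule_smult_minus[OF U' r(1) z(4) n'C d] r(4)]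
        r(1) z(4) n'C domain[OF r(2)] N'C by simp
    then show ?thesis using r by blast
  qed
qed

text \<open>\<open>D 1\<close> sends z to z/x and so identifies H/xH with the submodule of H_x/H
  that \<open>essential\<close> shows to be essential.\<close>

lemma finite_Goldie_pair_localization:
  assumes "finite_Goldie_pair R A N (plus_mult R A U x N)"
  shows "finite_Goldie_pair R B N' U'"
proof (rule finite_Goldie_pair_transfer[OF A.module_axioms B.module_axioms N _ N' U' linear])
  show "submodule (plus_mult R A U x N) R A" using A.submodule_plus_mult[OF U N x] .
  show "z \<in> N \<and> z' \<in> N'" if "D 1 z z'" for z z' using domain[OF that] .
  show "z \<in> plus_mult R A U x N \<longleftrightarrow> z' \<in> U'" if "D 1 z z'" for z z' using mem_iff[OF that] x by simp
  show "\<exists>r\<in>carrier R. \<exists>z y. D 1 z y \<and> y \<notin> U' \<and> r \<odot>\<^bsub>B\<^esub> z' \<ominus>\<^bsub>B\<^esub> y \<in> U'"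
    if "z' \<in> N'" "z' \<notin> U'" for z'
    using covering[OF that(1)] essential that(2) by blast
qed (rule assms)

text \<open>Localization commutes with the quotient by y: dividing H_x/H by its multiples of y gives
  the same construction for H/yH, with the same relation \<open>D\<close>. Regularity of x on H/yH
  lets powers of x be cancelled there.\<close>

lemma localization_quotient_plus_mult:
  assumes y: "y \<in> carrier R"
    and reg: "\<And>n. n \<in> N \<Longrightarrow> x \<odot>\<^bsub>A\<^esub> n \<in> plus_mult R A U y N \<Longrightarrow> n \<in> plus_mult R A U y N"
  shows "localization_quotient R A B x N (plus_mult R A U y N) N' (plus_mult R B U' y N') D"
proof (intro localization_quotient.intro localization_quotient_axioms.intro)
  show "module R A" "module R B" by (rule A.module_axioms B.module_axioms)+
  note NM = A.submoduleE(1)[OF N] and NM' = B.submoduleE(1)[OF N']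
  have UyN: "submodule (plus_mult R A U y N) R A" using A.submodule_plus_mult[OF U N y] .
  show "x \<in> carrier R" "submodule N R A" "submodule N' R B" by (rule x N N')+
  show "submodule (plus_mult R A U y N) R A" by (rule UyN)
  show "submodule (plus_mult R B U' y N') R B" using B.submodule_plus_mult[OF U' N' y] .
  show "linear_between R A B (D k)" for k by (rule linear)
  show "z \<in> N \<and> z' \<in> N'" if "D k z z'" for k z z' using domain[OF that] .
  show "\<exists>z'. D k z z'" if "z \<in> N" for k z using total[OF that] .
  show "\<exists>k z. D k z z'" if "z' \<in> N'" for z' using covering[OF that] .
  show "D (Suc k) (x \<odot>\<^bsub>A\<^esub> z) z'" if "D k z z'" for k z z' using shift[OF that] .
  fix k z z' assume D: "D k z z'"
  have z: "z \<in> N" "z \<in> carrier A" "z' \<in> carrier B" using domain[OF D] NC N'C by blast+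
  show "z' \<in> plus_mult R B U' y N' \<longleftrightarrow> z \<in> plus_mult R A (plus_mult R A U y N) (x [^]\<^bsub>R\<^esub> k) N"
  proof
    assume "z \<in> plus_mult R A (plus_mult R A U y N) (x [^]\<^bsub>R\<^esub> k) N"
    then have "z \<in> plus_mult R A (plus_mult R A U (x [^]\<^bsub>R\<^esub> k) N) y N"
      using A.plus_mult_commute[OF U N y x_pow] by simp
    then obtain n where n: "n \<in> N" "z \<ominus>\<^bsub>A\<^esub> y \<odot>\<^bsub>A\<^esub> n \<in> plus_mult R A U (x [^]\<^bsub>R\<^esub> k) N"
      using A.plus_multE[OF A.submodule_plus_mult[OF U N x_pow] NM y] by blast
    obtain n' where n': "D k n n'" using total[OF n(1)] by blast
    have "z' \<ominus>\<^bsub>B\<^esub> y \<odot>\<^bsub>B\<^esub> n' \<in> U'" using mem_iff[OF D_minus[OF D D_smult[OF y n']]] n(2) by blast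
    then show "z' \<in> plus_mult R B U' y N'"
      using B.plus_multI[OF U' _ NM' y z(3)] domain[OF n'] by blast
  next
    assume "z' \<in> plus_mult R B U' y N'"
    then obtain n' where n': "n' \<in> N'" "z' \<ominus>\<^bsub>B\<^esub> y \<odot>\<^bsub>B\<^esub> n' \<in> U'"
      using B.plus_multE[OF U' NM' y] by blast
    obtain j n where n: "D j n n'" using covering[OF n'(1)] by blast
    have nN: "n \<in> N" "n \<in> carrier A" using domain[OF n] NC by blast+
    have xj: "x [^]\<^bsub>R\<^esub> j \<in> carrier R" and xk: "x [^]\<^bsub>R\<^esub> k \<in> carrier R" by (rule x_pow)+
    \<comment> \<open>The fractions z/x^k and n/x^j are brought to the common denominator
      x^(j+k).\<close>
    have "D (j + k) ((x [^]\<^bsub>R\<^esub> j) \<odot>\<^bsub>A\<^esub> z \<ominus>\<^bsub>A\<^esub> y \<odot>\<^bsub>A\<^esub> ((x [^]\<^bsub>R\<^esub> k) \<odot>\<^bsub>A\<^esub> n)) (z' \<ominus>\<^bsub>B\<^esub> y \<odot>\<^bsub>B\<^esub> n')"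
      using D_minus[OF D_shift[OF D, of j] D_smult[OF y D_shift[OF n, of k, unfolded add.commute[of k]]]] .
    then have "(x [^]\<^bsub>R\<^esub> j) \<odot>\<^bsub>A\<^esub> z \<ominus>\<^bsub>A\<^esub> y \<odot>\<^bsub>A\<^esub> ((x [^]\<^bsub>R\<^esub> k) \<odot>\<^bsub>A\<^esub> n) \<in> plus_mult R A U (x [^]\<^bsub>R\<^esub> (j + k)) N"
      using mem_iff n'(2) by blast
    then obtain m where m: "m \<in> N"
      "(x [^]\<^bsub>R\<^esub> j) \<odot>\<^bsub>A\<^esub> z \<ominus>\<^bsub>A\<^esub> y \<odot>\<^bsub>A\<^esub> ((x [^]\<^bsub>R\<^esub> k) \<odot>\<^bsub>A\<^esub> n) \<ominus>\<^bsub>A\<^esub> (x [^]\<^bsub>R\<^esub> (j + k)) \<odot>\<^bsub>A\<^esub> m \<in> U"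
      using A.plus_multE[OF U NM x_pow] by blast
    have mC: "m \<in> carrier A" using NC m(1) .
    \<comment> \<open>The relation just obtained says that x^j w lies in U + yN; the factor x^j is
      then cancelled by regularity of x on H/yH.\<close>
    define w where "w = z \<ominus>\<^bsub>A\<^esub> (x [^]\<^bsub>R\<^esub> k) \<odot>\<^bsub>A\<^esub> m"
    have wN: "w \<in> N" unfolding w_def using A.submodule_minus[OF N z(1) A.submoduleE(4)[OF N xk m(1)]] .
    have "(x [^]\<^bsub>R\<^esub> j) \<odot>\<^bsub>A\<^esub> w \<ominus>\<^bsub>A\<^esub> y \<odot>\<^bsub>A\<^esub> ((x [^]\<^bsub>R\<^esub> k) \<odot>\<^bsub>A\<^esub> n) =
      (x [^]\<^bsub>R\<^esub> j) \<odot>\<^bsub>A\<^esub> z \<ominus>\<^bsub>A\<^esub> y \<odot>\<^bsub>A\<^esub> ((x [^]\<^bsub>R\<^esub> k) \<odot>\<^bsub>A\<^esub> n) \<ominus>\<^bsub>A\<^esub> (x [^]\<^bsub>R\<^esub> (j + k)) \<odot>\<^bsub>A\<^esub> m"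
      unfolding w_def using z(2) nN(2) mC xj xk x y
      by (simp add: A.smult_r_distr A.smult_r_minus A.smult_pow_add a_minus_def A.M.a_ac)
    then have "(x [^]\<^bsub>R\<^esub> j) \<odot>\<^bsub>A\<^esub> w \<in> plus_mult R A U y N"
      using A.plus_multI[OF U A.submoduleE(4)[OF N xk nN(1)] NM y, of "(x [^]\<^bsub>R\<^esub> j) \<odot>\<^bsub>A\<^esub> w"] m(2) xj NC[OF wN]
      by simp
    then have "w \<in> plus_mult R A U y N"
    proof (induct j)
      case 0
      then show ?case using NC[OF wN] by simp
    next
      case (Suc j)
      then show ?case
        using reg[OF A.submoduleE(4)[OF N x_pow wN, of j]] A.smult_pow_Suc[OF x NC[OF wN]] by simp
    qed
    then show "z \<in> plus_mult R A (plus_mult R A U y N) (x [^]\<^bsub>R\<^esub> k) N"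
      using A.plus_multI[OF UyN m(1) NM xk z(2)] by (simp add: w_def)
  qed
qed

end

text \<open>Induction on \<open>ys\<close>, dividing by its first element y. Exchanging x and y
  shows that x followed by the rest is regular on H/yH, so the hypothesis recurs; y is regular on
  H_x/H because it is regular on every H/x^j H.\<close>

theorem regular_Goldie_localization:
  assumes "localization_quotient R A B x N U N' U' D" "set ys \<subseteq> carrier R"
    and "regular_Goldie R A N (x # ys) U"
  shows "regular_Goldie R B N' ys U'"
  using assms
proof (induct ys arbitrary: U U')
  case Nil
  then show ?case using localization_quotient.finite_Goldie_pair_localization by fastforce
next
  case (Cons y ys)
  interpret localization_quotient R A B x N U N' U' D by (rule Cons.prems(1))
  have y: "y \<in> carrier R" and ys: "set ys \<subseteq> carrier R" using Cons.prems(2) by auto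
  have reg_x: "n \<in> U" if "n \<in> N" "x \<odot>\<^bsub>A\<^esub> n \<in> U" for n using Cons.prems(3) that by simp
  have reg_y: "n \<in> plus_mult R A U x N" if "n \<in> N" "y \<odot>\<^bsub>A\<^esub> n \<in> plus_mult R A U x N" for n
    using Cons.prems(3) that by simp
  have reg: "n \<in> plus_mult R A U y N" if "n \<in> N" "x \<odot>\<^bsub>A\<^esub> n \<in> plus_mult R A U y N" for n
    using A.regular_on_quotient_commute[OF U N x y reg_x reg_y that] .
  then have "regular_Goldie R A N (x # ys) (plus_mult R A U y N)"
    using Cons.prems(3) A.plus_mult_commute[OF U N x y] by simp
  then have "regular_Goldie R B N' ys (plus_mult R B U' y N')"
    using Cons.hyps[OF localization_quotient_plus_mult[OF y reg] ys] by blast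
  moreover have "n' \<in> U'" if n': "n' \<in> N'" "y \<odot>\<^bsub>B\<^esub> n' \<in> U'" for n'
  proof -
    obtain j n where n: "D j n n'" using covering[OF n'(1)] by blast
    have "y \<odot>\<^bsub>A\<^esub> n \<in> plus_mult R A U (x [^]\<^bsub>R\<^esub> j) N" using mem_iff[OF D_smult[OF y n]] n'(2) by blast
    then have "n \<in> plus_mult R A U (x [^]\<^bsub>R\<^esub> j) N"
      using A.regular_on_power_quotient[OF U N x y reg_x reg_y] domain[OF n] by blast
    then show ?thesis using mem_iff[OF n] by blast
  qed
  ultimately show ?case by simp
qed

section \<open>Torsion subcomplexes\<close>

lemma (in module) power_torsion_cancel:
  assumes "submodule J R M" "x \<in> carrier R" "z \<in> J" "(x [^] (k::nat)) \<odot>\<^bsub>M\<^esub> z \<in> power_torsion R M x J"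
  shows "z \<in> power_torsion R M x J"
proof -
  obtain l :: nat where "(x [^] l) \<odot>\<^bsub>M\<^esub> ((x [^] k) \<odot>\<^bsub>M\<^esub> z) = \<zero>\<^bsub>M\<^esub>"
    using assms(4) by (auto simp: power_torsion_def)
  then have "(x [^] (l + k)) \<odot>\<^bsub>M\<^esub> z = \<zero>\<^bsub>M\<^esub>"
    using smult_pow_add[OF assms(2)] submodule_carrier[OF assms(1,3)] by simp
  then show ?thesis using assms(3) by (auto simp: power_torsion_def)
qed

text \<open>One ambient complex whose differentials never change. Subcomplexes are families
  \<open>J\<close> of subsets of its terms, and the notions below take \<open>J\<close> as an
  argument.\<close>

locale module_complex =
  fixes R :: "('a, 'r) ring_scheme" and I :: "nat \<Rightarrow> ('a, 'e, 'y) module_scheme" and d :: "nat \<Rightarrow> 'e \<Rightarrow> 'e"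
  assumes noetherian: "noetherian_ring R"
    and module_I: "module R (I n)"
    and hom_d: "d n \<in> module_hom R (I n) (I (Suc n))"
    and d_d: "z \<in> carrier (I n) \<Longrightarrow> d (Suc n) (d n z) = \<zero>\<^bsub>I (Suc (Suc n))\<^esub>"
begin

sublocale M: module R "I n" for n by (rule module_I)

definition cycles :: "(nat \<Rightarrow> 'e set) \<Rightarrow> nat \<Rightarrow> 'e set"
  where "cycles J n = {z \<in> J n. d n z = \<zero>\<^bsub>I (Suc n)\<^esub>}"

definition boundaries :: "(nat \<Rightarrow> 'e set) \<Rightarrow> nat \<Rightarrow> 'e set"
  where "boundaries J n = (case n of 0 \<Rightarrow> {\<zero>\<^bsub>I 0\<^esub>} | Suc m \<Rightarrow> d m ` J m)"

definition exact_at :: "(nat \<Rightarrow> 'e set) \<Rightarrow> nat \<Rightarrow> bool"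
  where "exact_at J n \<longleftrightarrow> cycles J n \<subseteq> boundaries J n"

definition torsion_complex :: "'a \<Rightarrow> (nat \<Rightarrow> 'e set) \<Rightarrow> nat \<Rightarrow> 'e set"
  where "torsion_complex x J n = power_torsion R (I n) x (J n)"

definition baer_complex :: "(nat \<Rightarrow> 'e set) \<Rightarrow> bool"
  where "baer_complex J \<longleftrightarrow> (\<forall>n. baer R (I n) (J n) \<and> d n ` J n \<subseteq> J (Suc n))"

lemma boundaries_0: "boundaries J 0 = {\<zero>\<^bsub>I 0\<^esub>}" by (simp add: boundaries_def)

lemma boundaries_Suc: "boundaries J (Suc n) = d n ` J n" by (simp add: boundaries_def)

lemma d_closed: "z \<in> carrier (I n) \<Longrightarrow> d n z \<in> carrier (I (Suc n))"
  using hom_d[of n] unfolding module_hom_def by blast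

lemma d_add: "z \<in> carrier (I n) \<Longrightarrow> w \<in> carrier (I n) \<Longrightarrow> d n (z \<oplus>\<^bsub>I n\<^esub> w) = d n z \<oplus>\<^bsub>I (Suc n)\<^esub> d n w"
  using hom_d by (auto simp: module_hom_def)

lemma d_smult: "r \<in> carrier R \<Longrightarrow> z \<in> carrier (I n) \<Longrightarrow> d n (r \<odot>\<^bsub>I n\<^esub> z) = r \<odot>\<^bsub>I (Suc n)\<^esub> d n z"
  using hom_d by (auto simp: module_hom_def)

lemma d_zero: "d n \<zero>\<^bsub>I n\<^esub> = \<zero>\<^bsub>I (Suc n)\<^esub>"
  using d_smult[of "\<zero>\<^bsub>R\<^esub>" "\<zero>\<^bsub>I n\<^esub>" n] M.R.zero_closed d_closed[of "\<zero>\<^bsub>I n\<^esub>" n] by simp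

lemma d_minus:
  assumes "z \<in> carrier (I n)" "w \<in> carrier (I n)"
  shows "d n (z \<ominus>\<^bsub>I n\<^esub> w) = d n z \<ominus>\<^bsub>I (Suc n)\<^esub> d n w"
proof -
  have "d n (\<ominus>\<^bsub>I n\<^esub> w) = \<ominus>\<^bsub>I (Suc n)\<^esub> d n w"
    using d_smult[of "\<ominus>\<^bsub>R\<^esub> \<one>\<^bsub>R\<^esub>" w n] assms d_closed by (simp add: M.smult_l_minus)
  then show ?thesis using assms by (simp add: a_minus_def d_add)
qed

lemma baer_complexD:
  assumes "baer_complex J"
  shows "baer R (I n) (J n)" "submodule (J n) R (I n)" "z \<in> J n \<Longrightarrow> d n z \<in> J (Suc n)"
    "z \<in> J n \<Longrightarrow> z \<in> carrier (I n)"
proof -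
  show "baer R (I n) (J n)" "z \<in> J n \<Longrightarrow> d n z \<in> J (Suc n)" using assms by (auto simp: baer_complex_def)
  then show s: "submodule (J n) R (I n)" by (simp add: baer_def)
  show "z \<in> J n \<Longrightarrow> z \<in> carrier (I n)" using M.submodule_carrier[OF s] .
qed

lemma submodule_cycles:
  assumes "baer_complex J"
  shows "submodule (cycles J n) R (I n)"
proof (rule M.submoduleI)
  note sub = baer_complexD(2)[OF assms] and C = baer_complexD(4)[OF assms]
  show "cycles J n \<subseteq> carrier (I n)" using C by (auto simp: cycles_def)
  show "\<zero>\<^bsub>I n\<^esub> \<in> cycles J n" using M.submodule_zero[OF sub] d_zero by (simp add: cycles_def)
  show "a \<oplus>\<^bsub>I n\<^esub> b \<in> cycles J n" if "a \<in> cycles J n" "b \<in> cycles J n" for a b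
    using that C M.submoduleE(5)[OF sub] by (simp add: cycles_def d_add)
  show smul: "r \<odot>\<^bsub>I n\<^esub> a \<in> cycles J n" if "r \<in> carrier R" "a \<in> cycles J n" for a r
    using that C M.submoduleE(4)[OF sub] by (simp add: cycles_def d_smult)
  show "\<ominus>\<^bsub>I n\<^esub> a \<in> cycles J n" if "a \<in> cycles J n" for a
    using smul[OF _ that, of "\<ominus>\<^bsub>R\<^esub> \<one>\<^bsub>R\<^esub>"] that C by (simp add: cycles_def M.smult_l_minus)
qed

lemma submodule_boundaries:
  assumes "baer_complex J"
  shows "submodule (boundaries J n) R (I n)"
proof (cases n)
  case 0
  then show ?thesis by (auto simp: boundaries_0 M.minus_zero_eq intro!: M.submoduleI)
next
  case (Suc m)
  note sub = baer_complexD(2)[OF assms] and C = baer_complexD(4)[OF assms]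
  have "submodule (d m ` J m) R (I (Suc m))"
  proof (rule M.submoduleI)
    show "d m ` J m \<subseteq> carrier (I (Suc m))" using C d_closed by auto
    show "\<zero>\<^bsub>I (Suc m)\<^esub> \<in> d m ` J m" using M.submodule_zero[OF sub] d_zero by (metis image_eqI)
    show "a \<oplus>\<^bsub>I (Suc m)\<^esub> b \<in> d m ` J m" if ab: "a \<in> d m ` J m" "b \<in> d m ` J m" for a b
    proof -
      obtain v w where "a = d m v" "v \<in> J m" "b = d m w" "w \<in> J m" using ab by blast
      then show ?thesis using d_add[of v m w] C M.submoduleE(5)[OF sub, of v m w] by (metis image_eqI)
    qed
    show smul: "r \<odot>\<^bsub>I (Suc m)\<^esub> a \<in> d m ` J m" if r: "r \<in> carrier R" "a \<in> d m ` J m" for a r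
    proof -
      obtain v where "a = d m v" "v \<in> J m" using r by blast
      then show ?thesis using d_smult[of r v m] C M.submoduleE(4)[OF sub r(1), of v m] r(1) by (metis image_eqI)
    qed
    show "\<ominus>\<^bsub>I (Suc m)\<^esub> a \<in> d m ` J m" if a: "a \<in> d m ` J m" for a
    proof -
      have "a \<in> carrier (I (Suc m))" using a C d_closed by auto
      then show ?thesis using smul[OF _ a, of "\<ominus>\<^bsub>R\<^esub> \<one>\<^bsub>R\<^esub>"] by (simp add: M.smult_l_minus)
    qed
  qed
  then show ?thesis using Suc by (simp add: boundaries_Suc)
qed

lemma boundaries_subset_cycles:
  assumes "baer_complex J"
  shows "boundaries J n \<subseteq> cycles J n"
proof (cases n)
  case 0
  then show ?thesis using M.submodule_zero[OF submodule_cycles[OF assms]] by (simp add: boundaries_0)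
next
  case (Suc m)
  then show ?thesis using baer_complexD(3,4)[OF assms] d_d by (auto simp: boundaries_Suc cycles_def)
qed

lemma torsion_complex_subset: "torsion_complex x J n \<subseteq> J n"
  by (auto simp: torsion_complex_def power_torsion_def)

lemma torsion_complexE:
  assumes "z \<in> torsion_complex x J n"
  obtains k :: nat where "(x [^]\<^bsub>R\<^esub> k) \<odot>\<^bsub>I n\<^esub> z = \<zero>\<^bsub>I n\<^esub>" "z \<in> J n"
  using assms by (auto simp: torsion_complex_def power_torsion_def)

lemma d_torsion_complex:
  assumes "baer_complex J" "x \<in> carrier R" "z \<in> torsion_complex x J n"
  shows "d n z \<in> torsion_complex x J (Suc n)"
proof -
  obtain k :: nat where k: "(x [^]\<^bsub>R\<^esub> k) \<odot>\<^bsub>I n\<^esub> z = \<zero>\<^bsub>I n\<^esub>" "z \<in> J n" using torsion_complexE assms(3) by blast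
  then have "(x [^]\<^bsub>R\<^esub> k) \<odot>\<^bsub>I (Suc n)\<^esub> d n z = \<zero>\<^bsub>I (Suc n)\<^esub>"
    using d_smult[of "x [^]\<^bsub>R\<^esub> k" z n] assms(2) baer_complexD(4)[OF assms(1) k(2)] d_zero by simp
  then show ?thesis using baer_complexD(3)[OF assms(1) k(2)] by (auto simp: torsion_complex_def power_torsion_def)
qed

lemma baer_torsion_complex:
  assumes "baer_complex J" "x \<in> carrier R"
  shows "baer_complex (torsion_complex x J)"
  unfolding baer_complex_def
  using M.baer_power_torsion[OF noetherian baer_complexD(1)[OF assms(1)] assms(2)] d_torsion_complex[OF assms]
  by (auto simp: torsion_complex_def)

text \<open>For u = dw, \<open>baer_divisible\<close> in the degree below solves x^(m+k) v = x^m w;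
  applying d, the common factor x^m turns the equation into a congruence modulo x-torsion. In degree
  0 the only boundary is zero.\<close>

lemma boundary_divisible:
  assumes J: "baer_complex J" and x: "x \<in> carrier R" and u: "u \<in> boundaries J n"
  obtains v where "v \<in> boundaries J n" "(x [^]\<^bsub>R\<^esub> (k::nat)) \<odot>\<^bsub>I n\<^esub> v \<ominus>\<^bsub>I n\<^esub> u \<in> torsion_complex x J n"
proof (cases n)
  case 0
  have "\<zero>\<^bsub>I 0\<^esub> \<in> torsion_complex x J 0"
    using M.submodule_zero[OF baer_complexD(2)[OF baer_torsion_complex[OF J x]]] .
  then show ?thesis using that[of u] u x 0 by (simp add: boundaries_0 a_minus_def M.M.r_neg)
next
  case (Suc l)
  then obtain w where w: "u = d l w" "w \<in> J l" using u by (auto simp: boundaries_Suc)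
  obtain v m where v: "v \<in> J l" "(x [^]\<^bsub>R\<^esub> (m + k)) \<odot>\<^bsub>I l\<^esub> v = (x [^]\<^bsub>R\<^esub> m) \<odot>\<^bsub>I l\<^esub> w"
    using M.baer_divisible[OF noetherian baer_complexD(1)[OF J] x w(2)] by blast
  note C = baer_complexD(4)[OF J]
  have "(x [^]\<^bsub>R\<^esub> m) \<odot>\<^bsub>I n\<^esub> ((x [^]\<^bsub>R\<^esub> k) \<odot>\<^bsub>I n\<^esub> d l v \<ominus>\<^bsub>I n\<^esub> u)
    = (x [^]\<^bsub>R\<^esub> (m + k)) \<odot>\<^bsub>I n\<^esub> d l v \<ominus>\<^bsub>I n\<^esub> (x [^]\<^bsub>R\<^esub> m) \<odot>\<^bsub>I n\<^esub> u"
    using x v(1) w C d_closed Suc by (simp add: M.smult_minus_distr M.smult_pow_add)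
  also have "(x [^]\<^bsub>R\<^esub> (m + k)) \<odot>\<^bsub>I n\<^esub> d l v = (x [^]\<^bsub>R\<^esub> m) \<odot>\<^bsub>I n\<^esub> u"
    using d_smult[of "x [^]\<^bsub>R\<^esub> (m + k)" v l] d_smult[of "x [^]\<^bsub>R\<^esub> m" w l] v w x C Suc by simp
  also have "(x [^]\<^bsub>R\<^esub> m) \<odot>\<^bsub>I n\<^esub> u \<ominus>\<^bsub>I n\<^esub> (x [^]\<^bsub>R\<^esub> m) \<odot>\<^bsub>I n\<^esub> u = \<zero>\<^bsub>I n\<^esub>"
    using w x C d_closed Suc by (simp add: a_minus_def M.M.r_neg)
  finally have z: "(x [^]\<^bsub>R\<^esub> m) \<odot>\<^bsub>I n\<^esub> ((x [^]\<^bsub>R\<^esub> k) \<odot>\<^bsub>I n\<^esub> d l v \<ominus>\<^bsub>I n\<^esub> u) = \<zero>\<^bsub>I n\<^esub>" .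
  have "d l v \<in> J n" "u \<in> J n" using baer_complexD(3)[OF J] v(1) w Suc by simp_all
  then have "(x [^]\<^bsub>R\<^esub> k) \<odot>\<^bsub>I n\<^esub> d l v \<ominus>\<^bsub>I n\<^esub> u \<in> J n"
    using M.submodule_minus[OF baer_complexD(2)[OF J]] M.submoduleE(4)[OF baer_complexD(2)[OF J]] x by simp
  then have "(x [^]\<^bsub>R\<^esub> k) \<odot>\<^bsub>I n\<^esub> d l v \<ominus>\<^bsub>I n\<^esub> u \<in> torsion_complex x J n"
    unfolding torsion_complex_def power_torsion_def using z by blast
  moreover have "d l v \<in> boundaries J n" using v(1) Suc by (simp add: boundaries_Suc)
  ultimately show ?thesis using that by blast
qed

text \<open>Exactness one degree lower makes the cohomology of Gamma_x(J) embed into that of J. If z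
  = dw is killed by x^k, then x^k w is a cycle, hence a boundary; divided by x^k up to torsion it
  becomes a boundary v such that w - v is torsion, and d(w - v) = z.\<close>

lemma torsion_boundary:
  assumes J: "baer_complex J" and x: "x \<in> carrier R" and ex: "\<And>m. n = Suc m \<Longrightarrow> exact_at J m"
    and z: "z \<in> boundaries J n" "z \<in> torsion_complex x J n"
  shows "z \<in> boundaries (torsion_complex x J) n"
proof (cases n)
  case 0
  then show ?thesis using z by (simp add: boundaries_0)
next
  case (Suc m)
  note C = baer_complexD(4)[OF J] and sub = baer_complexD(2)[OF J]
  have T: "submodule (torsion_complex x J i) R (I i)" for i using baer_complexD(2)[OF baer_torsion_complex[OF J x]] .
  obtain w where w: "z = d m w" "w \<in> J m" using z(1) Suc by (auto simp: boundaries_Suc)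
  obtain k :: nat where k: "(x [^]\<^bsub>R\<^esub> k) \<odot>\<^bsub>I n\<^esub> z = \<zero>\<^bsub>I n\<^esub>" using torsion_complexE z(2) by blast
  have xk: "x [^]\<^bsub>R\<^esub> k \<in> carrier R" using x by simp
  have "(x [^]\<^bsub>R\<^esub> k) \<odot>\<^bsub>I m\<^esub> w \<in> cycles J m"
    using d_smult[OF xk C[OF w(2)]] k w Suc M.submoduleE(4)[OF sub xk w(2)] by (simp add: cycles_def)
  then have "(x [^]\<^bsub>R\<^esub> k) \<odot>\<^bsub>I m\<^esub> w \<in> boundaries J m" using ex[OF Suc] by (auto simp: exact_at_def)
  then obtain v where v: "v \<in> boundaries J m"
    "(x [^]\<^bsub>R\<^esub> k) \<odot>\<^bsub>I m\<^esub> v \<ominus>\<^bsub>I m\<^esub> (x [^]\<^bsub>R\<^esub> k) \<odot>\<^bsub>I m\<^esub> w \<in> torsion_complex x J m"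
    using boundary_divisible[OF J x] by blast
  have vc: "v \<in> J m" "d m v = \<zero>\<^bsub>I (Suc m)\<^esub>" using boundaries_subset_cycles[OF J] v(1) by (auto simp: cycles_def)
  have "(x [^]\<^bsub>R\<^esub> k) \<odot>\<^bsub>I m\<^esub> (w \<ominus>\<^bsub>I m\<^esub> v) \<in> torsion_complex x J m"
    using M.submodule_minus_commute[OF T _ _ v(2)] M.smult_minus_distr[OF xk C[OF w(2)] C[OF vc(1)]]
      C[OF w(2)] C[OF vc(1)] xk by simp
  then have "w \<ominus>\<^bsub>I m\<^esub> v \<in> torsion_complex x J m"
    using M.power_torsion_cancel[OF sub x M.submodule_minus[OF sub w(2) vc(1)]] by (simp add: torsion_complex_def)
  moreover have "d m (w \<ominus>\<^bsub>I m\<^esub> v) = z"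
    using d_minus[OF C[OF w(2)] C[OF vc(1)]] vc(2) w d_closed[OF C[OF w(2)]]
    by (simp add: a_minus_def M.minus_zero_eq)
  ultimately show ?thesis using Suc by (auto simp: boundaries_Suc)
qed

lemma exact_at_torsion_complex:
  assumes "baer_complex J" "x \<in> carrier R" "\<And>m. n = Suc m \<Longrightarrow> exact_at J m"
    and "cycles (torsion_complex x J) n \<subseteq> boundaries J n"
  shows "exact_at (torsion_complex x J) n"
  unfolding exact_at_def
  using torsion_boundary[OF assms(1,2)] assms(3,4) by (auto simp: cycles_def)

lemma cycles_torsion_complex_subset: "cycles (torsion_complex x J) n \<subseteq> cycles J n"
  using torsion_complex_subset by (auto simp: cycles_def)

lemma boundaries_torsion_complex_subset: "boundaries (torsion_complex x J) n \<subseteq> boundaries J n"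
  by (cases n) (simp_all add: boundaries_0 boundaries_Suc image_mono torsion_complex_subset)

text \<open>Some x^k z is zero, hence a boundary; regularity of x on the cohomology removes the
  factors x one at a time.\<close>

lemma regular_torsion_mem:
  assumes J: "baer_complex J" and x: "x \<in> carrier R"
    and reg: "\<And>n. n \<in> cycles J p \<Longrightarrow> x \<odot>\<^bsub>I p\<^esub> n \<in> boundaries J p \<Longrightarrow> n \<in> boundaries J p"
    and z: "z \<in> cycles J p" "z \<in> torsion_complex x J p"
  shows "z \<in> boundaries J p"
proof -
  obtain k :: nat where k: "(x [^]\<^bsub>R\<^esub> k) \<odot>\<^bsub>I p\<^esub> z = \<zero>\<^bsub>I p\<^esub>" using torsion_complexE z(2) by blast
  have zC: "z \<in> carrier (I p)" using z(1) M.submodule_carrier[OF submodule_cycles[OF J]] by blast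
  have "(x [^]\<^bsub>R\<^esub> k) \<odot>\<^bsub>I p\<^esub> z \<in> boundaries J p" using k M.submodule_zero[OF submodule_boundaries[OF J]] by simp
  then show ?thesis
  proof (induct k)
    case 0
    then show ?case using zC by simp
  next
    case (Suc k)
    have "(x [^]\<^bsub>R\<^esub> k) \<odot>\<^bsub>I p\<^esub> z \<in> cycles J p" using M.submoduleE(4)[OF submodule_cycles[OF J] _ z(1)] x by simp
    then show ?case using Suc reg M.smult_pow_Suc[OF x zC] by simp
  qed
qed

text \<open>In the long exact sequence of 0 -> Gamma_x(J) -> J -> J_x -> 0 with H = H^p(J) as the
  only cohomology of J, the connecting map induces an isomorphism of H_x/H with
  H^(p+1)(Gamma_x(J)).\<close>

lemma localization_quotient_cohomology:
  assumes J: "baer_complex J" and x: "x \<in> carrier R" and ex: "\<And>n. n \<noteq> p \<Longrightarrow> exact_at J n"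
    and reg: "\<And>n. n \<in> cycles J p \<Longrightarrow> x \<odot>\<^bsub>I p\<^esub> n \<in> boundaries J p \<Longrightarrow> n \<in> boundaries J p"
  shows "\<exists>D. localization_quotient R (I p) (I (Suc p)) x (cycles J p) (boundaries J p)
    (cycles (torsion_complex x J) (Suc p)) (boundaries (torsion_complex x J) (Suc p)) D"
proof
  let ?T = "torsion_complex x J"
  \<comment> \<open>Congruence modulo x-torsion is equality in J_x: v is a preimage of z/x^k there,
    and dv is the value of the connecting map.\<close>
  let ?D = "\<lambda>(k::nat) z z'. z \<in> cycles J p \<and> z' \<in> cycles ?T (Suc p) \<and>
    (\<exists>v\<in>J p. d p v = z' \<and> (x [^]\<^bsub>R\<^esub> k) \<odot>\<^bsub>I p\<^esub> v \<ominus>\<^bsub>I p\<^esub> z \<in> ?T p)"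
  note C = baer_complexD(4)[OF J] and sub = baer_complexD(2)[OF J]
  note BT = baer_torsion_complex[OF J x]
  have T: "submodule (?T i) R (I i)" for i using baer_complexD(2)[OF BT] .
  have TC: "z \<in> carrier (I i)" if "z \<in> ?T i" for z i using baer_complexD(4)[OF BT that] .
  have Z: "submodule (cycles J p) R (I p)" and B: "submodule (boundaries J p) R (I p)"
    and Z': "submodule (cycles ?T (Suc p)) R (I (Suc p))" and B': "submodule (boundaries ?T (Suc p)) R (I (Suc p))"
    using submodule_cycles submodule_boundaries J BT by blast+
  have ZC: "z \<in> carrier (I p)" if "z \<in> cycles J p" for z using that M.submodule_carrier[OF Z] by blast
  have ZJ: "z \<in> J p" and Zd: "d p z = \<zero>\<^bsub>I (Suc p)\<^esub>" if "z \<in> cycles J p" for z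
    using that by (auto simp: cycles_def)
  have BZ: "z \<in> cycles J p" if "z \<in> boundaries J p" for z using that boundaries_subset_cycles[OF J] by blast
  have [simp]: "x [^]\<^bsub>R\<^esub> k \<in> carrier R" for k :: nat using x by simp
  show "localization_quotient R (I p) (I (Suc p)) x (cycles J p) (boundaries J p)
    (cycles ?T (Suc p)) (boundaries ?T (Suc p)) ?D"
  proof (intro localization_quotient.intro localization_quotient_axioms.intro)
    show "module R (I p)" "module R (I (Suc p))" by (rule module_I)+
    show "x \<in> carrier R" by (rule x)
    show "submodule (cycles J p) R (I p)" "submodule (boundaries J p) R (I p)"
      "submodule (cycles ?T (Suc p)) R (I (Suc p))" "submodule (boundaries ?T (Suc p)) R (I (Suc p))"
      by (rule Z B Z' B')+
    show "linear_between R (I p) (I (Suc p)) (?D k)" for k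
      unfolding linear_between_def
    proof (intro conjI allI ballI impI)
      show "\<zero>\<^bsub>I p\<^esub> \<in> cycles J p" "\<zero>\<^bsub>I (Suc p)\<^esub> \<in> cycles ?T (Suc p)"
        using M.submodule_zero Z Z' by blast+
      show "\<exists>v\<in>J p. d p v = \<zero>\<^bsub>I (Suc p)\<^esub> \<and> (x [^]\<^bsub>R\<^esub> k) \<odot>\<^bsub>I p\<^esub> v \<ominus>\<^bsub>I p\<^esub> \<zero>\<^bsub>I p\<^esub> \<in> ?T p"
        using M.submodule_zero[OF sub] M.submodule_zero[OF T] d_zero
        by (intro bexI[of _ "\<zero>\<^bsub>I p\<^esub>"]) (simp_all add: a_minus_def M.minus_zero_eq)
    next
      fix z z' w w' assume D: "?D k z z'" "?D k w w'"
      show "z \<oplus>\<^bsub>I p\<^esub> w \<in> cycles J p" "z' \<oplus>\<^bsub>I (Suc p)\<^esub> w' \<in> cycles ?T (Suc p)"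
        using D M.submoduleE(5)[OF Z] M.submoduleE(5)[OF Z'] by blast+
      obtain v u where v: "v \<in> J p" "d p v = z'" "(x [^]\<^bsub>R\<^esub> k) \<odot>\<^bsub>I p\<^esub> v \<ominus>\<^bsub>I p\<^esub> z \<in> ?T p"
        and u: "u \<in> J p" "d p u = w'" "(x [^]\<^bsub>R\<^esub> k) \<odot>\<^bsub>I p\<^esub> u \<ominus>\<^bsub>I p\<^esub> w \<in> ?T p" using D by blast
      have "(x [^]\<^bsub>R\<^esub> k) \<odot>\<^bsub>I p\<^esub> (v \<oplus>\<^bsub>I p\<^esub> u) \<ominus>\<^bsub>I p\<^esub> (z \<oplus>\<^bsub>I p\<^esub> w) =
        ((x [^]\<^bsub>R\<^esub> k) \<odot>\<^bsub>I p\<^esub> v \<ominus>\<^bsub>I p\<^esub> z) \<oplus>\<^bsub>I p\<^esub> ((x [^]\<^bsub>R\<^esub> k) \<odot>\<^bsub>I p\<^esub> u \<ominus>\<^bsub>I p\<^esub> w)"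
        using C[OF v(1)] C[OF u(1)] D ZC by (simp add: a_minus_def M.smult_r_distr M.M.minus_add M.M.a_ac)
      then show "\<exists>v\<in>J p. d p v = z' \<oplus>\<^bsub>I (Suc p)\<^esub> w' \<and> (x [^]\<^bsub>R\<^esub> k) \<odot>\<^bsub>I p\<^esub> v \<ominus>\<^bsub>I p\<^esub> (z \<oplus>\<^bsub>I p\<^esub> w) \<in> ?T p"
        using M.submoduleE(5)[OF T v(3) u(3)] M.submoduleE(5)[OF sub v(1) u(1)] v u C
        by (intro bexI[of _ "v \<oplus>\<^bsub>I p\<^esub> u"]) (simp_all add: d_add)
    next
      fix r z z' assume r: "r \<in> carrier R" and D: "?D k z z'"
      show "r \<odot>\<^bsub>I p\<^esub> z \<in> cycles J p" "r \<odot>\<^bsub>I (Suc p)\<^esub> z' \<in> cycles ?T (Suc p)"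
        using D M.submoduleE(4)[OF Z r] M.submoduleE(4)[OF Z' r] by blast+
      obtain v where v: "v \<in> J p" "d p v = z'" "(x [^]\<^bsub>R\<^esub> k) \<odot>\<^bsub>I p\<^esub> v \<ominus>\<^bsub>I p\<^esub> z \<in> ?T p" using D by blast
      have "r \<odot>\<^bsub>I p\<^esub> ((x [^]\<^bsub>R\<^esub> k) \<odot>\<^bsub>I p\<^esub> v) \<ominus>\<^bsub>I p\<^esub> r \<odot>\<^bsub>I p\<^esub> z \<in> ?T p"
        using M.submodule_smult_minus[OF T r _ _ v(3)] C[OF v(1)] D ZC by simp
      then show "\<exists>v\<in>J p. d p v = r \<odot>\<^bsub>I (Suc p)\<^esub> z' \<and> (x [^]\<^bsub>R\<^esub> k) \<odot>\<^bsub>I p\<^esub> v \<ominus>\<^bsub>I p\<^esub> r \<odot>\<^bsub>I p\<^esub> z \<in> ?T p"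
        using M.submoduleE(4)[OF sub r v(1)] v C r M.smult_left_commute[of r "x [^]\<^bsub>R\<^esub> k" v p]
        by (intro bexI[of _ "r \<odot>\<^bsub>I p\<^esub> v"]) (simp_all add: d_smult)
    qed
    show "z \<in> cycles J p \<and> z' \<in> cycles ?T (Suc p)" if "?D k z z'" for k z z' using that by blast
    \<comment> \<open>\<open>baer_divisible\<close> supplies the preimage v of z/x^k; dv is torsion
      because x^(m+k) dv = x^m dz = 0.\<close>
    show "\<exists>z'. ?D k z z'" if z: "z \<in> cycles J p" for k z
    proof -
      obtain v m where v: "v \<in> J p" "(x [^]\<^bsub>R\<^esub> (m + k)) \<odot>\<^bsub>I p\<^esub> v = (x [^]\<^bsub>R\<^esub> m) \<odot>\<^bsub>I p\<^esub> z"
        using M.baer_divisible[OF noetherian baer_complexD(1)[OF J] x ZJ[OF z]] by blast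
      have vC: "v \<in> carrier (I p)" using C v(1) .
      have "(x [^]\<^bsub>R\<^esub> m) \<odot>\<^bsub>I p\<^esub> ((x [^]\<^bsub>R\<^esub> k) \<odot>\<^bsub>I p\<^esub> v \<ominus>\<^bsub>I p\<^esub> z) = \<zero>\<^bsub>I p\<^esub>"
        using v(2) vC x ZC[OF z] by (simp add: M.smult_minus_distr M.smult_pow_add) (simp add: a_minus_def M.M.r_neg)
      then have "(x [^]\<^bsub>R\<^esub> k) \<odot>\<^bsub>I p\<^esub> v \<ominus>\<^bsub>I p\<^esub> z \<in> ?T p"
        unfolding torsion_complex_def power_torsion_def
        using M.submodule_minus[OF sub M.submoduleE(4)[OF sub _ v(1)] ZJ[OF z]] by auto
      moreover have "(x [^]\<^bsub>R\<^esub> (m + k)) \<odot>\<^bsub>I (Suc p)\<^esub> d p v = \<zero>\<^bsub>I (Suc p)\<^esub>"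
        using d_smult[of "x [^]\<^bsub>R\<^esub> (m + k)" v p] d_smult[of "x [^]\<^bsub>R\<^esub> m" z p] v(2) vC ZC[OF z] Zd[OF z] by simp
      then have "d p v \<in> ?T (Suc p)"
        unfolding torsion_complex_def power_torsion_def using baer_complexD(3)[OF J v(1)] by blast
      then have "d p v \<in> cycles ?T (Suc p)" using d_d[OF vC] by (simp add: cycles_def)
      ultimately show ?thesis using v(1) z by blast
    qed
    \<comment> \<open>Exactness in degree p + 1 writes z' as dv, and the power of x that kills z'
      makes x^k v a cycle, which serves as numerator.\<close>
    show "\<exists>k z. ?D k z z'" if z': "z' \<in> cycles ?T (Suc p)" for z'
    proof -
      have "z' \<in> cycles J (Suc p)" using z' cycles_torsion_complex_subset by blast
      then have "z' \<in> boundaries J (Suc p)" using ex[of "Suc p"] by (auto simp: exact_at_def)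
      then obtain v where v: "v \<in> J p" "z' = d p v" by (auto simp: boundaries_Suc)
      have "z' \<in> ?T (Suc p)" using z' by (auto simp: cycles_def)
      then obtain k :: nat where k: "(x [^]\<^bsub>R\<^esub> k) \<odot>\<^bsub>I (Suc p)\<^esub> z' = \<zero>\<^bsub>I (Suc p)\<^esub>" using torsion_complexE by blast
      have "(x [^]\<^bsub>R\<^esub> k) \<odot>\<^bsub>I p\<^esub> v \<in> cycles J p"
        using k v C M.submoduleE(4)[OF sub _ v(1)] by (simp add: cycles_def d_smult)
      moreover have "(x [^]\<^bsub>R\<^esub> k) \<odot>\<^bsub>I p\<^esub> v \<ominus>\<^bsub>I p\<^esub> (x [^]\<^bsub>R\<^esub> k) \<odot>\<^bsub>I p\<^esub> v \<in> ?T p"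
        using C[OF v(1)] M.submodule_zero[OF T] by (simp add: a_minus_def M.M.r_neg)
      ultimately show ?thesis using v z' by blast
    qed
    show "?D (Suc k) (x \<odot>\<^bsub>I p\<^esub> z) z'" if D: "?D k z z'" for k z z'
    proof -
      obtain v where v: "v \<in> J p" "d p v = z'" "(x [^]\<^bsub>R\<^esub> k) \<odot>\<^bsub>I p\<^esub> v \<ominus>\<^bsub>I p\<^esub> z \<in> ?T p" using D by blast
      have "x \<odot>\<^bsub>I p\<^esub> ((x [^]\<^bsub>R\<^esub> k) \<odot>\<^bsub>I p\<^esub> v) \<ominus>\<^bsub>I p\<^esub> x \<odot>\<^bsub>I p\<^esub> z \<in> ?T p"
        using M.submodule_smult_minus[OF T x _ _ v(3)] C[OF v(1)] D ZC by simp
      then have "(x [^]\<^bsub>R\<^esub> Suc k) \<odot>\<^bsub>I p\<^esub> v \<ominus>\<^bsub>I p\<^esub> x \<odot>\<^bsub>I p\<^esub> z \<in> ?T p"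
        using M.smult_pow_Suc[OF x C[OF v(1)]] by simp
      then show ?thesis using v D M.submoduleE(4)[OF Z x] by blast
    qed
    fix k :: nat and z z' assume D: "?D k z z'"
    then obtain v where v: "v \<in> J p" "d p v = z'" "(x [^]\<^bsub>R\<^esub> k) \<odot>\<^bsub>I p\<^esub> v \<ominus>\<^bsub>I p\<^esub> z \<in> ?T p" by blast
    have zC: "z \<in> carrier (I p)" and vC: "v \<in> carrier (I p)" using D ZC C[OF v(1)] by blast+
    note ZM = M.submoduleE(1)[OF Z]
    show "z' \<in> boundaries ?T (Suc p) \<longleftrightarrow> z \<in> plus_mult R (I p) (boundaries J p) (x [^]\<^bsub>R\<^esub> k) (cycles J p)"
    proof
      assume "z' \<in> boundaries ?T (Suc p)"
      then obtain t where t: "t \<in> ?T p" "d p t = z'" by (auto simp: boundaries_Suc)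
      have tC: "t \<in> carrier (I p)" using TC t(1) .
      \<comment> \<open>Removing a torsion element with the same differential leaves a cycle n for
        which z - x^k n is torsion. This difference is a torsion cycle, hence a boundary by
        regularity.\<close>
      define n where "n = v \<ominus>\<^bsub>I p\<^esub> t"
      have nJ: "n \<in> J p" unfolding n_def
        using M.submodule_minus[OF sub v(1)] t(1) torsion_complex_subset by blast
      have "d p n = \<zero>\<^bsub>I (Suc p)\<^esub>" unfolding n_def using d_minus[OF vC tC] t(2) v(2) d_closed[OF vC]
        by (simp add: a_minus_def M.M.r_neg)
      then have nZ: "n \<in> cycles J p" using nJ by (simp add: cycles_def)
      have nC: "n \<in> carrier (I p)" using ZC nZ .
      have "(x [^]\<^bsub>R\<^esub> k) \<odot>\<^bsub>I p\<^esub> v \<ominus>\<^bsub>I p\<^esub> (x [^]\<^bsub>R\<^esub> k) \<odot>\<^bsub>I p\<^esub> n = (x [^]\<^bsub>R\<^esub> k) \<odot>\<^bsub>I p\<^esub> t"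
        unfolding n_def using vC tC
        by (simp add: a_minus_def M.smult_r_distr M.smult_r_minus M.M.minus_add M.M.minus_minus M.M.a_ac M.M.r_neg M.M.r_neg2)
      then have "(x [^]\<^bsub>R\<^esub> k) \<odot>\<^bsub>I p\<^esub> v \<ominus>\<^bsub>I p\<^esub> (x [^]\<^bsub>R\<^esub> k) \<odot>\<^bsub>I p\<^esub> n \<in> ?T p"
        using M.submoduleE(4)[OF T _ t(1)] by simp
      moreover have "z \<ominus>\<^bsub>I p\<^esub> (x [^]\<^bsub>R\<^esub> k) \<odot>\<^bsub>I p\<^esub> v \<in> ?T p"
        using M.submodule_minus_commute[OF T _ zC v(3)] vC by simp
      ultimately have "z \<ominus>\<^bsub>I p\<^esub> (x [^]\<^bsub>R\<^esub> k) \<odot>\<^bsub>I p\<^esub> n \<in> ?T p"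
        using M.submodule_minus_trans[OF T zC, of "(x [^]\<^bsub>R\<^esub> k) \<odot>\<^bsub>I p\<^esub> v"] vC nC by simp
      moreover have "z \<ominus>\<^bsub>I p\<^esub> (x [^]\<^bsub>R\<^esub> k) \<odot>\<^bsub>I p\<^esub> n \<in> cycles J p"
        using M.submodule_minus[OF Z _ M.submoduleE(4)[OF Z _ nZ]] D by simp
      ultimately have "z \<ominus>\<^bsub>I p\<^esub> (x [^]\<^bsub>R\<^esub> k) \<odot>\<^bsub>I p\<^esub> n \<in> boundaries J p"
        using regular_torsion_mem[OF J x reg] by blast
      then show "z \<in> plus_mult R (I p) (boundaries J p) (x [^]\<^bsub>R\<^esub> k) (cycles J p)"
        using M.plus_multI[OF B nZ ZM _ zC] by simp
    next
      assume "z \<in> plus_mult R (I p) (boundaries J p) (x [^]\<^bsub>R\<^esub> k) (cycles J p)"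
      then obtain n where n: "n \<in> cycles J p" "z \<ominus>\<^bsub>I p\<^esub> (x [^]\<^bsub>R\<^esub> k) \<odot>\<^bsub>I p\<^esub> n \<in> boundaries J p"
        using M.plus_multE[OF B ZM] by (metis \<open>\<And>k. x [^]\<^bsub>R\<^esub> k \<in> carrier R\<close>)
      \<comment> \<open>The boundary z - x^k n is itself divided by x^k up to torsion. Then v - n -
        u is torsion, and its differential is still z' because n and u are cycles.\<close>
      obtain u where u: "u \<in> boundaries J p"
        "(x [^]\<^bsub>R\<^esub> k) \<odot>\<^bsub>I p\<^esub> u \<ominus>\<^bsub>I p\<^esub> (z \<ominus>\<^bsub>I p\<^esub> (x [^]\<^bsub>R\<^esub> k) \<odot>\<^bsub>I p\<^esub> n) \<in> ?T p"
        using boundary_divisible[OF J x n(2)] by blast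
      have nC: "n \<in> carrier (I p)" and uC: "u \<in> carrier (I p)" using ZC n(1) BZ[OF u(1)] by blast+
      define w where "w = v \<ominus>\<^bsub>I p\<^esub> n \<ominus>\<^bsub>I p\<^esub> u"
      have wJ: "w \<in> J p" unfolding w_def
        using M.submodule_minus[OF sub M.submodule_minus[OF sub v(1) ZJ[OF n(1)]] ZJ[OF BZ[OF u(1)]]] .
      have "(x [^]\<^bsub>R\<^esub> k) \<odot>\<^bsub>I p\<^esub> w = ((x [^]\<^bsub>R\<^esub> k) \<odot>\<^bsub>I p\<^esub> v \<ominus>\<^bsub>I p\<^esub> z) \<ominus>\<^bsub>I p\<^esub>
        ((x [^]\<^bsub>R\<^esub> k) \<odot>\<^bsub>I p\<^esub> u \<ominus>\<^bsub>I p\<^esub> (z \<ominus>\<^bsub>I p\<^esub> (x [^]\<^bsub>R\<^esub> k) \<odot>\<^bsub>I p\<^esub> n))"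
        unfolding w_def using vC nC uC zC
        by (simp add: a_minus_def M.smult_r_distr M.smult_r_minus M.M.minus_add M.M.minus_minus M.M.a_ac M.M.r_neg1 M.M.r_neg2)
      then have "(x [^]\<^bsub>R\<^esub> k) \<odot>\<^bsub>I p\<^esub> w \<in> ?T p" using M.submodule_minus[OF T v(3) u(2)] by simp
      then have "w \<in> ?T p" using M.power_torsion_cancel[OF sub x wJ] by (simp add: torsion_complex_def)
      moreover have "d p w = z'"
        unfolding w_def using vC nC uC Zd[OF n(1)] Zd[OF BZ[OF u(1)]] v(2) d_closed[OF vC]
        by (simp add: d_minus) (simp add: a_minus_def M.minus_zero_eq)
      ultimately show "z' \<in> boundaries ?T (Suc p)" by (auto simp: boundaries_Suc)
    qed
  qed
qed

text \<open>Exactness in degree n needs exactness of \<open>J\<close> in degree n - 1, which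
  excludes n = p + 1. In degree p the torsion cycles are boundaries of \<open>J\<close> by
  regularity, and boundaries of the torsion subcomplex by exactness below.\<close>

lemma exact_torsion_complex_regular:
  assumes J: "baer_complex J" and x: "x \<in> carrier R" and ex: "\<And>n. n \<noteq> p \<Longrightarrow> exact_at J n"
    and reg: "\<And>n. n \<in> cycles J p \<Longrightarrow> x \<odot>\<^bsub>I p\<^esub> n \<in> boundaries J p \<Longrightarrow> n \<in> boundaries J p"
    and n: "n \<noteq> Suc p"
  shows "exact_at (torsion_complex x J) n"
proof (rule exact_at_torsion_complex[OF J x])
  show "exact_at J m" if "n = Suc m" for m using ex that n by simp
  show "cycles (torsion_complex x J) n \<subseteq> boundaries J n"
  proof (cases "n = p")
    case True
    have "z \<in> boundaries J p" if z: "z \<in> cycles (torsion_complex x J) p" for z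
    proof (rule regular_torsion_mem[OF J x reg])
      show "z \<in> cycles J p" using z cycles_torsion_complex_subset by blast
      show "z \<in> torsion_complex x J p" using z by (simp add: cycles_def)
    qed
    then show ?thesis using True by blast
  next
    case False
    then show ?thesis using ex cycles_torsion_complex_subset unfolding exact_at_def by blast
  qed
qed

lemma finite_Goldie_cohomology_regular:
  assumes "baer_complex J" "set xs \<subseteq> carrier R" "\<And>n. n \<noteq> p \<Longrightarrow> exact_at J n"
    and "regular_Goldie R (I p) (cycles J p) xs (boundaries J p)"
  shows "baer_complex (fold torsion_complex xs J)
    \<and> (\<forall>n. n \<noteq> p + length xs \<longrightarrow> exact_at (fold torsion_complex xs J) n)
    \<and> finite_Goldie_pair R (I (p + length xs)) (cycles (fold torsion_complex xs J) (p + length xs))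
        (boundaries (fold torsion_complex xs J) (p + length xs))"
  using assms
proof (induct xs arbitrary: J p)
  case Nil
  then show ?case by simp
next
  case (Cons x xs)
  have x: "x \<in> carrier R" and xs: "set xs \<subseteq> carrier R" using Cons.prems(2) by auto
  have reg: "n \<in> boundaries J p" if "n \<in> cycles J p" "x \<odot>\<^bsub>I p\<^esub> n \<in> boundaries J p" for n
    using Cons.prems(4) that by simp
  obtain D where D: "localization_quotient R (I p) (I (Suc p)) x (cycles J p) (boundaries J p)
    (cycles (torsion_complex x J) (Suc p)) (boundaries (torsion_complex x J) (Suc p)) D"
    using localization_quotient_cohomology[OF Cons.prems(1) x Cons.prems(3) reg] by blast
  have "regular_Goldie R (I (Suc p)) (cycles (torsion_complex x J) (Suc p)) xs (boundaries (torsion_complex x J) (Suc p))"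
    by (rule regular_Goldie_localization[OF D xs Cons.prems(4)])
  then show ?case
    using Cons.hyps[OF baer_torsion_complex[OF Cons.prems(1) x] xs, of "Suc p"]
      exact_torsion_complex_regular[OF Cons.prems(1) x Cons.prems(3) reg] by simp
qed

lemma finite_Goldie_cohomology_torsion:
  assumes "baer_complex J" "set ys \<subseteq> carrier R" "\<And>n. n < h \<Longrightarrow> exact_at J n"
    and "finite_Goldie_pair R (I h) (cycles J h) (boundaries J h)"
  shows "baer_complex (fold torsion_complex ys J) \<and>
    finite_Goldie_pair R (I h) (cycles (fold torsion_complex ys J) h) (boundaries (fold torsion_complex ys J) h)"
  using assms
proof (induct ys arbitrary: J)
  case Nil
  then show ?case by simp
next
  case (Cons y ys)
  let ?T = "torsion_complex y J"
  have y: "y \<in> carrier R" and ys: "set ys \<subseteq> carrier R" using Cons.prems(2) by auto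
  note J = Cons.prems(1)
  note T = baer_torsion_complex[OF J y]
  \<comment> \<open>Exactness below h has to persist, because the next torsion step uses it
    again.\<close>
  have ex: "exact_at ?T n" if "n < h" for n
    using exact_at_torsion_complex[OF J y] Cons.prems(3) that cycles_torsion_complex_subset[of y J n]
    unfolding exact_at_def by (metis Suc_lessD subset_trans)
  have B: "z \<in> boundaries ?T h" if "z \<in> cycles ?T h" "z \<in> boundaries J h" for z
    using torsion_boundary[OF J y _ that(2)] Cons.prems(3) that(1) by (auto simp: cycles_def)
  note sub = submodule_cycles[OF J, of h] submodule_boundaries[OF J, of h]
    submodule_cycles[OF T, of h] submodule_boundaries[OF T, of h]
  have "finite_Goldie_pair R (I h) (cycles ?T h) (boundaries ?T h)"
  \<comment> \<open>The inclusion of the torsion cycles, read as a relation. Its range is all of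
    them, so the essentiality condition holds with multiplier 1.\<close>
  proof (rule finite_Goldie_pair_transfer[OF module_I module_I sub, where D = "\<lambda>z z'. z = z' \<and> z \<in> cycles ?T h"])
    show "linear_between R (I h) (I h) (\<lambda>z z'. z = z' \<and> z \<in> cycles ?T h)"
      unfolding linear_between_def
      using M.submodule_zero[OF sub(3)] M.submoduleE(5)[OF sub(3)] M.submoduleE(4)[OF sub(3)] by auto
    show "z \<in> cycles J h \<and> z' \<in> cycles ?T h" if "z = z' \<and> z \<in> cycles ?T h" for z z'
      using that cycles_torsion_complex_subset by blast
    show "z \<in> boundaries J h \<longleftrightarrow> z' \<in> boundaries ?T h" if "z = z' \<and> z \<in> cycles ?T h" for z z'
      using that B boundaries_torsion_complex_subset by blast
    show "\<exists>r\<in>carrier R. \<exists>z y'. (z = y' \<and> z \<in> cycles ?T h) \<and> y' \<notin> boundaries ?T h \<and>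
        r \<odot>\<^bsub>I h\<^esub> z' \<ominus>\<^bsub>I h\<^esub> y' \<in> boundaries ?T h"
      if "z' \<in> cycles ?T h" "z' \<notin> boundaries ?T h" for z'
    proof (intro bexI exI conjI)
      show "\<one>\<^bsub>R\<^esub> \<odot>\<^bsub>I h\<^esub> z' \<ominus>\<^bsub>I h\<^esub> z' \<in> boundaries ?T h"
        using M.submodule_carrier[OF sub(3) that(1)] M.submodule_zero[OF sub(4)] by (simp add: a_minus_def M.M.r_neg)
    qed (use that M.R.one_closed in auto)
  qed (rule Cons.prems(4))
  then show ?case using Cons.hyps[OF T ys ex] by simp
qed

lemma fold_torsion_complex_mem:
  "z \<in> fold torsion_complex xs J n \<longleftrightarrow> z \<in> J n \<and> (\<forall>x\<in>set xs. \<exists>k::nat. (x [^]\<^bsub>R\<^esub> k) \<odot>\<^bsub>I n\<^esub> z = \<zero>\<^bsub>I n\<^esub>)"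
  by (induct xs arbitrary: J) (auto simp: torsion_complex_def power_torsion_def)

end

section \<open>Regular sequences\<close>

lemma (in module) hom_zero:
  assumes "module R B" "f \<in> module_hom R M B"
  shows "f \<zero>\<^bsub>M\<^esub> = \<zero>\<^bsub>B\<^esub>"
proof -
  interpret B: module R B by fact
  have "f (\<zero> \<odot>\<^bsub>M\<^esub> \<zero>\<^bsub>M\<^esub>) = \<zero> \<odot>\<^bsub>B\<^esub> f \<zero>\<^bsub>M\<^esub>" "f \<zero>\<^bsub>M\<^esub> \<in> carrier B"
    using assms(2) R.zero_closed M.zero_closed unfolding module_hom_def by blast+
  then show ?thesis by simp
qed

lemma (in module) image_plus_mult:
  assumes "f \<in> module_hom R M B" "U \<subseteq> carrier M" "N \<subseteq> carrier M" "a \<in> carrier R"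
  shows "plus_mult R B (f ` U) a (f ` N) = f ` plus_mult R M U a N"
proof -
  have eq: "f (u \<oplus>\<^bsub>M\<^esub> a \<odot>\<^bsub>M\<^esub> n) = f u \<oplus>\<^bsub>B\<^esub> a \<odot>\<^bsub>B\<^esub> f n" if "u \<in> U" "n \<in> N" for u n
  proof -
    have "u \<in> carrier M" "n \<in> carrier M" using that assms(2,3) by auto
    then show ?thesis using assms(1,4) by (simp add: module_hom_def)
  qed
  show ?thesis
  proof (intro subset_antisym subsetI)
    fix z assume "z \<in> plus_mult R B (f ` U) a (f ` N)"
    then obtain u n where "u \<in> U" "n \<in> N" "z = f u \<oplus>\<^bsub>B\<^esub> a \<odot>\<^bsub>B\<^esub> f n" by (auto simp: plus_mult_def)
    then have "z = f (u \<oplus>\<^bsub>M\<^esub> a \<odot>\<^bsub>M\<^esub> n)" "u \<oplus>\<^bsub>M\<^esub> a \<odot>\<^bsub>M\<^esub> n \<in> plus_mult R M U a N"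
      using eq by (auto simp: plus_mult_def)
    then show "z \<in> f ` plus_mult R M U a N" by blast
  next
    fix z assume "z \<in> f ` plus_mult R M U a N"
    then obtain u n where "u \<in> U" "n \<in> N" "z = f (u \<oplus>\<^bsub>M\<^esub> a \<odot>\<^bsub>M\<^esub> n)" by (auto simp: plus_mult_def)
    then show "z \<in> plus_mult R B (f ` U) a (f ` N)" using eq by (auto simp: plus_mult_def)
  qed
qed

lemma (in module) submodule_image:
  assumes "module R B" "f \<in> module_hom R M B" "submodule N R M"
  shows "submodule (f ` N) R B"
proof -
  interpret B: module R B by fact
  have NC: "z \<in> carrier M" if "z \<in> N" for z using that assms(3) submodule_carrier by blast
  have fC: "f z \<in> carrier B" if "z \<in> N" for z using NC[OF that] assms(2) by (auto simp: module_hom_def)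
  have smul: "r \<odot>\<^bsub>B\<^esub> z \<in> f ` N" if r: "r \<in> carrier R" "z \<in> f ` N" for r z
  proof -
    obtain w where w: "w \<in> N" "z = f w" using r by blast
    then have "r \<odot>\<^bsub>B\<^esub> z = f (r \<odot>\<^bsub>M\<^esub> w)" using assms(2) r(1) NC[OF w(1)] by (simp add: module_hom_def)
    then show ?thesis using submoduleE(4)[OF assms(3) r(1) w(1)] by blast
  qed
  show ?thesis
  proof (rule B.submoduleI)
    show "f ` N \<subseteq> carrier B" using fC by blast
    show "\<zero>\<^bsub>B\<^esub> \<in> f ` N"
      using smul[OF R.zero_closed imageI[OF submodule_zero[OF assms(3)]]] fC[OF submodule_zero[OF assms(3)]]
      by simp
    show "\<ominus>\<^bsub>B\<^esub> z \<in> f ` N" if z: "z \<in> f ` N" for z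
    proof -
      have "z \<in> carrier B" using z fC by blast
      then show ?thesis using smul[OF _ z, of "\<ominus> \<one>"] by (simp add: B.smult_l_minus)
    qed
    show "z \<oplus>\<^bsub>B\<^esub> w \<in> f ` N" if zw: "z \<in> f ` N" "w \<in> f ` N" for z w
    proof -
      obtain z0 w0 where zw0: "z0 \<in> N" "z = f z0" "w0 \<in> N" "w = f w0" using zw by blast
      then have "z \<oplus>\<^bsub>B\<^esub> w = f (z0 \<oplus>\<^bsub>M\<^esub> w0)" using assms(2) NC by (simp add: module_hom_def)
      then show ?thesis using submoduleE(5)[OF assms(3) zw0(1,3)] by blast
    qed
  qed (rule smul)
qed

text \<open>Carries the hypothesis from M to its copy e(M), the module of 0-cycles of the
  resolution.\<close>

lemma (in module) regular_Goldie_image: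
  assumes "module R B" "f \<in> module_hom R M B" "inj_on f (carrier M)"
    and "submodule N R M" "submodule U R M" "set xs \<subseteq> carrier R"
    and "regular_Goldie R M N xs U"
  shows "regular_Goldie R B (f ` N) xs (f ` U)"
  using assms(5-7)
proof (induct xs arbitrary: U)
  case Nil
  interpret B: module R B by fact
  note N = assms(4) and U = Nil(1)
  have C: "z \<in> carrier M" if "z \<in> N \<or> z \<in> U" for z using that N U submodule_carrier by blast
  have fmem: "f z \<in> f ` U \<longleftrightarrow> z \<in> U" if "z \<in> N" for z
    using inj_on_image_mem_iff[OF assms(3)] C that submoduleE(1)[OF U] by blast
  have fin: "finite_Goldie_pair R M N U" using Nil(3) by simp
  have "finite_Goldie_pair R B (f ` N) (f ` U)"
  proof (rule finite_Goldie_pair_transfer[OF module_axioms assms(1) N U submodule_image[OF assms(1,2) N]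
        submodule_image[OF assms(1,2) U] _ _ _ _ fin, where D = "\<lambda>z z'. z \<in> N \<and> z' = f z"])
    show "linear_between R M B (\<lambda>z z'. z \<in> N \<and> z' = f z)"
      using submodule_zero[OF N] submoduleE(4,5)[OF N] C assms(2) hom_zero[OF assms(1,2)]
      by (simp add: linear_between_def module_hom_def)
    show "z \<in> N \<and> z' \<in> f ` N" if "z \<in> N \<and> z' = f z" for z z' using that by blast
    show "z \<in> U \<longleftrightarrow> z' \<in> f ` U" if "z \<in> N \<and> z' = f z" for z z' using that fmem[of z] by auto
    show "\<exists>r\<in>carrier R. \<exists>z y. (z \<in> N \<and> y = f z) \<and> y \<notin> f ` U \<and> r \<odot>\<^bsub>B\<^esub> z' \<ominus>\<^bsub>B\<^esub> y \<in> f ` U"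
      if z': "z' \<in> f ` N" "z' \<notin> f ` U" for z'
    proof -
      have "\<one> \<odot>\<^bsub>B\<^esub> z' \<ominus>\<^bsub>B\<^esub> z' \<in> f ` U"
        using B.submodule_carrier[OF submodule_image[OF assms(1,2) N] z'(1)]
          B.submodule_zero[OF submodule_image[OF assms(1,2) U]] by (simp add: a_minus_def B.M.r_neg)
      moreover obtain w where "w \<in> N" "z' = f w" using z'(1) by auto
      ultimately show ?thesis
        using z'(2) R.one_closed by (intro bexI[of _ \<one>] exI[of _ w] exI[of _ z']) simp_all
    qed
  qed
  then show ?case by simp
next
  case (Cons a xs)
  have a: "a \<in> carrier R" and xs: "set xs \<subseteq> carrier R" using Cons.prems(2) by auto
  have NM: "N \<subseteq> carrier M" and UM: "U \<subseteq> carrier M" using submoduleE(1)[OF assms(4)] submoduleE(1)[OF Cons.prems(1)] by simp_all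
  have "n \<in> f ` U" if n: "n \<in> f ` N" "a \<odot>\<^bsub>B\<^esub> n \<in> f ` U" for n
  proof -
    obtain m where m: "m \<in> N" "n = f m" using n(1) by blast
    then have "a \<odot>\<^bsub>B\<^esub> n = f (a \<odot>\<^bsub>M\<^esub> m)" using assms(2) a NM by (auto simp: module_hom_def)
    then have "a \<odot>\<^bsub>M\<^esub> m \<in> U"
      using inj_on_image_mem_iff[OF assms(3) _ UM, of "a \<odot>\<^bsub>M\<^esub> m"] a m(1) NM n(2) by auto
    then show ?thesis using Cons.prems(3) m by simp
  qed
  moreover have "regular_Goldie R B (f ` N) xs (plus_mult R B (f ` U) a (f ` N))"
    using Cons.hyps[OF submodule_plus_mult[OF Cons.prems(1) assms(4) a] xs] Cons.prems(3)
      image_plus_mult[OF assms(2) UM NM a] by simp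
  ultimately show ?case by simp
qed

text \<open>Passes from the form of \<open>regular_sequence\<close>, where the i-th element acts
  modulo the prefix \<open>take i xs\<close>, to the recursive form; \<open>foldl\<close>
  accumulates the submodule to divide by.\<close>

lemma regular_GoldieI:
  assumes "\<And>i n. i < length xs \<Longrightarrow> n \<in> N \<Longrightarrow>
      xs ! i \<odot>\<^bsub>M\<^esub> n \<in> foldl (\<lambda>U a. plus_mult R M U a N) U (take i xs) \<Longrightarrow>
      n \<in> foldl (\<lambda>U a. plus_mult R M U a N) U (take i xs)"
    and "finite_Goldie_pair R M N (foldl (\<lambda>U a. plus_mult R M U a N) U xs)"
  shows "regular_Goldie R M N xs U"
  using assms
proof (induct xs arbitrary: U)
  case Nil
  then show ?case by simp
next
  case (Cons a xs)
  have "regular_Goldie R M N xs (plus_mult R M U a N)"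
    using Cons.prems(1)[of "Suc _"] Cons.prems(2) by (intro Cons.hyps) auto
  then show ?case using Cons.prems(1)[of 0] by simp
qed

context module
begin

lemma submodule_module_span: "S \<subseteq> carrier M \<Longrightarrow> submodule (module_span R M S) R M"
  and module_span_superset: "S \<subseteq> module_span R M S"
  and module_span_minimal: "submodule N R M \<Longrightarrow> S \<subseteq> N \<Longrightarrow> module_span R M S \<subseteq> N"
proof -
  show "S \<subseteq> module_span R M S" by (auto simp: module_span_def)
  show "module_span R M S \<subseteq> N" if "submodule N R M" "S \<subseteq> N" using that by (auto simp: module_span_def)
  assume S: "S \<subseteq> carrier M"
  show "submodule (module_span R M S) R M"
  proof (rule submoduleI)
    show "module_span R M S \<subseteq> carrier M"
      using S carrier_is_submodule by (auto simp: module_span_def)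
  qed (auto simp: module_span_def submodule_zero submoduleE(3,4,5))
qed

definition sequence_span :: "'a list \<Rightarrow> 'c set"
  where "sequence_span xs = module_span R M {r \<odot>\<^bsub>M\<^esub> x |r x. r \<in> set xs \<and> x \<in> carrier M}"

lemma submodule_sequence_span: "set xs \<subseteq> carrier R \<Longrightarrow> submodule (sequence_span xs) R M"
  unfolding sequence_span_def by (rule submodule_module_span) auto

lemma sequence_span_mem:
  "r \<in> set xs \<Longrightarrow> z \<in> carrier M \<Longrightarrow> r \<odot>\<^bsub>M\<^esub> z \<in> sequence_span xs"
  unfolding sequence_span_def by (rule subsetD[OF module_span_superset]) blast

lemma sequence_span_Nil: "sequence_span [] = {\<zero>\<^bsub>M\<^esub>}"
  unfolding sequence_span_def
  using module_span_minimal[OF submodule_zero_submodule, of "{}"]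
    submodule_zero[OF submodule_module_span[of "{}"]] by auto

lemma sequence_span_mono:
  assumes "set xs \<subseteq> set ys"
  shows "sequence_span xs \<subseteq> sequence_span ys"
  unfolding sequence_span_def module_span_def
proof (rule Inter_anti_mono, rule Collect_mono, rule impI, elim conjE)
  fix N assume "submodule N R M" "{r \<odot>\<^bsub>M\<^esub> x |r x. r \<in> set ys \<and> x \<in> carrier M} \<subseteq> N"
  then show "submodule N R M \<and> {r \<odot>\<^bsub>M\<^esub> x |r x. r \<in> set xs \<and> x \<in> carrier M} \<subseteq> N"
    using assms by auto
qed

lemma sequence_span_snoc:
  assumes "set xs \<subseteq> carrier R" "a \<in> carrier R"
  shows "sequence_span (xs @ [a]) = plus_mult R M (sequence_span xs) a (carrier M)"
proof
  note sub = submodule_sequence_span[OF assms(1)]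
  have P: "submodule (plus_mult R M (sequence_span xs) a (carrier M)) R M"
    using submodule_plus_mult[OF sub carrier_is_submodule assms(2)] .
  have "r \<odot>\<^bsub>M\<^esub> x \<in> plus_mult R M (sequence_span xs) a (carrier M)"
    if "r \<in> set (xs @ [a])" "x \<in> carrier M" for r x
  proof (cases "r = a")
    case True
    then show ?thesis using plus_mult_mult_mem[OF sub that(2) subset_refl assms(2)] by simp
  next
    case False
    then have "r \<odot>\<^bsub>M\<^esub> x \<in> sequence_span xs" using that sequence_span_mem by simp
    then show ?thesis using plus_mult_superset[OF sub carrier_is_submodule assms(2)] by blast
  qed
  then show "sequence_span (xs @ [a]) \<subseteq> plus_mult R M (sequence_span xs) a (carrier M)"
    unfolding sequence_span_def[of "xs @ [a]"] by (intro module_span_minimal[OF P]) blast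
  have sub': "submodule (sequence_span (xs @ [a])) R M" by (rule submodule_sequence_span) (use assms in auto)
  show "plus_mult R M (sequence_span xs) a (carrier M) \<subseteq> sequence_span (xs @ [a])"
    using submoduleE(5)[OF sub'] sequence_span_mono[of xs "xs @ [a]"] sequence_span_mem[of a "xs @ [a]"]
    by (auto simp: plus_mult_def subset_eq)
qed

lemma foldl_plus_mult_eq_sequence_span:
  "set xs \<subseteq> carrier R \<Longrightarrow> foldl (\<lambda>U a. plus_mult R M U a (carrier M)) {\<zero>\<^bsub>M\<^esub>} xs = sequence_span xs"
  by (induct xs rule: rev_induct) (simp_all add: sequence_span_Nil sequence_span_snoc)

lemma regular_sequence_iff:
  "regular_sequence R M xs \<longleftrightarrow> set xs \<subseteq> carrier R \<and>
    (\<forall>i<length xs. \<forall>n\<in>carrier M. xs ! i \<odot>\<^bsub>M\<^esub> n \<in> sequence_span (take i xs) \<longrightarrow> n \<in> sequence_span (take i xs)) \<and>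
    \<not> carrier M \<subseteq> sequence_span xs"
proof (cases "set xs \<subseteq> carrier R")
  case True
  have "submodule (sequence_span (take i xs)) R M" for i
    using submodule_sequence_span[OF subset_trans[OF set_take_subset True]] .
  moreover have "xs ! i \<in> carrier R" if "i < length xs" for i using True that nth_mem by blast
  ultimately show ?thesis
    using True submodule_sequence_span[OF True]
    by (simp add: regular_sequence_def quotient_by_sequence_def nonzerodivisor_on_quotient_module
        carrier_quotient_module_trivial_iff flip: sequence_span_def)
qed (simp add: regular_sequence_def)

lemma regular_sequence_imp_regular_Goldie:
  assumes "noetherian_ring R" "finitely_generated_module R M" "regular_sequence R M xs"
  shows "regular_Goldie R M (carrier M) xs {\<zero>\<^bsub>M\<^esub>}"
proof (rule regular_GoldieI)
  have xs: "set xs \<subseteq> carrier R" using assms(3) by (simp add: regular_sequence_def)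
  then have tk: "set (take i xs) \<subseteq> carrier R" for i using set_take_subset by fastforce
  show "finite_Goldie_pair R M (carrier M) (foldl (\<lambda>U a. plus_mult R M U a (carrier M)) {\<zero>\<^bsub>M\<^esub>} xs)"
    unfolding foldl_plus_mult_eq_sequence_span[OF xs]
    using finitely_generated_imp_finite_Goldie_pair[OF assms(1,2) submodule_sequence_span[OF xs]] .
  show "n \<in> foldl (\<lambda>U a. plus_mult R M U a (carrier M)) {\<zero>\<^bsub>M\<^esub>} (take i xs)"
    if "i < length xs" "n \<in> carrier M"
      "xs ! i \<odot>\<^bsub>M\<^esub> n \<in> foldl (\<lambda>U a. plus_mult R M U a (carrier M)) {\<zero>\<^bsub>M\<^esub>} (take i xs)" for i n
    using that assms(3) unfolding foldl_plus_mult_eq_sequence_span[OF tk] regular_sequence_iff by blast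
qed

text \<open>The ideal (T : S), used with S all of M to compare regular sequences and with S a single
  element to handle powers of \<open>\<aa>\<close>.\<close>

lemma ideal_transporter:
  assumes T: "submodule T R M" and S: "S \<subseteq> carrier M"
  shows "ideal {r \<in> carrier R. \<forall>z\<in>S. r \<odot>\<^bsub>M\<^esub> z \<in> T} R" (is "ideal ?A R")
proof (rule idealI)
  have C: "z \<in> carrier M" if "z \<in> S" for z using S that by blast
  show "ring R" by (rule R.ring_axioms)
  have "\<zero> \<in> ?A" using submodule_zero[OF T] C by simp
  then show "subgroup ?A (add_monoid R)"
    using submoduleE(3,5)[OF T] C
    by (intro R.add.subgroupI) (auto simp: smult_l_minus smult_l_distr)
  show "x \<otimes> a \<in> ?A" if "a \<in> ?A" "x \<in> carrier R" for a x
    using that submoduleE(4)[OF T] C by (simp add: smult_assoc1)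
  then show "a \<otimes> x \<in> ?A" if "a \<in> ?A" "x \<in> carrier R" for a x
    using that R.m_comm[of a x] by auto
qed

text \<open>Sequences are compared through the ideals ((xs)M : M). Appending y to a regular sequence
  so that it stays regular enlarges this ideal strictly: otherwise yM would lie in (xs)M, and y
  would not be a non-zero-divisor on the non-zero module M/(xs)M. So a sequence with a maximal such
  ideal cannot be extended.\<close>

lemma maximal_regular_sequence_exists:
  assumes "noetherian_ring R" "\<aa> \<subseteq> carrier R" "carrier M \<noteq> {\<zero>\<^bsub>M\<^esub>}"
  shows "\<exists>xs. maximal_regular_sequence R \<aa> M xs"
proof -
  interpret noetherian_ring R by fact
  define A where "A xs = {r \<in> carrier R. \<forall>z\<in>carrier M. r \<odot>\<^bsub>M\<^esub> z \<in> sequence_span xs}" for xs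
  define X where "X = {xs. regular_sequence R M xs \<and> set xs \<subseteq> \<aa>}"
  have "\<not> carrier M \<subseteq> {\<zero>\<^bsub>M\<^esub>}" using assms(3) M.zero_closed by blast
  then have "[] \<in> X" by (simp add: X_def regular_sequence_iff sequence_span_Nil)
  then have "A ` X \<noteq> {}" by blast
  moreover have "ideal J R" if J: "J \<in> A ` X" for J
  proof -
    obtain xs where "J = A xs" "set xs \<subseteq> carrier R" using J assms(2) by (auto simp: X_def)
    then show ?thesis unfolding A_def using ideal_transporter[OF submodule_sequence_span] by simp
  qed
  ultimately obtain J where J: "J \<in> A ` X" "\<And>K. K \<in> A ` X \<Longrightarrow> J \<subseteq> K \<Longrightarrow> K = J"
    using ideal_set_has_maximal[of "A ` X"] by blast
  then obtain xs where xs: "xs \<in> X" "J = A xs" by blast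
  have xsR: "set xs \<subseteq> carrier R" using xs(1) assms(2) by (auto simp: X_def)
  have "\<not> regular_sequence R M (xs @ [y])" if y: "y \<in> \<aa>" for y
  proof
    assume reg: "regular_sequence R M (xs @ [y])"
    have yR: "y \<in> carrier R" using y assms(2) by blast
    have "xs @ [y] \<in> X" using reg xs(1) y by (simp add: X_def)
    moreover have "A xs \<subseteq> A (xs @ [y])" unfolding A_def using sequence_span_mono[of xs "xs @ [y]"] by auto
    ultimately have "A (xs @ [y]) = A xs" using J(2) xs(2) by blast
    moreover have "y \<in> A (xs @ [y])" unfolding A_def using yR sequence_span_mem[of y "xs @ [y]"] by simp
    ultimately have "y \<odot>\<^bsub>M\<^esub> z \<in> sequence_span xs" if "z \<in> carrier M" for z using that by (auto simp: A_def)
    then have "carrier M \<subseteq> sequence_span xs"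
      using reg[unfolded regular_sequence_iff] by (metis append_eq_conv_conj length_append_singleton lessI nth_append_length subsetI)
    then show False using xs(1) by (simp add: X_def regular_sequence_iff)
  qed
  then show ?thesis using xs(1) unfolding maximal_regular_sequence_def X_def by blast
qed

section \<open>Powers of an ideal and torsion with respect to its generators\<close>

lemma ideal_power:
  assumes "ideal \<aa> R"
  shows "ideal (\<aa> [^]\<^bsub>ideals_set R\<^esub> (t::nat)) R"
  by (induct t) (use assms in \<open>auto simp: nat_pow_def ideals_set_def R.oneideal R.ideal_prod_is_ideal\<close>)

lemma ideal_power_Suc: "\<aa> [^]\<^bsub>ideals_set R\<^esub> Suc t = ideal_prod R (\<aa> [^]\<^bsub>ideals_set R\<^esub> t) \<aa>"
  by (simp add: nat_pow_def ideals_set_def)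

lemma power_mem_ideal_power:
  assumes "ideal \<aa> R" "x \<in> \<aa>"
  shows "x [^] (t::nat) \<in> \<aa> [^]\<^bsub>ideals_set R\<^esub> t"
proof (induct t)
  case 0
  then show ?case by (simp add: nat_pow_def ideals_set_def)
next
  case (Suc t)
  have "x [^] t \<otimes> x \<in> ideal_prod R (\<aa> [^]\<^bsub>ideals_set R\<^esub> t) \<aa>"
    by (rule ideal_prod.prod[OF Suc assms(2)])
  then show ?case unfolding ideal_power_Suc by simp
qed

lemma submodule_annihilated:
  assumes "S \<subseteq> carrier R"
  shows "submodule {z \<in> carrier M. \<forall>r\<in>S. r \<odot>\<^bsub>M\<^esub> z = \<zero>\<^bsub>M\<^esub>} R M" (is "submodule ?T R M")
proof (rule submoduleI)
  have SC: "r \<in> carrier R" if "r \<in> S" for r using assms that by blast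
  show "a \<odot>\<^bsub>M\<^esub> z \<in> ?T" if "a \<in> carrier R" "z \<in> ?T" for a z
    using that SC smult_left_commute[of _ a z] by auto
qed (use assms in \<open>auto simp: smult_r_distr smult_r_minus minus_zero_eq\<close>)

text \<open>
  By induction on the sum of the exponents: multiplying \<open>z\<close> by a generator lowers one of them.
\<close>

lemma killed_by_ideal_power:
  assumes G: "finite G" "G \<subseteq> carrier R" and \<aa>: "\<aa> = Idl G"
    and z: "z \<in> carrier M" "\<And>g. g \<in> G \<Longrightarrow> \<exists>k::nat. (g [^] k) \<odot>\<^bsub>M\<^esub> z = \<zero>\<^bsub>M\<^esub>"
  shows "\<exists>t::nat. \<forall>r\<in>\<aa> [^]\<^bsub>ideals_set R\<^esub> t. r \<odot>\<^bsub>M\<^esub> z = \<zero>\<^bsub>M\<^esub>"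
proof -
  have ida: "ideal \<aa> R" unfolding \<aa> using R.genideal_ideal[OF G(2)] .
  define P where "P t = \<aa> [^]\<^bsub>ideals_set R\<^esub> t" for t :: nat
  have P: "ideal (P t) R" for t unfolding P_def by (rule ideal_power[OF ida])
  have PC: "P t \<subseteq> carrier R" for t using additive_subgroup.a_subset[OF ideal.axioms(1)[OF P]] .
  have PS: "P (Suc t) = ideal_prod R (P t) \<aa>" for t unfolding P_def by (rule ideal_power_Suc)
  have anti: "P u \<subseteq> P t" if "t \<le> u" for t u
    using lift_Suc_antimono_le[of P, OF _ that] R.ideal_prod_inter[OF P ida] PS by blast
  define T where "T t = {z \<in> carrier M. \<forall>r\<in>P t. r \<odot>\<^bsub>M\<^esub> z = \<zero>\<^bsub>M\<^esub>}" for t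
  have T: "submodule (T t) R M" for t unfolding T_def by (rule submodule_annihilated[OF PC])
  \<comment> \<open>If every generator moves z into one \<open>T t\<close>, then so does all of
    \<open>\<aa>\<close>, and the product of the t-th power with \<open>\<aa>\<close> kills
    z.\<close>
  have step: "\<exists>t. z \<in> T t" if zC: "z \<in> carrier M" and gz: "\<forall>g\<in>G. \<exists>t. g \<odot>\<^bsub>M\<^esub> z \<in> T t" for z
  proof -
    obtain \<tau> where \<tau>: "\<And>g. g \<in> G \<Longrightarrow> g \<odot>\<^bsub>M\<^esub> z \<in> T (\<tau> g)" using gz by metis
    \<comment> \<open>The sum serves as a common upper bound of the finitely many exponents.\<close>
    define t where "t = sum \<tau> G"
    have "g \<odot>\<^bsub>M\<^esub> z \<in> T t" if g: "g \<in> G" for g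
    proof -
      have "\<tau> g \<le> t" unfolding t_def using member_le_sum[OF g _ G(1), of \<tau>] by simp
      then show ?thesis using \<tau>[OF g] anti unfolding T_def by blast
    qed
    then have "G \<subseteq> {r \<in> carrier R. \<forall>z\<in>{z}. r \<odot>\<^bsub>M\<^esub> z \<in> T t}" using G(2) by blast
    then have a: "\<aa> \<subseteq> {r \<in> carrier R. \<forall>z\<in>{z}. r \<odot>\<^bsub>M\<^esub> z \<in> T t}"
      unfolding \<aa> using R.genideal_minimal[OF ideal_transporter[OF T, of "{z}"]] zC by simp
    have "r \<odot>\<^bsub>M\<^esub> z = \<zero>\<^bsub>M\<^esub>" if "r \<in> ideal_prod R (P t) \<aa>" for r
      using that
    proof (induct r rule: ideal_prod.induct)
      case (prod i j)
      have "j \<in> carrier R" "j \<odot>\<^bsub>M\<^esub> z \<in> T t" using a prod(2) by auto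
      moreover have "i \<in> carrier R" using PC prod(1) by blast
      ultimately show ?case using prod(1) zC smult_assoc1[of i j z] by (simp add: T_def)
    next
      case (sum r s)
      have "r \<in> carrier R" "s \<in> carrier R" using R.ideal_prod_in_carrier[OF P ida] sum(1,3) by blast+
      then show ?case using sum zC by (simp add: smult_l_distr)
    qed
    then have "z \<in> T (Suc t)" unfolding T_def PS using zC by blast
    then show ?thesis by blast
  qed
  have "\<exists>t. z \<in> T t" if "z \<in> carrier M" "\<forall>g\<in>G. (g [^] \<kappa> g) \<odot>\<^bsub>M\<^esub> z = \<zero>\<^bsub>M\<^esub>" for z and \<kappa> :: "'a \<Rightarrow> nat"
    using that
  proof (induct "sum \<kappa> G" arbitrary: z \<kappa> rule: less_induct)
    case less
    show ?case
    proof (rule step[OF less.prems(1)], rule ballI)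
      fix g assume g: "g \<in> G"
      have gR: "g \<in> carrier R" using G(2) g by blast
      show "\<exists>t. g \<odot>\<^bsub>M\<^esub> z \<in> T t"
      proof (cases "\<kappa> g")
        case 0
        then have "z = \<zero>\<^bsub>M\<^esub>" using less.prems g by force
        then show ?thesis using submodule_zero[OF T] gR by auto
      next
        case (Suc k)
        define \<kappa>' where "\<kappa>' = \<kappa>(g := k)"
        have "sum \<kappa>' G < sum \<kappa> G"
          using G(1) g Suc by (intro sum_strict_mono_ex1) (auto simp: \<kappa>'_def)
        moreover have "(h [^] \<kappa>' h) \<odot>\<^bsub>M\<^esub> (g \<odot>\<^bsub>M\<^esub> z) = \<zero>\<^bsub>M\<^esub>" if h: "h \<in> G" for h
        proof -
          have hR: "h \<in> carrier R" using G(2) h by blast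
          show ?thesis
          proof (cases "h = g")
            case True
            then show ?thesis
              using less.prems g Suc gR smult_pow_Suc[OF gR less.prems(1), of k]
                smult_left_commute[of g "g [^] k" z] by (force simp: \<kappa>'_def)
          next
            case False
            then show ?thesis
              using less.prems h hR gR smult_left_commute[of "h [^] \<kappa> h" g z] by (simp add: \<kappa>'_def)
          qed
        qed
        ultimately show ?thesis using less.hyps[of \<kappa>' "g \<odot>\<^bsub>M\<^esub> z"] gR less.prems(1) by simp
      qed
    qed
  qed
  moreover obtain \<kappa> :: "'a \<Rightarrow> nat" where "\<forall>g\<in>G. (g [^] \<kappa> g) \<odot>\<^bsub>M\<^esub> z = \<zero>\<^bsub>M\<^esub>" using z(2) by metis
  ultimately show ?thesis using z(1) unfolding T_def P_def by blast
qed

text \<open>If each generator has a power killing z, so does some power of the ideal, and hence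
  every element of the ideal has such a power. Allowing any \<open>W\<close> between the generators
  and the ideal makes room for adding the regular sequence to the generators.\<close>

lemma carrier_torsion_module:
  assumes G: "finite G" "G \<subseteq> carrier R" and \<aa>: "\<aa> = Idl G" and xs: "G \<subseteq> W" "W \<subseteq> \<aa>"
  shows "carrier (torsion_module R \<aa> M) = {z \<in> carrier M. \<forall>x\<in>W. \<exists>k::nat. (x [^] k) \<odot>\<^bsub>M\<^esub> z = \<zero>\<^bsub>M\<^esub>}"
proof -
  have ida: "ideal \<aa> R" unfolding \<aa> using R.genideal_ideal[OF G(2)] .
  have "\<exists>k::nat. (x [^] k) \<odot>\<^bsub>M\<^esub> z = \<zero>\<^bsub>M\<^esub>"
    if "\<forall>r\<in>\<aa> [^]\<^bsub>ideals_set R\<^esub> t. r \<odot>\<^bsub>M\<^esub> z = \<zero>\<^bsub>M\<^esub>" "x \<in> W" for z x and t :: nat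
    using that power_mem_ideal_power[OF ida, of x t] xs(2) by blast
  moreover have "\<exists>t::nat. \<forall>r\<in>\<aa> [^]\<^bsub>ideals_set R\<^esub> t. r \<odot>\<^bsub>M\<^esub> z = \<zero>\<^bsub>M\<^esub>"
    if "z \<in> carrier M" "\<forall>x\<in>W. \<exists>k::nat. (x [^] k) \<odot>\<^bsub>M\<^esub> z = \<zero>\<^bsub>M\<^esub>" for z
    using killed_by_ideal_power[OF G \<aa> that(1)] that(2) xs(1) by blast
  ultimately show ?thesis by (auto simp: torsion_module_def)
qed

lemma finite_Goldie_dimension_subquotient:
  assumes Z: "submodule Z R M" and U: "submodule U R M" and UZ: "U \<subseteq> Z"
    and fin: "finite_Goldie_pair R M Z U"
  shows "finite_Goldie_dimension R (quotient_module (M\<lparr>carrier := Z\<rparr>) U)"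
proof -
  interpret Z: module R "M\<lparr>carrier := Z\<rparr>"
    using submodule.submodule_is_module[OF Z module_axioms] .
  have "submodule U R (M\<lparr>carrier := Z\<rparr>)"
  proof (rule Z.submoduleI)
    \<comment> \<open>Negation is defined through the carrier, so on the restricted record it is
      rewritten as multiplication by -1 before closure of \<open>U\<close> is applied.\<close>
    show "\<ominus>\<^bsub>M\<lparr>carrier := Z\<rparr>\<^esub> a \<in> U" if a: "a \<in> U" for a
    proof -
      have "\<ominus>\<^bsub>M\<lparr>carrier := Z\<rparr>\<^esub> a = (\<ominus> \<one>) \<odot>\<^bsub>M\<lparr>carrier := Z\<rparr>\<^esub> a"
        using a UZ Z.smult_l_minus[of \<one> a] Z.smult_one[of a] by (simp add: subset_eq)
      then show ?thesis using submoduleE(4)[OF U _ a, of "\<ominus> \<one>"] by simp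
    qed
  qed (use UZ submodule_zero[OF U] submoduleE(4,5)[OF U] in auto)
  moreover have "span_chain R (M\<lparr>carrier := Z\<rparr>) U z n = span_chain R M U z n" for z n
    by (induct n) simp_all
  then have "finite_Goldie_pair R (M\<lparr>carrier := Z\<rparr>) (carrier (M\<lparr>carrier := Z\<rparr>)) U"
    using fin by (simp add: finite_Goldie_pair_def)
  ultimately show ?thesis using Z.finite_Goldie_dimension_quotient_module by blast
qed

end

theorem corollary2p4:
  fixes R :: "('a, 'r) ring_scheme"
    and \<aa> :: "'a set"
    and M :: "('a, 'm, 'x) module_scheme"
    and I :: "nat \<Rightarrow> ('a, 'e, 'y) module_scheme"
    and d :: "nat \<Rightarrow> 'e \<Rightarrow> 'e"
    and e :: "'m \<Rightarrow> 'e"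
  assumes "cring R" and "noetherian_ring R" and "\<one>\<^bsub>R\<^esub> \<noteq> \<zero>\<^bsub>R\<^esub>"
    and "ideal \<aa> R"
    and "module R M" and "finitely_generated_module R M" and "carrier M \<noteq> {\<zero>\<^bsub>M\<^esub>}"
    and "injective_resolution R M I d e"
  shows "finite_Goldie_dimension R (local_cohomology R \<aa> I d (module_grade R \<aa> M))"
proof -
  interpret N: module R M by fact
  interpret noetherian_ring R by fact
  have \<aa>R: "\<aa> \<subseteq> carrier R" using additive_subgroup.a_subset[OF ideal.axioms(1)[OF assms(4)]] .
  have "\<exists>n xs. maximal_regular_sequence R \<aa> M xs \<and> length xs = n"
    using N.maximal_regular_sequence_exists[OF assms(2) \<aa>R assms(7)] by blast
  then have "\<exists>xs. maximal_regular_sequence R \<aa> M xs \<and> length xs = module_grade R \<aa> M"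
    unfolding module_grade_def by (rule someI_ex)
  \<comment> \<open>From here on the grade is known as the length of this regular sequence in
    \<open>\<aa>\<close>.\<close>
  then obtain xs where xs: "regular_sequence R M xs" "set xs \<subseteq> \<aa>" "length xs = module_grade R \<aa> M"
    by (auto simp: maximal_regular_sequence_def)
  have xsR: "set xs \<subseteq> carrier R" using xs(2) \<aa>R by blast
  obtain G where G: "G \<subseteq> carrier R" "finite G" "\<aa> = Idl\<^bsub>R\<^esub> G" using finetely_gen[OF assms(4)] by blast
  obtain gs where gs: "set gs = G" using finite_list[OF G(2)] by blast
  have res: "\<And>n. injective_module R (I n)" "e \<in> module_hom R M (I 0)"
    "\<And>n. d n \<in> module_hom R (I n) (I (Suc n))" "inj_on e (carrier M)"
    "e ` carrier M = a_kernel (I 0) (I 1) (d 0)"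
    "\<And>n. d n ` carrier (I n) = a_kernel (I (Suc n)) (I (Suc (Suc n))) (d (Suc n))"
    using assms(8) by (auto simp: injective_resolution_def)
  interpret module_complex R I d
  proof (rule module_complex.intro)
    show "noetherian_ring R" by fact
    show "module R (I n)" for n using res(1) by (simp add: injective_module_def)
    show "d n \<in> module_hom R (I n) (I (Suc n))" for n by (rule res(3))
    show "d (Suc n) (d n z) = \<zero>\<^bsub>I (Suc (Suc n))\<^esub>" if "z \<in> carrier (I n)" for n z
      using res(6)[of n] that by (auto simp: a_kernel_def')
  qed
  define J where "J n = carrier (I n)" for n
  have J: "baer_complex J"
    using injective_module_imp_baer[OF res(1)] d_closed by (auto simp: baer_complex_def J_def)
  have "exact_at J n" if "n \<noteq> 0" for n
  proof -
    obtain m where "n = Suc m" using \<open>n \<noteq> 0\<close> not0_implies_Suc by blast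
    then show ?thesis
      using res(6)[of m] by (auto simp: exact_at_def cycles_def boundaries_Suc J_def a_kernel_def')
  qed
  note ex = this
  \<comment> \<open>The augmentation identifies M with the 0-cycles and its zero with the
    0-boundaries, so the induction along the sequence starts with p = 0.\<close>
  have "cycles J 0 = e ` carrier M" using res(5) by (auto simp: cycles_def J_def a_kernel_def')
  moreover have "boundaries J 0 = e ` {\<zero>\<^bsub>M\<^esub>}"
    using N.hom_zero[OF module_I res(2)] by (simp add: boundaries_0)
  ultimately have "regular_Goldie R (I 0) (cycles J 0) xs (boundaries J 0)"
    using N.regular_Goldie_image[OF module_I res(2,4) N.carrier_is_submodule N.submodule_zero_submodule xsR
      N.regular_sequence_imp_regular_Goldie[OF assms(2,6) xs(1)]] by simp
  note step1 = finite_Goldie_cohomology_regular[OF J xsR ex this]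
  define h where "h = length xs"
  \<comment> \<open>Torsion for \<open>xs\<close> brings the cohomology into degree h; torsion for
    the generators then cuts down to \<open>\<aa>\<close>-torsion. As \<open>xs\<close> lies in
    \<open>\<aa>\<close>, the outcome is exactly the \<open>\<aa>\<close>-torsion
    subcomplex.\<close>
  define J' where "J' = fold torsion_complex gs (fold torsion_complex xs J)"
  have "baer_complex J' \<and> finite_Goldie_pair R (I h) (cycles J' h) (boundaries J' h)"
    unfolding J'_def using step1 gs G(1)
    by (intro finite_Goldie_cohomology_torsion) (auto simp: h_def)
  then have J': "baer_complex J'" and fin: "finite_Goldie_pair R (I h) (cycles J' h) (boundaries J' h)" by auto
  have "carrier (torsion_module R \<aa> (I n)) = J' n" for n
  proof -
    have W: "G \<subseteq> set xs \<union> set gs" "set xs \<union> set gs \<subseteq> \<aa>"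
      using gs xs(2) N.R.genideal_self[OF G(1)] G(3) by auto
    show ?thesis
      unfolding M.carrier_torsion_module[OF G(2,1,3) W]
      by (auto simp: J'_def fold_torsion_complex_mem J_def)
  qed
  then have T: "torsion_module R \<aa> (I n) = (I n)\<lparr>carrier := J' n\<rparr>" for n
    by (simp add: torsion_module_def)
  have "a_kernel (torsion_module R \<aa> (I h)) (torsion_module R \<aa> (I (Suc h))) (d h) = cycles J' h"
    unfolding T by (simp add: a_kernel_def' cycles_def)
  moreover have "coboundaries (\<lambda>n. torsion_module R \<aa> (I n)) d h = boundaries J' h"
    unfolding T by (cases h) (simp_all add: coboundaries_def boundaries_def)
  ultimately have "local_cohomology R \<aa> I d h = quotient_module ((I h)\<lparr>carrier := cycles J' h\<rparr>) (boundaries J' h)"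
    unfolding local_cohomology_def cohomology_module_def by (simp add: T)
  then show ?thesis
    using M.finite_Goldie_dimension_subquotient[OF submodule_cycles[OF J'] submodule_boundaries[OF J']
      boundaries_subset_cycles[OF J'] fin] xs(3) by (simp add: h_def)
qed

end
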